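(* Let $\mathbf{k}$ be an algebraically closed field of characteristic $p>0$, let $\mathcal{C}$ be a symmetric tensor category over $\mathbf{k}$, and let $0\to X\to Y\to Z\to 0$ be a short exact sequence in $\mathcal{C}$. Then for each $1\le i\le p-1$ there is a 6-periodic long exact sequence $$\cdots\to G_i(X)\to G_i(Y)\to G_i(Z)\to G_{p-i}(X)\to G_{p-i}(Y)\to G_{p-i}(Z)\to G_i(X)\to\cdots$$ in which the maps $G_j(X)\to G_j(Y)\to G_j(Z)$ are those induced by $X\to Y\to Z$. In particular, the functor $X\mapsto G_i(X)$ is exact in the middle for all $i$ (i.e. $G_i(X)\to G_i(Y)\to G_i(Z)$ is exact at $G_i(Y)$). Therefore the composition series of $G_i(Y)$ is dominated by the composition series of $G_i(X)\oplus G_i(Z)$ as objects of $\mathcal{C}$ (i.e. each simple object occurs in $G_i(Y)$ with multiplicity at most that in $G_i(X)\oplus G_i(Z)$).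
   Context: A tensor category over $\mathbf{k}$ is a $\mathbf{k}$-linear abelian rigid monoidal category with finite-length objects, finite-dimensional Hom spaces, $\mathbf{k}$-bilinear tensor product and $\mathrm{End}(\mathbf{1})=\mathbf{k}$. For $X\in\mathcal{C}$ let $c$ be the cyclic permutation $(1\,2\cdots p)$ acting on $X^{\otimes p}$ via the symmetric structure and let $D=1-c$, so $D^p=0$. For $i=1,\dots,p-1$ put $$G_i(X)=\mathrm{Ker}(D^i)/\mathrm{Im}(D^{p-i}),$$ a subquotient of $X^{\otimes p}$ in $\mathcal{C}$; $G_i$ is made a functor on $\mathcal{C}$ by letting $G_i(f)$ be induced by $f^{\otimes p}$. *)

theory Defs
  imports "HOL-Computational_Algebra.Computational_Algebra"
begin

section \<open>Linear categories\<close>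

text \<open>
  The objects are the elements of the type \<open>'o\<close>.  The Hom-spaces are subspaces of one ambient
  vector space \<open>'m\<close>; every linear category arises like this, with \<open>'m\<close> the direct sum of all its
  Hom-spaces and composition and tensor product extended bilinearly.  All zero morphisms are then
  the same element \<open>0\<close>, and an element of \<open>'m\<close> does not determine its source and target, which is
  why they are passed as arguments below.  Nothing is required of \<open>mcomp\<close> outside
  composable pairs, and \<open>mcomp C g f\<close> means \<open>g\<close> after \<open>f\<close>.
\<close>

record ('k, 'o, 'm) linear_cat =
  Hom :: "'o \<Rightarrow> 'o \<Rightarrow> 'm set"
  mcomp :: "'m \<Rightarrow> 'm \<Rightarrow> 'm"  (infixr \<open>\<cdot>\<index>\<close> 70)
  idm :: "'o \<Rightarrow> 'm"
  scal :: "'k \<Rightarrow> 'm \<Rightarrow> 'm"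

locale linear_category = vector_space "scal C"
  for C :: "('k::field, 'o, 'm::ab_group_add, 'z) linear_cat_scheme" (structure) +
  assumes subspace_Hom: "subspace (Hom C X Y)"
    and idm_in_Hom: "idm C X \<in> Hom C X X"
    and comp_in_Hom: "\<lbrakk>f \<in> Hom C X Y; g \<in> Hom C Y Z\<rbrakk> \<Longrightarrow> g \<cdot> f \<in> Hom C X Z"
    and comp_assoc: "\<lbrakk>f \<in> Hom C W X; g \<in> Hom C X Y; h \<in> Hom C Y Z\<rbrakk> \<Longrightarrow> (h \<cdot> g) \<cdot> f = h \<cdot> (g \<cdot> f)"
    and comp_idm: "f \<in> Hom C X Y \<Longrightarrow> f \<cdot> idm C X = f"
    and idm_comp: "f \<in> Hom C X Y \<Longrightarrow> idm C Y \<cdot> f = f"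
    and comp_add_left: "\<lbrakk>f \<in> Hom C X Y; g \<in> Hom C Y Z; h \<in> Hom C Y Z\<rbrakk>
          \<Longrightarrow> (g + h) \<cdot> f = g \<cdot> f + h \<cdot> f"
    and comp_add_right: "\<lbrakk>f \<in> Hom C X Y; g \<in> Hom C X Y; h \<in> Hom C Y Z\<rbrakk>
          \<Longrightarrow> h \<cdot> (f + g) = h \<cdot> f + h \<cdot> g"
    and comp_scal_left: "\<lbrakk>f \<in> Hom C X Y; g \<in> Hom C Y Z\<rbrakk>
          \<Longrightarrow> scal C a g \<cdot> f = scal C a (g \<cdot> f)"
    and comp_scal_right: "\<lbrakk>f \<in> Hom C X Y; g \<in> Hom C Y Z\<rbrakk>
          \<Longrightarrow> g \<cdot> scal C a f = scal C a (g \<cdot> f)"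

definition monic :: "('k, 'o, 'm, 'z) linear_cat_scheme \<Rightarrow> 'o \<Rightarrow> 'o \<Rightarrow> 'm \<Rightarrow> bool" where
  "monic C X Y f \<longleftrightarrow> f \<in> Hom C X Y \<and>
     (\<forall>W. \<forall>u\<in>Hom C W X. \<forall>v\<in>Hom C W X. f \<cdot>\<^bsub>C\<^esub> u = f \<cdot>\<^bsub>C\<^esub> v \<longrightarrow> u = v)"

definition epic :: "('k, 'o, 'm, 'z) linear_cat_scheme \<Rightarrow> 'o \<Rightarrow> 'o \<Rightarrow> 'm \<Rightarrow> bool" where
  "epic C X Y f \<longleftrightarrow> f \<in> Hom C X Y \<and>
     (\<forall>W. \<forall>u\<in>Hom C Y W. \<forall>v\<in>Hom C Y W. u \<cdot>\<^bsub>C\<^esub> f = v \<cdot>\<^bsub>C\<^esub> f \<longrightarrow> u = v)"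

definition inverse_mor :: "('k, 'o, 'm, 'z) linear_cat_scheme \<Rightarrow> 'o \<Rightarrow> 'o \<Rightarrow> 'm \<Rightarrow> 'm \<Rightarrow> bool" where
  "inverse_mor C X Y f g \<longleftrightarrow> f \<in> Hom C X Y \<and> g \<in> Hom C Y X \<and>
     g \<cdot>\<^bsub>C\<^esub> f = idm C X \<and> f \<cdot>\<^bsub>C\<^esub> g = idm C Y"

definition iso_mor :: "('k, 'o, 'm, 'z) linear_cat_scheme \<Rightarrow> 'o \<Rightarrow> 'o \<Rightarrow> 'm \<Rightarrow> bool" where
  "iso_mor C X Y f \<longleftrightarrow> (\<exists>g. inverse_mor C X Y f g)"

definition inv_mor :: "('k, 'o, 'm, 'z) linear_cat_scheme \<Rightarrow> 'o \<Rightarrow> 'o \<Rightarrow> 'm \<Rightarrow> 'm" where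
  "inv_mor C X Y f = (THE g. inverse_mor C X Y f g)"

definition isomorphic :: "('k, 'o, 'm, 'z) linear_cat_scheme \<Rightarrow> 'o \<Rightarrow> 'o \<Rightarrow> bool" where
  "isomorphic C X Y \<longleftrightarrow> (\<exists>f. iso_mor C X Y f)"

definition zero_object :: "('k, 'o, 'm::ab_group_add, 'z) linear_cat_scheme \<Rightarrow> 'o \<Rightarrow> bool" where
  "zero_object C Z \<longleftrightarrow> (\<forall>X. Hom C X Z = {0} \<and> Hom C Z X = {0})"

definition biproduct ::
    "('k, 'o, 'm::ab_group_add, 'z) linear_cat_scheme \<Rightarrow> 'o \<Rightarrow> 'o \<Rightarrow> 'o \<Rightarrow> bool" where
  "biproduct C X Y P \<longleftrightarrow>
     (\<exists>i1\<in>Hom C X P. \<exists>i2\<in>Hom C Y P. \<exists>p1\<in>Hom C P X. \<exists>p2\<in>Hom C P Y.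
        p1 \<cdot>\<^bsub>C\<^esub> i1 = idm C X \<and> p2 \<cdot>\<^bsub>C\<^esub> i2 = idm C Y \<and>
        p1 \<cdot>\<^bsub>C\<^esub> i2 = 0 \<and> p2 \<cdot>\<^bsub>C\<^esub> i1 = 0 \<and>
        i1 \<cdot>\<^bsub>C\<^esub> p1 + i2 \<cdot>\<^bsub>C\<^esub> p2 = idm C P)"

definition is_kernel ::
    "('k, 'o, 'm::ab_group_add, 'z) linear_cat_scheme \<Rightarrow> 'o \<Rightarrow> 'o \<Rightarrow> 'm \<Rightarrow> 'o \<Rightarrow> 'm \<Rightarrow> bool" where
  "is_kernel C X Y f K k \<longleftrightarrow> f \<in> Hom C X Y \<and> k \<in> Hom C K X \<and> f \<cdot>\<^bsub>C\<^esub> k = 0 \<and>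
     (\<forall>W. \<forall>h\<in>Hom C W X. f \<cdot>\<^bsub>C\<^esub> h = 0 \<longrightarrow> (\<exists>!u. u \<in> Hom C W K \<and> k \<cdot>\<^bsub>C\<^esub> u = h))"

definition is_cokernel ::
    "('k, 'o, 'm::ab_group_add, 'z) linear_cat_scheme \<Rightarrow> 'o \<Rightarrow> 'o \<Rightarrow> 'm \<Rightarrow> 'o \<Rightarrow> 'm \<Rightarrow> bool" where
  "is_cokernel C X Y f Q q \<longleftrightarrow> f \<in> Hom C X Y \<and> q \<in> Hom C Y Q \<and> q \<cdot>\<^bsub>C\<^esub> f = 0 \<and>
     (\<forall>W. \<forall>h\<in>Hom C Y W. h \<cdot>\<^bsub>C\<^esub> f = 0 \<longrightarrow> (\<exists>!u. u \<in> Hom C Q W \<and> u \<cdot>\<^bsub>C\<^esub> q = h))"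

locale abelian_category = linear_category +
  assumes zero_object_exists: "\<exists>Z. zero_object C Z"
    and biproduct_exists: "\<exists>P. biproduct C X Y P"
    and kernel_exists: "f \<in> Hom C X Y \<Longrightarrow> \<exists>K k. is_kernel C X Y f K k"
    and cokernel_exists: "f \<in> Hom C X Y \<Longrightarrow> \<exists>Q q. is_cokernel C X Y f Q q"
    and monic_normal: "monic C X Y f \<Longrightarrow> \<exists>Z g. is_kernel C Y Z g X f"
    and epic_normal: "epic C X Y f \<Longrightarrow> \<exists>W g. is_cokernel C W X g Y f"


section \<open>Kernels, images and exactness\<close>

text \<open>Kernels, cokernels and images are arbitrarily but globally chosen.\<close>

definition Ker :: "('k, 'o, 'm::ab_group_add, 'z) linear_cat_scheme \<Rightarrow> 'o \<Rightarrow> 'o \<Rightarrow> 'm \<Rightarrow> 'o" where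
  "Ker C X Y f = (SOME K. \<exists>k. is_kernel C X Y f K k)"

definition ker_map :: "('k, 'o, 'm::ab_group_add, 'z) linear_cat_scheme \<Rightarrow> 'o \<Rightarrow> 'o \<Rightarrow> 'm \<Rightarrow> 'm" where
  "ker_map C X Y f = (SOME k. is_kernel C X Y f (Ker C X Y f) k)"

definition Coker :: "('k, 'o, 'm::ab_group_add, 'z) linear_cat_scheme \<Rightarrow> 'o \<Rightarrow> 'o \<Rightarrow> 'm \<Rightarrow> 'o" where
  "Coker C X Y f = (SOME Q. \<exists>q. is_cokernel C X Y f Q q)"

definition coker_map :: "('k, 'o, 'm::ab_group_add, 'z) linear_cat_scheme \<Rightarrow> 'o \<Rightarrow> 'o \<Rightarrow> 'm \<Rightarrow> 'm" where
  "coker_map C X Y f = (SOME q. is_cokernel C X Y f (Coker C X Y f) q)"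

definition image_obj :: "('k, 'o, 'm::ab_group_add, 'z) linear_cat_scheme \<Rightarrow> 'o \<Rightarrow> 'o \<Rightarrow> 'm \<Rightarrow> 'o" where
  "image_obj C X Y f = Ker C Y (Coker C X Y f) (coker_map C X Y f)"

definition image_map :: "('k, 'o, 'm::ab_group_add, 'z) linear_cat_scheme \<Rightarrow> 'o \<Rightarrow> 'o \<Rightarrow> 'm \<Rightarrow> 'm" where
  "image_map C X Y f = ker_map C Y (Coker C X Y f) (coker_map C X Y f)"

text \<open>Exactness of \<open>X \<rightarrow> Y \<rightarrow> Z\<close> at \<open>Y\<close>: the image of \<open>f\<close>, as a subobject of \<open>Y\<close>, is the kernel of \<open>g\<close>.\<close>

definition exact_at ::
    "('k, 'o, 'm::ab_group_add, 'z) linear_cat_scheme \<Rightarrow> 'o \<Rightarrow> 'm \<Rightarrow> 'o \<Rightarrow> 'm \<Rightarrow> 'o \<Rightarrow> bool" where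
  "exact_at C X f Y g Z \<longleftrightarrow> f \<in> Hom C X Y \<and> g \<in> Hom C Y Z \<and>
     is_kernel C Y Z g (image_obj C X Y f) (image_map C X Y f)"

definition short_exact ::
    "('k, 'o, 'm::ab_group_add, 'z) linear_cat_scheme \<Rightarrow> 'o \<Rightarrow> 'm \<Rightarrow> 'o \<Rightarrow> 'm \<Rightarrow> 'o \<Rightarrow> bool" where
  "short_exact C X f Y g Z \<longleftrightarrow> monic C X Y f \<and> exact_at C X f Y g Z \<and> epic C Y Z g"


section \<open>Composition series\<close>

definition simple_object :: "('k, 'o, 'm::ab_group_add, 'z) linear_cat_scheme \<Rightarrow> 'o \<Rightarrow> bool" where
  "simple_object C S \<longleftrightarrow> \<not> zero_object C S \<and>
     (\<forall>T f. monic C T S f \<longrightarrow> zero_object C T \<or> iso_mor C T S f)"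

text \<open>
  \<open>composition_series C X Ss\<close>: there is a filtration \<open>0 = X\<^sub>0 \<subseteq> X\<^sub>1 \<subseteq> \<dots> \<subseteq> X\<^sub>n = X\<close> whose successive
  quotients are the simple objects in the list \<open>Ss\<close>, topmost first.
\<close>

inductive composition_series ::
    "('k, 'o, 'm::ab_group_add, 'z) linear_cat_scheme \<Rightarrow> 'o \<Rightarrow> 'o list \<Rightarrow> bool" for C where
  zero: "zero_object C X \<Longrightarrow> composition_series C X []"
| step: "\<lbrakk>composition_series C A Ss; short_exact C A f X g S; simple_object C S\<rbrakk>
         \<Longrightarrow> composition_series C X (S # Ss)"

definition occurrences :: "('k, 'o, 'm, 'z) linear_cat_scheme \<Rightarrow> 'o \<Rightarrow> 'o list \<Rightarrow> nat" where
  "occurrences C S Ss = length (filter (isomorphic C S) Ss)"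


section \<open>Symmetric tensor categories\<close>

record ('k, 'o, 'm) symm_tensor_cat = "('k, 'o, 'm) linear_cat" +
  tens :: "'o \<Rightarrow> 'o \<Rightarrow> 'o"  (infixr \<open>\<otimes>\<index>\<close> 75)
  tensm :: "'m \<Rightarrow> 'm \<Rightarrow> 'm"  (infixr \<open>\<boxtimes>\<index>\<close> 75)
  unit :: "'o"  (\<open>\<one>\<index>\<close>)
  assoc :: "'o \<Rightarrow> 'o \<Rightarrow> 'o \<Rightarrow> 'm"
  lunit :: "'o \<Rightarrow> 'm"
  runit :: "'o \<Rightarrow> 'm"
  braid :: "'o \<Rightarrow> 'o \<Rightarrow> 'm"

text \<open>\<open>Xs\<close> is a left dual of \<open>X\<close>, equivalently \<open>X\<close> is a right dual of \<open>Xs\<close>; the unit constraints are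
  moved to the right-hand side of the two zigzag identities.\<close>

definition left_dual :: "('k, 'o, 'm, 'z) symm_tensor_cat_scheme \<Rightarrow> 'o \<Rightarrow> 'o \<Rightarrow> bool" where
  "left_dual C X Xs \<longleftrightarrow>
     (\<exists>ev\<in>Hom C (Xs \<otimes>\<^bsub>C\<^esub> X) \<one>\<^bsub>C\<^esub>. \<exists>coev\<in>Hom C \<one>\<^bsub>C\<^esub> (X \<otimes>\<^bsub>C\<^esub> Xs).
        runit C X \<cdot>\<^bsub>C\<^esub> (idm C X \<boxtimes>\<^bsub>C\<^esub> ev) \<cdot>\<^bsub>C\<^esub> assoc C X Xs X \<cdot>\<^bsub>C\<^esub> (coev \<boxtimes>\<^bsub>C\<^esub> idm C X)
          = lunit C X \<and>
        lunit C Xs \<cdot>\<^bsub>C\<^esub> (ev \<boxtimes>\<^bsub>C\<^esub> idm C Xs)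
          \<cdot>\<^bsub>C\<^esub> inv_mor C ((Xs \<otimes>\<^bsub>C\<^esub> X) \<otimes>\<^bsub>C\<^esub> Xs) (Xs \<otimes>\<^bsub>C\<^esub> (X \<otimes>\<^bsub>C\<^esub> Xs)) (assoc C Xs X Xs)
          \<cdot>\<^bsub>C\<^esub> (idm C Xs \<boxtimes>\<^bsub>C\<^esub> coev)
          = runit C Xs)"

locale tensor_category = abelian_category C
  for C :: "('k::field, 'o, 'm::ab_group_add, 'z) symm_tensor_cat_scheme" (structure) +
  assumes finite_length: "\<exists>Ss. composition_series C X Ss"
    and finite_dim_Hom: "\<exists>B. finite B \<and> Hom C X Y = span B"
    and tensm_in_Hom: "\<lbrakk>f \<in> Hom C X Y; g \<in> Hom C X' Y'\<rbrakk>
          \<Longrightarrow> f \<boxtimes> g \<in> Hom C (X \<otimes> X') (Y \<otimes> Y')"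
    and tensm_idm: "idm C X \<boxtimes> idm C Y = idm C (X \<otimes> Y)"
    and tensm_comp: "\<lbrakk>f \<in> Hom C X Y; g \<in> Hom C Y Z; f' \<in> Hom C X' Y'; g' \<in> Hom C Y' Z'\<rbrakk>
          \<Longrightarrow> (g \<cdot> f) \<boxtimes> (g' \<cdot> f') = (g \<boxtimes> g') \<cdot> (f \<boxtimes> f')"
    and tensm_add_left: "\<lbrakk>f \<in> Hom C X Y; f' \<in> Hom C X Y; g \<in> Hom C X' Y'\<rbrakk>
          \<Longrightarrow> (f + f') \<boxtimes> g = f \<boxtimes> g + f' \<boxtimes> g"
    and tensm_add_right: "\<lbrakk>f \<in> Hom C X Y; g \<in> Hom C X' Y'; g' \<in> Hom C X' Y'\<rbrakk>
          \<Longrightarrow> f \<boxtimes> (g + g') = f \<boxtimes> g + f \<boxtimes> g'"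
    and tensm_scal_left: "\<lbrakk>f \<in> Hom C X Y; g \<in> Hom C X' Y'\<rbrakk>
          \<Longrightarrow> scal C a f \<boxtimes> g = scal C a (f \<boxtimes> g)"
    and tensm_scal_right: "\<lbrakk>f \<in> Hom C X Y; g \<in> Hom C X' Y'\<rbrakk>
          \<Longrightarrow> f \<boxtimes> scal C a g = scal C a (f \<boxtimes> g)"
    and assoc_iso: "iso_mor C ((X \<otimes> Y) \<otimes> Z) (X \<otimes> (Y \<otimes> Z)) (assoc C X Y Z)"
    and assoc_natural: "\<lbrakk>f \<in> Hom C X X'; g \<in> Hom C Y Y'; h \<in> Hom C Z Z'\<rbrakk>
          \<Longrightarrow> assoc C X' Y' Z' \<cdot> ((f \<boxtimes> g) \<boxtimes> h) = (f \<boxtimes> (g \<boxtimes> h)) \<cdot> assoc C X Y Z"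
    and lunit_iso: "iso_mor C (\<one> \<otimes> X) X (lunit C X)"
    and lunit_natural: "f \<in> Hom C X Y \<Longrightarrow> lunit C Y \<cdot> (idm C \<one> \<boxtimes> f) = f \<cdot> lunit C X"
    and runit_iso: "iso_mor C (X \<otimes> \<one>) X (runit C X)"
    and runit_natural: "f \<in> Hom C X Y \<Longrightarrow> runit C Y \<cdot> (f \<boxtimes> idm C \<one>) = f \<cdot> runit C X"
    and pentagon: "assoc C W X (Y \<otimes> Z) \<cdot> assoc C (W \<otimes> X) Y Z
          = (idm C W \<boxtimes> assoc C X Y Z) \<cdot> assoc C W (X \<otimes> Y) Z \<cdot> (assoc C W X Y \<boxtimes> idm C Z)"
    and triangle: "(idm C X \<boxtimes> lunit C Y) \<cdot> assoc C X \<one> Y = runit C X \<boxtimes> idm C Y"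
    and rigid_left: "\<exists>Xs. left_dual C X Xs"
    and rigid_right: "\<exists>Xs. left_dual C Xs X"
    and End_unit: "bij_betw (\<lambda>a. scal C a (idm C \<one>)) UNIV (Hom C \<one> \<one>)"

locale symmetric_tensor_category = tensor_category +
  assumes braid_in_Hom: "braid C X Y \<in> Hom C (X \<otimes> Y) (Y \<otimes> X)"
    and braid_natural: "\<lbrakk>f \<in> Hom C X X'; g \<in> Hom C Y Y'\<rbrakk>
          \<Longrightarrow> braid C X' Y' \<cdot> (f \<boxtimes> g) = (g \<boxtimes> f) \<cdot> braid C X Y"
    and braid_symmetric: "braid C Y X \<cdot> braid C X Y = idm C (X \<otimes> Y)"
    and hexagon: "assoc C Y Z X \<cdot> braid C X (Y \<otimes> Z) \<cdot> assoc C X Y Z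
          = (idm C Y \<boxtimes> braid C X Z) \<cdot> assoc C Y X Z \<cdot> (braid C X Y \<boxtimes> idm C Z)"


section \<open>The functors G\<close>

text \<open>Tensor powers are bracketed to the right and end in the unit object: \<open>X \<otimes> (X \<otimes> (\<dots> \<otimes> \<one>))\<close>.\<close>

primrec tpow :: "('k, 'o, 'm, 'z) symm_tensor_cat_scheme \<Rightarrow> 'o \<Rightarrow> nat \<Rightarrow> 'o" where
  "tpow C X 0 = \<one>\<^bsub>C\<^esub>"
| "tpow C X (Suc n) = X \<otimes>\<^bsub>C\<^esub> tpow C X n"

primrec tpow_map :: "('k, 'o, 'm, 'z) symm_tensor_cat_scheme \<Rightarrow> 'm \<Rightarrow> nat \<Rightarrow> 'm" where
  "tpow_map C f 0 = idm C \<one>\<^bsub>C\<^esub>"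
| "tpow_map C f (Suc n) = f \<boxtimes>\<^bsub>C\<^esub> tpow_map C f n"

text \<open>The symmetry exchanging the first two factors of \<open>X \<otimes> (X \<otimes> W)\<close>.\<close>

definition swap_front :: "('k, 'o, 'm, 'z) symm_tensor_cat_scheme \<Rightarrow> 'o \<Rightarrow> 'o \<Rightarrow> 'm" where
  "swap_front C X W = assoc C X X W \<cdot>\<^bsub>C\<^esub> (braid C X X \<boxtimes>\<^bsub>C\<^esub> idm C W)
     \<cdot>\<^bsub>C\<^esub> inv_mor C ((X \<otimes>\<^bsub>C\<^esub> X) \<otimes>\<^bsub>C\<^esub> W) (X \<otimes>\<^bsub>C\<^esub> (X \<otimes>\<^bsub>C\<^esub> W)) (assoc C X X W)"

text \<open>
  The action of the cycle \<open>(1 2 \<dots> n)\<close> on the \<open>n\<close>-th tensor power, through the factorisation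
  \<open>(1 2 \<dots> n) = (1 2) (2 3 \<dots> n)\<close>: the cycle \<open>(2 3 \<dots> n)\<close> acts by the identity on the first factor
  and by the shorter cycle on the remaining ones.  The opposite convention for the action
  replaces the cycle by its inverse, which changes none of the kernels and images below.
\<close>

fun cyc :: "('k, 'o, 'm, 'z) symm_tensor_cat_scheme \<Rightarrow> 'o \<Rightarrow> nat \<Rightarrow> 'm" where
  "cyc C X 0 = idm C (tpow C X 0)"
| "cyc C X (Suc 0) = idm C (tpow C X (Suc 0))"
| "cyc C X (Suc (Suc n)) = swap_front C X (tpow C X n) \<cdot>\<^bsub>C\<^esub> (idm C X \<boxtimes>\<^bsub>C\<^esub> cyc C X (Suc n))"

primrec endo_pow :: "('k, 'o, 'm, 'z) linear_cat_scheme \<Rightarrow> 'o \<Rightarrow> 'm \<Rightarrow> nat \<Rightarrow> 'm" where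
  "endo_pow C A f 0 = idm C A"
| "endo_pow C A f (Suc n) = f \<cdot>\<^bsub>C\<^esub> endo_pow C A f n"

definition Dpow :: "('k, 'o, 'm::ab_group_add, 'z) symm_tensor_cat_scheme \<Rightarrow> nat \<Rightarrow> 'o \<Rightarrow> nat \<Rightarrow> 'm" where
  "Dpow C p X i = endo_pow C (tpow C X p) (idm C (tpow C X p) - cyc C X p) i"

definition KerD :: "('k, 'o, 'm::ab_group_add, 'z) symm_tensor_cat_scheme \<Rightarrow> nat \<Rightarrow> nat \<Rightarrow> 'o \<Rightarrow> 'o" where
  "KerD C p i X = Ker C (tpow C X p) (tpow C X p) (Dpow C p X i)"

definition kerD :: "('k, 'o, 'm::ab_group_add, 'z) symm_tensor_cat_scheme \<Rightarrow> nat \<Rightarrow> nat \<Rightarrow> 'o \<Rightarrow> 'm" where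
  "kerD C p i X = ker_map C (tpow C X p) (tpow C X p) (Dpow C p X i)"

definition ImD :: "('k, 'o, 'm::ab_group_add, 'z) symm_tensor_cat_scheme \<Rightarrow> nat \<Rightarrow> nat \<Rightarrow> 'o \<Rightarrow> 'o" where
  "ImD C p i X = image_obj C (tpow C X p) (tpow C X p) (Dpow C p X i)"

definition imD :: "('k, 'o, 'm::ab_group_add, 'z) symm_tensor_cat_scheme \<Rightarrow> nat \<Rightarrow> nat \<Rightarrow> 'o \<Rightarrow> 'm" where
  "imD C p i X = image_map C (tpow C X p) (tpow C X p) (Dpow C p X i)"

text \<open>The inclusion of \<open>Im (D\<^bsup>p-i\<^esup>)\<close> into \<open>Ker (D\<^bsup>i\<^esup>)\<close>, as subobjects of the tensor power.\<close>

definition im_ker_incl ::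
    "('k, 'o, 'm::ab_group_add, 'z) symm_tensor_cat_scheme \<Rightarrow> nat \<Rightarrow> nat \<Rightarrow> 'o \<Rightarrow> 'm" where
  "im_ker_incl C p i X =
     (THE j. j \<in> Hom C (ImD C p (p - i) X) (KerD C p i X) \<and>
             kerD C p i X \<cdot>\<^bsub>C\<^esub> j = imD C p (p - i) X)"

definition G :: "('k, 'o, 'm::ab_group_add, 'z) symm_tensor_cat_scheme \<Rightarrow> nat \<Rightarrow> nat \<Rightarrow> 'o \<Rightarrow> 'o" where
  "G C p i X = Coker C (ImD C p (p - i) X) (KerD C p i X) (im_ker_incl C p i X)"

definition G_proj :: "('k, 'o, 'm::ab_group_add, 'z) symm_tensor_cat_scheme \<Rightarrow> nat \<Rightarrow> nat \<Rightarrow> 'o \<Rightarrow> 'm" where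
  "G_proj C p i X = coker_map C (ImD C p (p - i) X) (KerD C p i X) (im_ker_incl C p i X)"

text \<open>The value of the functor \<open>G\<close> on \<open>f : X \<rightarrow> Y\<close>: the \<open>p\<close>-th tensor power of \<open>f\<close> restricts to a
  morphism \<open>u\<close> between the kernels, which descends to the quotients.\<close>

definition G_map ::
    "('k, 'o, 'm::ab_group_add, 'z) symm_tensor_cat_scheme \<Rightarrow> nat \<Rightarrow> nat \<Rightarrow> 'o \<Rightarrow> 'o \<Rightarrow> 'm \<Rightarrow> 'm" where
  "G_map C p i X Y f =
     (THE h. h \<in> Hom C (G C p i X) (G C p i Y) \<and>
        (\<exists>u\<in>Hom C (KerD C p i X) (KerD C p i Y).
           kerD C p i Y \<cdot>\<^bsub>C\<^esub> u = tpow_map C f p \<cdot>\<^bsub>C\<^esub> kerD C p i X \<and>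
           h \<cdot>\<^bsub>C\<^esub> G_proj C p i X = G_proj C p i Y \<cdot>\<^bsub>C\<^esub> u))"

end

theory Submission
  imports Defs
begin

text \<open>
  Statements about subobjects of \<open>Y\<^bsup>\<otimes>p\<^esup>\<close> are checked on local elements: morphisms \<open>W \<rightarrow> Y\<^bsup>\<otimes>p\<^esup>\<close>, where an
  existence claim may be met after precomposition with an epimorphism \<open>W' \<rightarrow> W\<close>.

  Let \<open>F\<^sub>j \<subseteq> Y\<^bsup>\<otimes>p\<^esup>\<close> be the sum of the tensor products of \<open>p\<close> factors \<open>X\<close> or \<open>Y\<close> with at least \<open>j\<close> factors
  \<open>X\<close>, so that \<open>F\<^sub>1\<close> is the kernel of \<open>Y\<^bsup>\<otimes>p\<^esup> \<rightarrow> Z\<^bsup>\<otimes>p\<^esup>\<close> and \<open>F\<^sub>p = X\<^bsup>\<otimes>p\<^esup>\<close>.  On \<open>F\<^sub>j / F\<^sub>j\<^sub>+\<^sub>1\<close> with \<open>0 < j < p\<close>, the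
  projections \<open>P\<^sub>k\<close> onto the words with an \<open>X\<close> in position \<open>k\<close> are conjugate under the cycle and add up to
  the invertible scalar \<open>j\<close>; hence every invariant is a norm, i.e. \<open>Ker D = Im D\<^bsup>p-1\<^esup>\<close>, which implies
  \<open>Ker D\<^sup>i = Im D\<^bsup>p-i\<^esup>\<close> for all \<open>i\<close>.  So \<open>F\<^sub>1 / X\<^bsup>\<otimes>p\<^esup>\<close> has no cohomology, and the snake lemma for
  \<open>0 \<rightarrow> F\<^sub>1 \<rightarrow> Y\<^bsup>\<otimes>p\<^esup> \<rightarrow> Z\<^bsup>\<otimes>p\<^esup> \<rightarrow> 0\<close> with its \<open>2\<close>-periodic differentials \<open>D\<^sup>i, D\<^bsup>p-i\<^esup>\<close> gives the sequence.
\<close>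

section \<open>Abelian categories by local elements\<close>

text \<open>The graded pieces are never formed as objects. A local element of \<open>F_j\<close> is
  a sum over words whose components are determined only modulo \<open>F_{j+1}\<close>, so the
  projections \<open>P_k\<close> would first have to be shown well defined. Instead one
  decomposition is fixed, and its \<open>P_k\<close>-parts are compared after rotating position
  \<open>k\<close> to the front, where the intersection of \<open>X \<otimes> Y^{p-1}\<close> with
  \<open>Y \<otimes> F_j\<close> decides. This intersection rests on exactness of the tensor
  product, which comes from rigidity.

  Characteristic \<open>p\<close> enters through \<open>(1-c)^p = 1 - c^p\<close> and
  \<open>(1-c)^{p-1} = 1 + c + ... + c^{p-1}\<close>: the first gives \<open>D^p = 0\<close> once
  \<open>c^p = 1\<close>, the second turns norms into elements of \<open>Im D^{p-1}\<close>. It also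
  makes \<open>j\<close> invertible for \<open>0 < j < p\<close>. The relation
  \<open>c^p = 1\<close> needs work, since the associativity constraints are arbitrary and
  \<open>cyc\<close> is given by recursion; it is derived from the Yang-Baxter relation for
  neighbouring transpositions.\<close>

context linear_category
begin

lemma zero_in_Hom: "0 \<in> Hom C X Y"
  using subspace_0[OF subspace_Hom] .

lemma add_in_Hom: "f \<in> Hom C X Y \<Longrightarrow> g \<in> Hom C X Y \<Longrightarrow> f + g \<in> Hom C X Y"
  using subspace_add[OF subspace_Hom] .

lemma diff_in_Hom: "f \<in> Hom C X Y \<Longrightarrow> g \<in> Hom C X Y \<Longrightarrow> f - g \<in> Hom C X Y"
  using subspace_diff[OF subspace_Hom] .

lemma scal_in_Hom: "f \<in> Hom C X Y \<Longrightarrow> scal C a f \<in> Hom C X Y"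
  using subspace_scale[OF subspace_Hom] .

lemma sum_in_Hom: "(\<And>i. i \<in> I \<Longrightarrow> f i \<in> Hom C X Y) \<Longrightarrow> sum f I \<in> Hom C X Y"
  using subspace_sum[OF subspace_Hom] .

lemmas hom = zero_in_Hom add_in_Hom diff_in_Hom scal_in_Hom idm_in_Hom comp_in_Hom

lemma comp_zero_left: "f \<in> Hom C X Y \<Longrightarrow> 0 \<cdot> f = 0"
  using comp_add_left[of f X Y 0 Y 0] zero_in_Hom by simp

lemma comp_zero_right: "g \<in> Hom C Y Z \<Longrightarrow> g \<cdot> 0 = 0"
  using comp_add_right[of 0 Y Y 0 g Z] zero_in_Hom by simp

lemma comp_diff_left:
  assumes "f \<in> Hom C X Y" "g \<in> Hom C Y Z" "h \<in> Hom C Y Z"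
  shows "(g - h) \<cdot> f = g \<cdot> f - h \<cdot> f"
  using comp_add_left[OF assms(1) diff_in_Hom[OF assms(2,3)] assms(3)] by (simp add: algebra_simps)

lemma comp_diff_right:
  assumes "f \<in> Hom C X Y" "g \<in> Hom C X Y" "h \<in> Hom C Y Z"
  shows "h \<cdot> (f - g) = h \<cdot> f - h \<cdot> g"
  using comp_add_right[OF diff_in_Hom[OF assms(1,2)] assms(2,3)] by (simp add: algebra_simps)

lemma comp_sum_right:
  assumes "\<And>i. i \<in> I \<Longrightarrow> f i \<in> Hom C X Y" "h \<in> Hom C Y Z"
  shows "h \<cdot> sum f I = (\<Sum>i\<in>I. h \<cdot> f i)"
  using assms(1)
proof (induction I rule: infinite_finite_induct)
  case (insert i I)
  then show ?case
    using comp_add_right[of "f i" X Y "sum f I" h Z] sum_in_Hom[of I f X Y] assms(2) by simp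
qed (simp_all add: comp_zero_right[OF assms(2)])

lemma comp_sum_left:
  assumes "\<And>i. i \<in> I \<Longrightarrow> f i \<in> Hom C Y Z" "h \<in> Hom C X Y"
  shows "sum f I \<cdot> h = (\<Sum>i\<in>I. f i \<cdot> h)"
  using assms(1)
proof (induction I rule: infinite_finite_induct)
  case (insert i I)
  then show ?case
    using comp_add_left[of h X Y "f i" Z "sum f I"] sum_in_Hom[of I f Y Z] assms(2) by simp
qed (simp_all add: comp_zero_left[OF assms(2)])

lemma monicI:
  assumes "f \<in> Hom C X Y" "\<And>W u. u \<in> Hom C W X \<Longrightarrow> f \<cdot> u = 0 \<Longrightarrow> u = 0"
  shows "monic C X Y f"
  unfolding monic_def
proof (intro conjI allI ballI impI assms(1))
  fix W u v assume uv: "u \<in> Hom C W X" "v \<in> Hom C W X" "f \<cdot> u = f \<cdot> v"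
  then have "f \<cdot> (u - v) = 0" using comp_diff_right[OF uv(1,2) assms(1)] by simp
  then show "u = v" using assms(2)[OF diff_in_Hom[OF uv(1,2)]] by simp
qed

lemma epicI:
  assumes "f \<in> Hom C X Y" "\<And>W u. u \<in> Hom C Y W \<Longrightarrow> u \<cdot> f = 0 \<Longrightarrow> u = 0"
  shows "epic C X Y f"
  unfolding epic_def
proof (intro conjI allI ballI impI assms(1))
  fix W u v assume uv: "u \<in> Hom C Y W" "v \<in> Hom C Y W" "u \<cdot> f = v \<cdot> f"
  then have "(u - v) \<cdot> f = 0" using comp_diff_left[OF assms(1) uv(1,2)] by simp
  then show "u = v" using assms(2)[OF diff_in_Hom[OF uv(1,2)]] by simp
qed

lemma monic_in_Hom: "monic C X Y f \<Longrightarrow> f \<in> Hom C X Y"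
  by (simp add: monic_def)

lemma epic_in_Hom: "epic C X Y f \<Longrightarrow> f \<in> Hom C X Y"
  by (simp add: epic_def)

lemma monic_cancel:
  "monic C X Y f \<Longrightarrow> u \<in> Hom C W X \<Longrightarrow> v \<in> Hom C W X \<Longrightarrow> f \<cdot> u = f \<cdot> v \<Longrightarrow> u = v"
  unfolding monic_def by blast

lemma epic_cancel:
  "epic C X Y f \<Longrightarrow> u \<in> Hom C Y W \<Longrightarrow> v \<in> Hom C Y W \<Longrightarrow> u \<cdot> f = v \<cdot> f \<Longrightarrow> u = v"
  unfolding epic_def by blast

lemma monic_zero: "monic C X Y f \<Longrightarrow> u \<in> Hom C W X \<Longrightarrow> f \<cdot> u = 0 \<Longrightarrow> u = 0"
  using monic_cancel[OF _ _ zero_in_Hom] comp_zero_right monic_in_Hom by metis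

lemma epic_zero: "epic C X Y f \<Longrightarrow> u \<in> Hom C Y W \<Longrightarrow> u \<cdot> f = 0 \<Longrightarrow> u = 0"
  using epic_cancel[OF _ _ zero_in_Hom] comp_zero_left epic_in_Hom by metis

lemma monic_comp:
  assumes "monic C X Y f" "monic C Y Z g"
  shows "monic C X Z (g \<cdot> f)"
proof (rule monicI)
  note h = monic_in_Hom[OF assms(1)] monic_in_Hom[OF assms(2)]
  show "g \<cdot> f \<in> Hom C X Z" using h by (rule comp_in_Hom)
  fix W u assume u: "u \<in> Hom C W X" "(g \<cdot> f) \<cdot> u = 0"
  then have "g \<cdot> (f \<cdot> u) = 0" using comp_assoc h by metis
  then show "u = 0" using monic_zero assms comp_in_Hom h u(1) by metis
qed

lemma epic_comp:
  assumes "epic C X Y f" "epic C Y Z g"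
  shows "epic C X Z (g \<cdot> f)"
proof (rule epicI)
  note h = epic_in_Hom[OF assms(1)] epic_in_Hom[OF assms(2)]
  show "g \<cdot> f \<in> Hom C X Z" using h by (rule comp_in_Hom)
  fix W u assume u: "u \<in> Hom C Z W" "u \<cdot> (g \<cdot> f) = 0"
  then have "(u \<cdot> g) \<cdot> f = 0" using comp_assoc h by metis
  then show "u = 0" using epic_zero assms comp_in_Hom h u(1) by metis
qed

lemma monic_right_factor:
  assumes "f \<in> Hom C X Y" "g \<in> Hom C Y Z" "monic C X Z (g \<cdot> f)"
  shows "monic C X Y f"
proof (rule monicI[OF assms(1)])
  fix W u assume u: "u \<in> Hom C W X" "f \<cdot> u = 0"
  then have "(g \<cdot> f) \<cdot> u = 0" using comp_assoc[OF u(1) assms(1,2)] comp_zero_right[OF assms(2)] by simp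
  then show "u = 0" using monic_zero assms(3) u(1) by blast
qed

lemma epic_left_factor:
  assumes "f \<in> Hom C X Y" "g \<in> Hom C Y Z" "epic C X Z (g \<cdot> f)"
  shows "epic C Y Z g"
proof (rule epicI[OF assms(2)])
  fix W u assume u: "u \<in> Hom C Z W" "u \<cdot> g = 0"
  then have "u \<cdot> (g \<cdot> f) = 0" using comp_assoc[OF assms(1,2) u(1)] comp_zero_left[OF assms(1)] by simp
  then show "u = 0" using epic_zero assms(3) u(1) by blast
qed

lemma epic_idm: "epic C X X (idm C X)"
  by (rule epicI) (auto simp: idm_in_Hom comp_idm)

lemma monic_idm: "monic C X X (idm C X)"
  by (rule monicI) (auto simp: idm_in_Hom idm_comp)

lemma iso_mor_monic_epic:
  assumes "iso_mor C X Y f"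
  shows "monic C X Y f" "epic C X Y f"
proof -
  obtain g where g: "f \<in> Hom C X Y" "g \<in> Hom C Y X" "g \<cdot> f = idm C X" "f \<cdot> g = idm C Y"
    using assms unfolding iso_mor_def inverse_mor_def by blast
  show "monic C X Y f"
  proof (rule monicI[OF g(1)])
    fix W u assume u: "u \<in> Hom C W X" "f \<cdot> u = 0"
    show "u = 0"
      using comp_assoc[OF u(1) g(1,2)] idm_comp[OF u(1)] comp_zero_right[OF g(2)] u(2) g(3) by simp
  qed
  show "epic C X Y f"
  proof (rule epicI[OF g(1)])
    fix W u assume u: "u \<in> Hom C Y W" "u \<cdot> f = 0"
    show "u = 0"
      using comp_assoc[OF g(2,1) u(1)] comp_idm[OF u(1)] comp_zero_left[OF g(2)] u(2) g(4) by simp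
  qed
qed

lemma inv_mor_inverse:
  assumes "iso_mor C X Y f"
  shows "inverse_mor C X Y f (inv_mor C X Y f)"
proof -
  obtain g where g: "inverse_mor C X Y f g" using assms unfolding iso_mor_def by blast
  moreover have "h = g" if h: "inverse_mor C X Y f h" for h
  proof -
    note gD = g[unfolded inverse_mor_def] and hD = h[unfolded inverse_mor_def]
    have "f \<cdot> h = f \<cdot> g" using gD hD by simp
    then show ?thesis using monic_cancel[OF iso_mor_monic_epic(1)[OF assms]] gD hD by blast
  qed
  ultimately show ?thesis unfolding inv_mor_def by (rule theI)
qed

lemma is_kernelD:
  assumes "is_kernel C X Y f K k"
  shows "f \<in> Hom C X Y" "k \<in> Hom C K X" "f \<cdot> k = 0"
  using assms unfolding is_kernel_def by auto

lemma is_cokernelD: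
  assumes "is_cokernel C X Y f Q q"
  shows "f \<in> Hom C X Y" "q \<in> Hom C Y Q" "q \<cdot> f = 0"
  using assms unfolding is_cokernel_def by auto

lemma kernel_factor:
  assumes "is_kernel C X Y f K k" "h \<in> Hom C W X" "f \<cdot> h = 0"
  obtains u where "u \<in> Hom C W K" "k \<cdot> u = h"
  using assms unfolding is_kernel_def by meson

lemma cokernel_factor:
  assumes "is_cokernel C X Y f Q q" "h \<in> Hom C Y W" "h \<cdot> f = 0"
  obtains u where "u \<in> Hom C Q W" "u \<cdot> q = h"
  using assms unfolding is_cokernel_def by meson

lemma kernel_monic:
  assumes "is_kernel C X Y f K k"
  shows "monic C K X k"
proof (rule monicI)
  note k = is_kernelD[OF assms]
  show "k \<in> Hom C K X" by (rule k)
  fix W u assume u: "u \<in> Hom C W K" "k \<cdot> u = 0"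
  have "\<exists>!u. u \<in> Hom C W K \<and> k \<cdot> u = 0"
    using assms zero_in_Hom comp_zero_right[OF k(1)] unfolding is_kernel_def by blast
  then show "u = 0" using u zero_in_Hom comp_zero_right[OF k(2)] by blast
qed

lemma cokernel_epic:
  assumes "is_cokernel C X Y f Q q"
  shows "epic C Y Q q"
proof (rule epicI)
  note q = is_cokernelD[OF assms]
  show "q \<in> Hom C Y Q" by (rule q)
  fix W u assume u: "u \<in> Hom C Q W" "u \<cdot> q = 0"
  have "\<exists>!u. u \<in> Hom C Q W \<and> u \<cdot> q = 0"
    using assms zero_in_Hom comp_zero_left[OF q(1)] unfolding is_cokernel_def by blast
  then show "u = 0" using u zero_in_Hom comp_zero_left[OF q(2)] by blast
qed

lemma is_kernelI:
  assumes "f \<in> Hom C X Y" "monic C K X k" "f \<cdot> k = 0"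
    "\<And>W h. h \<in> Hom C W X \<Longrightarrow> f \<cdot> h = 0 \<Longrightarrow> \<exists>u\<in>Hom C W K. k \<cdot> u = h"
  shows "is_kernel C X Y f K k"
  unfolding is_kernel_def using assms monic_in_Hom monic_cancel by metis

lemma is_cokernelI:
  assumes "f \<in> Hom C X Y" "epic C Y Q q" "q \<cdot> f = 0"
    "\<And>W h. h \<in> Hom C Y W \<Longrightarrow> h \<cdot> f = 0 \<Longrightarrow> \<exists>u\<in>Hom C Q W. u \<cdot> q = h"
  shows "is_cokernel C X Y f Q q"
  unfolding is_cokernel_def using assms epic_in_Hom epic_cancel by metis

lemma comp_eq_restrict:
  assumes "f \<cdot> x = g \<cdot> y" "x \<in> Hom C W A" "f \<in> Hom C A T" "y \<in> Hom C W B" "g \<in> Hom C B T"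
    "e \<in> Hom C W' W"
  shows "f \<cdot> (x \<cdot> e) = g \<cdot> (y \<cdot> e)"
  using assms(1) comp_assoc[OF assms(6,2,3)] comp_assoc[OF assms(6,4,5)] by simp

lemma comp_zero_restrict:
  assumes "f \<cdot> x = 0" "x \<in> Hom C W A" "f \<in> Hom C A T" "e \<in> Hom C W' W"
  shows "f \<cdot> (x \<cdot> e) = 0"
  using assms(1) comp_assoc[OF assms(4,2,3)] comp_zero_left[OF assms(4)] by simp

end

section \<open>Pullbacks of epimorphisms, images, and exactness on local elements\<close>

context abelian_category
begin

lemma ker_is_kernel: "f \<in> Hom C X Y \<Longrightarrow> is_kernel C X Y f (Ker C X Y f) (ker_map C X Y f)"
  using kernel_exists[of f X Y] unfolding Ker_def ker_map_def by (metis (mono_tags, lifting) someI_ex)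

lemma coker_is_cokernel:
  "f \<in> Hom C X Y \<Longrightarrow> is_cokernel C X Y f (Coker C X Y f) (coker_map C X Y f)"
  using cokernel_exists[of f X Y] unfolding Coker_def coker_map_def
  by (metis (mono_tags, lifting) someI_ex)

text \<open>An epimorphism is the cokernel of some \<open>g\<close>, and \<open>g\<close> factors
  through the kernel \<open>k\<close>; so whatever kills \<open>k\<close> kills
  \<open>g\<close>.\<close>

lemma epic_cokernel_of_kernel:
  assumes "epic C X Y e" "is_kernel C X Y e K k"
  shows "is_cokernel C K X k Y e"
proof (rule is_cokernelI)
  note k = is_kernelD[OF assms(2)]
  show "k \<in> Hom C K X" "epic C X Y e" "e \<cdot> k = 0" using k assms by auto
  obtain W g where g: "is_cokernel C W X g Y e" using epic_normal[OF assms(1)] by blast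
  note gD = is_cokernelD[OF g]
  obtain v where v: "v \<in> Hom C W K" "k \<cdot> v = g" using kernel_factor[OF assms(2) gD(1,3)] .
  fix V h assume h: "h \<in> Hom C X V" "h \<cdot> k = 0"
  have "h \<cdot> g = 0" using comp_assoc[OF v(1) k(2) h(1)] h(2) v comp_zero_left[OF v(1)] by simp
  then show "\<exists>u\<in>Hom C Y V. u \<cdot> e = h" using cokernel_factor[OF g h(1)] by metis
qed

lemma monic_kernel_of_cokernel:
  assumes "monic C X Y m" "is_cokernel C X Y m Q q"
  shows "is_kernel C Y Q q X m"
proof (rule is_kernelI)
  note q = is_cokernelD[OF assms(2)]
  show "q \<in> Hom C Y Q" "monic C X Y m" "q \<cdot> m = 0" using q assms by auto
  obtain Z g where g: "is_kernel C Y Z g X m" using monic_normal[OF assms(1)] by blast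
  note gD = is_kernelD[OF g]
  obtain v where v: "v \<in> Hom C Q Z" "v \<cdot> q = g" using cokernel_factor[OF assms(2) gD(1,3)] .
  fix V h assume h: "h \<in> Hom C V Y" "q \<cdot> h = 0"
  have "g \<cdot> h = 0" using comp_assoc[OF h(1) q(2) v(1)] h(2) v comp_zero_right[OF v(1)] by simp
  then show "\<exists>u\<in>Hom C V X. m \<cdot> u = h" using kernel_factor[OF g h(1)] by metis
qed

text \<open>This is what permits existence claims to be met only after an epimorphism. The pullback
  is the kernel of \<open>e p1 - h p2\<close> on the biproduct. That difference is epic because
  \<open>e\<close> is, hence it is the cokernel of its kernel, and this forces the projection of the
  kernel to \<open>W\<close> to be epic.\<close>

lemma epi_pullback:
  assumes e: "epic C A B e" and h: "h \<in> Hom C W B"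
  obtains W' \<epsilon> a where "epic C W' W \<epsilon>" "a \<in> Hom C W' A" "e \<cdot> a = h \<cdot> \<epsilon>"
proof -
  note eh = epic_in_Hom[OF e]
  obtain P i1 i2 p1 p2 where
    P: "i1 \<in> Hom C A P" "i2 \<in> Hom C W P" "p1 \<in> Hom C P A" "p2 \<in> Hom C P W"
    "p1 \<cdot> i1 = idm C A" "p2 \<cdot> i2 = idm C W" "p1 \<cdot> i2 = 0" "p2 \<cdot> i1 = 0"
    "i1 \<cdot> p1 + i2 \<cdot> p2 = idm C P"
    using biproduct_exists[of A W] unfolding biproduct_def by blast
  define \<phi> where "\<phi> = e \<cdot> p1 - h \<cdot> p2"
  have ep: "e \<cdot> p1 \<in> Hom C P B" "h \<cdot> p2 \<in> Hom C P B" using comp_in_Hom P eh h by blast+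
  have \<phi>: "\<phi> \<in> Hom C P B" unfolding \<phi>_def using ep by (rule diff_in_Hom)
  have "\<phi> \<cdot> i1 = e \<cdot> (p1 \<cdot> i1) - h \<cdot> (p2 \<cdot> i1)"
    unfolding \<phi>_def using comp_diff_left[OF P(1) ep] comp_assoc[OF P(1,3) eh] comp_assoc[OF P(1,4) h] by simp
  then have \<phi>i: "\<phi> \<cdot> i1 = e" using P(5,8) comp_idm[OF eh] comp_zero_right[OF h] by simp
  have \<phi>e: "epic C P B \<phi>" using epic_left_factor[OF P(1) \<phi>] \<phi>i e by simp
  obtain K k where k: "is_kernel C P B \<phi> K k" using kernel_exists[OF \<phi>] by blast
  note kD = is_kernelD[OF k]
  have ck: "is_cokernel C K P k B \<phi>" using epic_cokernel_of_kernel[OF \<phi>e k] .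
  have pk: "p1 \<cdot> k \<in> Hom C K A" "p2 \<cdot> k \<in> Hom C K W" using comp_in_Hom kD P by blast+
  have "\<phi> \<cdot> k = e \<cdot> (p1 \<cdot> k) - h \<cdot> (p2 \<cdot> k)"
    unfolding \<phi>_def using comp_diff_left[OF kD(2) ep] comp_assoc[OF kD(2) P(3) eh] comp_assoc[OF kD(2) P(4) h] by simp
  then have eq: "e \<cdot> (p1 \<cdot> k) = h \<cdot> (p2 \<cdot> k)" using kD(3) by simp
  have "epic C K W (p2 \<cdot> k)"
  proof (rule epicI[OF pk(2)])
    fix V u assume u: "u \<in> Hom C W V" "u \<cdot> (p2 \<cdot> k) = 0"
    have up: "u \<cdot> p2 \<in> Hom C P V" using comp_in_Hom P(4) u(1) by blast
    have "(u \<cdot> p2) \<cdot> k = 0" using comp_assoc[OF kD(2) P(4) u(1)] u(2) by simp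
    then obtain v where v: "v \<in> Hom C B V" "v \<cdot> \<phi> = u \<cdot> p2" using cokernel_factor[OF ck up] by metis
    \<comment> \<open>Restriction along \<open>i1\<close> isolates \<open>v e\<close>, because
      \<open>p2 i1 = 0\<close>; so \<open>v\<close> vanishes, and \<open>u p2\<close> with
      it.\<close>
    have "v \<cdot> e = (u \<cdot> p2) \<cdot> i1" using comp_assoc[OF P(1) \<phi> v(1)] v(2) \<phi>i by simp
    also have "\<dots> = 0" using comp_assoc[OF P(1) P(4) u(1)] P(8) comp_zero_right[OF u(1)] by simp
    finally have "v = 0" using epic_zero[OF e v(1)] by simp
    then have "u \<cdot> p2 = 0" using v(2) comp_zero_left[OF \<phi>] by simp
    then have "(u \<cdot> p2) \<cdot> i2 = 0" using comp_zero_left[OF P(2)] by simp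
    then show "u = 0" using comp_assoc[OF P(2) P(4) u(1)] P(6) comp_idm[OF u(1)] by simp
  qed
  then show thesis using that pk eq by blast
qed

text \<open>If \<open>u e = 0\<close>, then \<open>f\<close> factors through the subobject
  \<open>m n\<close>, where \<open>m\<close> is the image inclusion and \<open>n\<close> the kernel
  of \<open>u\<close>. As a normal monomorphism \<open>m n\<close> is the kernel of some
  \<open>h\<close>; this \<open>h\<close> kills \<open>f\<close>, hence factors through the cokernel
  of \<open>f\<close> and kills \<open>m\<close>. So \<open>m\<close> factors through
  \<open>m n\<close>, which makes \<open>n\<close> a split epimorphism and
  \<open>u = 0\<close>.\<close>

lemma image_factor:
  assumes f: "f \<in> Hom C X Y"
  obtains e where "epic C X (image_obj C X Y f) e" "image_map C X Y f \<cdot> e = f"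
    "monic C (image_obj C X Y f) Y (image_map C X Y f)"
proof -
  let ?I = "image_obj C X Y f" and ?m = "image_map C X Y f"
  let ?Q = "Coker C X Y f" and ?q = "coker_map C X Y f"
  have q: "is_cokernel C X Y f ?Q ?q" by (rule coker_is_cokernel[OF f])
  note qD = is_cokernelD[OF q]
  have m: "is_kernel C Y ?Q ?q ?I ?m"
    unfolding image_obj_def image_map_def by (rule ker_is_kernel[OF qD(2)])
  note mD = is_kernelD[OF m] and mm = kernel_monic[OF m]
  obtain e where e: "e \<in> Hom C X ?I" "?m \<cdot> e = f" using kernel_factor[OF m f qD(3)] .
  have "epic C X ?I e"
  proof (rule epicI[OF e(1)])
    fix V u assume u: "u \<in> Hom C ?I V" "u \<cdot> e = 0"
    obtain N n where n: "is_kernel C ?I V u N n" using kernel_exists[OF u(1)] by blast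
    note nD = is_kernelD[OF n]
    obtain e' where e': "e' \<in> Hom C X N" "n \<cdot> e' = e" using kernel_factor[OF n e(1) u(2)] .
    have mn: "monic C N Y (?m \<cdot> n)" using monic_comp[OF kernel_monic[OF n] mm] .
    obtain H h where h: "is_kernel C Y H h N (?m \<cdot> n)" using monic_normal[OF mn] by blast
    note hD = is_kernelD[OF h]
    have "h \<cdot> f = (h \<cdot> (?m \<cdot> n)) \<cdot> e'"
      using comp_assoc[OF e'(1) hD(2) hD(1)] comp_assoc[OF e'(1) nD(2) mD(2)] e' e by simp
    then have "h \<cdot> f = 0" using hD(3) comp_zero_left[OF e'(1)] by simp
    then obtain h' where h': "h' \<in> Hom C ?Q H" "h' \<cdot> ?q = h" using cokernel_factor[OF q hD(1)] by metis
    have "h \<cdot> ?m = 0" using comp_assoc[OF mD(2) mD(1) h'(1)] h'(2) mD(3) comp_zero_right[OF h'(1)] by simp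
    then obtain r where r: "r \<in> Hom C ?I N" "(?m \<cdot> n) \<cdot> r = ?m" using kernel_factor[OF h mD(2)] by metis
    have "?m \<cdot> (n \<cdot> r) = ?m \<cdot> idm C ?I"
      using comp_assoc[OF r(1) nD(2) mD(2)] r(2) comp_idm[OF mD(2)] by simp
    then have nr: "n \<cdot> r = idm C ?I"
      using monic_cancel[OF mm] comp_in_Hom[OF r(1) nD(2)] idm_in_Hom by blast
    have "u = u \<cdot> (n \<cdot> r)" using nr comp_idm[OF u(1)] by simp
    also have "\<dots> = 0" using comp_assoc[OF r(1) nD(2) u(1)] nD(3) comp_zero_left[OF r(1)] by simp
    finally show "u = 0" .
  qed
  then show thesis using that e mm by blast
qed

text \<open>The epimorphism in \<open>loc\<close> does no harm: that \<open>y\<close> is killed by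
  the cokernel of \<open>f\<close> can be tested after it, and this already puts \<open>y\<close>
  into the image.\<close>

lemma exact_atI:
  assumes f: "f \<in> Hom C X Y" and g: "g \<in> Hom C Y Z" and gf: "g \<cdot> f = 0"
    and loc: "\<And>W y. y \<in> Hom C W Y \<Longrightarrow> g \<cdot> y = 0 \<Longrightarrow>
      \<exists>W' e x. epic C W' W e \<and> x \<in> Hom C W' X \<and> f \<cdot> x = y \<cdot> e"
  shows "exact_at C X f Y g Z"
  unfolding exact_at_def
proof (intro conjI f g is_kernelI)
  let ?I = "image_obj C X Y f" and ?m = "image_map C X Y f"
  obtain e where e: "epic C X ?I e" "?m \<cdot> e = f" and m: "monic C ?I Y ?m" using image_factor[OF f] .
  note mH = monic_in_Hom[OF m] and eH = epic_in_Hom[OF e(1)]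
  show "monic C ?I Y ?m" by (rule m)
  have "(g \<cdot> ?m) \<cdot> e = 0" using comp_assoc[OF eH mH g] e(2) gf by simp
  then show "g \<cdot> ?m = 0" using epic_zero[OF e(1)] comp_in_Hom[OF mH g] by blast
  fix W y assume y: "y \<in> Hom C W Y" "g \<cdot> y = 0"
  obtain W' \<epsilon> x where x: "epic C W' W \<epsilon>" "x \<in> Hom C W' X" "f \<cdot> x = y \<cdot> \<epsilon>" using loc[OF y] by blast
  note \<epsilon>H = epic_in_Hom[OF x(1)]
  let ?Q = "Coker C X Y f" and ?q = "coker_map C X Y f"
  note q = is_cokernelD[OF coker_is_cokernel[OF f]]
  have k: "is_kernel C Y ?Q ?q ?I ?m"
    unfolding image_obj_def image_map_def by (rule ker_is_kernel[OF q(2)])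
  have "(?q \<cdot> y) \<cdot> \<epsilon> = 0"
    using comp_assoc[OF \<epsilon>H y(1) q(2)] comp_assoc[OF x(2) f q(2)] x(3) q(3) comp_zero_left[OF x(2)] by simp
  then have "?q \<cdot> y = 0" using epic_zero[OF x(1)] comp_in_Hom[OF y(1) q(2)] by blast
  then show "\<exists>u\<in>Hom C W ?I. ?m \<cdot> u = y" using kernel_factor[OF k y(1)] by metis
qed

lemma exact_atD:
  assumes "exact_at C X f Y g Z"
  shows "f \<in> Hom C X Y" "g \<in> Hom C Y Z" "g \<cdot> f = 0"
proof -
  show f: "f \<in> Hom C X Y" and g: "g \<in> Hom C Y Z" using assms unfolding exact_at_def by auto
  have k: "is_kernel C Y Z g (image_obj C X Y f) (image_map C X Y f)"
    using assms unfolding exact_at_def by auto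
  obtain e where e: "epic C X (image_obj C X Y f) e" "image_map C X Y f \<cdot> e = f" using image_factor[OF f] .
  show "g \<cdot> f = 0"
    using comp_assoc[OF epic_in_Hom[OF e(1)] is_kernelD(2)[OF k] g] e(2) is_kernelD(3)[OF k]
      comp_zero_left[OF epic_in_Hom[OF e(1)]] by simp
qed

text \<open>The kernel property factors \<open>y\<close> through the image, and
  \<open>epi_pullback\<close> lifts the result along the epimorphism from \<open>X\<close> onto the
  image.\<close>

lemma exact_at_lift:
  assumes ex: "exact_at C X f Y g Z" and y: "y \<in> Hom C W Y" "g \<cdot> y = 0"
  obtains W' e x where "epic C W' W e" "x \<in> Hom C W' X" "f \<cdot> x = y \<cdot> e"
proof -
  let ?I = "image_obj C X Y f" and ?m = "image_map C X Y f"
  note f = exact_atD(1)[OF ex]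
  have k: "is_kernel C Y Z g ?I ?m" using ex unfolding exact_at_def by auto
  obtain e where e: "epic C X ?I e" "?m \<cdot> e = f" using image_factor[OF f] .
  obtain u where u: "u \<in> Hom C W ?I" "?m \<cdot> u = y" using kernel_factor[OF k y] .
  obtain W' \<epsilon> x where x: "epic C W' W \<epsilon>" "x \<in> Hom C W' X" "e \<cdot> x = u \<cdot> \<epsilon>"
    using epi_pullback[OF e(1) u(1)] .
  have "f \<cdot> x = y \<cdot> \<epsilon>"
    using comp_assoc[OF x(2) epic_in_Hom[OF e(1)] is_kernelD(2)[OF k]]
      comp_assoc[OF epic_in_Hom[OF x(1)] u(1) is_kernelD(2)[OF k]] unfolding e(2) u(2) x(3) by (rule trans[OF _ sym])
  then show thesis by (rule that[OF x(1,2)])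
qed

text \<open>A cokernel of \<open>f\<close> is also a cokernel of the image inclusion, and a
  monomorphism is the kernel of its cokernel.\<close>

lemma cokernel_exact:
  assumes q: "is_cokernel C X Y f Q q"
  shows "exact_at C X f Y q Q"
proof (rule exact_atI)
  note qD = is_cokernelD[OF q]
  show f: "f \<in> Hom C X Y" and "q \<in> Hom C Y Q" "q \<cdot> f = 0" using qD by auto
  fix W y assume y: "y \<in> Hom C W Y" "q \<cdot> y = 0"
  obtain e where e: "epic C X (image_obj C X Y f) e" "image_map C X Y f \<cdot> e = f"
    and m: "monic C (image_obj C X Y f) Y (image_map C X Y f)" using image_factor[OF f] .
  note mH = monic_in_Hom[OF m]
  have "is_cokernel C (image_obj C X Y f) Y (image_map C X Y f) Q q"
  proof (rule is_cokernelI[OF mH cokernel_epic[OF q]])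
    have "(q \<cdot> image_map C X Y f) \<cdot> e = 0"
      using comp_assoc[OF epic_in_Hom[OF e(1)] mH qD(2)] e(2) qD(3) by simp
    then show "q \<cdot> image_map C X Y f = 0" using epic_zero[OF e(1)] comp_in_Hom[OF mH qD(2)] by blast
    fix V h assume h: "h \<in> Hom C Y V" "h \<cdot> image_map C X Y f = 0"
    have "h \<cdot> f = 0"
      using comp_assoc[OF epic_in_Hom[OF e(1)] mH h(1)] e(2) h(2) comp_zero_left[OF epic_in_Hom[OF e(1)]] by simp
    then show "\<exists>u\<in>Hom C Q V. u \<cdot> q = h" using cokernel_factor[OF q h(1)] by metis
  qed
  then have k: "is_kernel C Y Q q (image_obj C X Y f) (image_map C X Y f)"
    using monic_kernel_of_cokernel[OF m] by blast
  obtain u where u: "u \<in> Hom C W (image_obj C X Y f)" "image_map C X Y f \<cdot> u = y" using kernel_factor[OF k y] .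
  obtain W' \<epsilon> x where x: "epic C W' W \<epsilon>" "x \<in> Hom C W' X" "e \<cdot> x = u \<cdot> \<epsilon>"
    using epi_pullback[OF e(1) u(1)] .
  have "f \<cdot> x = y \<cdot> \<epsilon>"
    using comp_assoc[OF x(2) epic_in_Hom[OF e(1)] mH]
      comp_assoc[OF epic_in_Hom[OF x(1)] u(1) mH] unfolding e(2) u(2) x(3) by (rule trans[OF _ sym])
  then show "\<exists>W' e x. epic C W' W e \<and> x \<in> Hom C W' X \<and> f \<cdot> x = y \<cdot> e" using x by blast
qed

text \<open>What kills \<open>f\<close> also kills the kernel of \<open>g\<close>, because local
  elements of that kernel lift along \<open>f\<close>; and \<open>g\<close> is the cokernel of its
  kernel.\<close>

lemma exact_epic_cokernel:
  assumes ex: "exact_at C X f Y g Z" and g: "epic C Y Z g"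
  shows "is_cokernel C X Y f Z g"
proof (rule is_cokernelI[OF _ g])
  note D = exact_atD[OF ex]
  show "f \<in> Hom C X Y" "g \<cdot> f = 0" using D by auto
  obtain K k where k: "is_kernel C Y Z g K k" using kernel_exists[OF D(2)] by blast
  note kD = is_kernelD[OF k]
  fix W h assume h: "h \<in> Hom C Y W" "h \<cdot> f = 0"
  obtain W' e x where x: "epic C W' K e" "x \<in> Hom C W' X" "f \<cdot> x = k \<cdot> e"
    using exact_at_lift[OF ex kD(2,3)] .
  have "(h \<cdot> k) \<cdot> e = 0"
    using comp_assoc[OF epic_in_Hom[OF x(1)] kD(2) h(1)] comp_assoc[OF x(2) D(1) h(1)] x(3) h(2)
      comp_zero_left[OF x(2)] by simp
  then have "h \<cdot> k = 0" using epic_zero[OF x(1)] comp_in_Hom[OF kD(2) h(1)] by blast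
  then show "\<exists>u\<in>Hom C Z W. u \<cdot> g = h" using cokernel_factor[OF epic_cokernel_of_kernel[OF g k] h(1)] by metis
qed

lemma kernel_short_exact:
  assumes "epic C X Y e" "is_kernel C X Y e K k"
  shows "short_exact C K k X e Y"
  unfolding short_exact_def
  using cokernel_exact[OF epic_cokernel_of_kernel[OF assms]] kernel_monic[OF assms(2)] assms(1) by blast

lemma cokernel_short_exact:
  assumes "monic C X Y m" "is_cokernel C X Y m Q q"
  shows "short_exact C X m Y q Q"
  unfolding short_exact_def using cokernel_exact[OF assms(2)] cokernel_epic[OF assms(2)] assms(1) by blast

lemma short_exactD:
  assumes "short_exact C X f Y g Z"
  shows "monic C X Y f" "epic C Y Z g" "exact_at C X f Y g Z" "f \<in> Hom C X Y" "g \<in> Hom C Y Z" "g \<cdot> f = 0"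
  using assms exact_atD unfolding short_exact_def by blast+

lemma short_exact_kernel:
  assumes "short_exact C X f Y g Z"
  shows "is_kernel C Y Z g X f"
  using monic_kernel_of_cokernel exact_epic_cokernel short_exactD[OF assms] by blast

lemma short_exactI:
  assumes "monic C X Y f" "is_kernel C Y Z g X f" "epic C Y Z g"
  shows "short_exact C X f Y g Z"
  using kernel_short_exact assms by blast

lemma monic_epic_iso:
  assumes "monic C X Y f" "epic C X Y f"
  shows "iso_mor C X Y f"
proof -
  note f = monic_in_Hom[OF assms(1)]
  obtain Z g where g: "is_kernel C Y Z g X f" using monic_normal[OF assms(1)] by blast
  note gD = is_kernelD[OF g]
  have "g = 0" using epic_zero[OF assms(2) gD(1,3)] .
  then have "g \<cdot> idm C Y = 0" using comp_zero_left[OF idm_in_Hom] by simp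
  then obtain u where u: "u \<in> Hom C Y X" "f \<cdot> u = idm C Y" using kernel_factor[OF g idm_in_Hom] by metis
  have "f \<cdot> (u \<cdot> f) = f \<cdot> idm C X"
    using comp_assoc[OF f u(1) f] u(2) idm_comp[OF f] comp_idm[OF f] by simp
  then have "u \<cdot> f = idm C X" using monic_cancel[OF assms(1)] comp_in_Hom[OF f u(1)] idm_in_Hom by blast
  then show ?thesis unfolding iso_mor_def inverse_mor_def using f u by blast
qed

end

section \<open>Multiplicities of simple objects\<close>

context abelian_category
begin

lemma isomorphic_sym: "isomorphic C X Y \<Longrightarrow> isomorphic C Y X"
  unfolding isomorphic_def iso_mor_def inverse_mor_def by blast

lemma isomorphic_trans: "isomorphic C X Y \<Longrightarrow> isomorphic C Y Z \<Longrightarrow> isomorphic C X Z"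
  unfolding isomorphic_def
  using iso_mor_monic_epic monic_epic_iso monic_comp epic_comp by meson

lemma zero_objectI:
  assumes "idm C X = 0"
  shows "zero_object C X"
proof -
  have "f = 0" if "f \<in> Hom C W X" for W f
    using idm_comp[OF that] comp_zero_left[OF that] assms by simp
  moreover have "f = 0" if "f \<in> Hom C X W" for W f
    using comp_idm[OF that] comp_zero_right[OF that] assms by simp
  ultimately show ?thesis unfolding zero_object_def using zero_in_Hom by blast
qed

lemma zero_object_Hom: "zero_object C X \<Longrightarrow> f \<in> Hom C W X \<Longrightarrow> f = 0"
  "zero_object C X \<Longrightarrow> f \<in> Hom C X W \<Longrightarrow> f = 0"
  unfolding zero_object_def by blast+

lemma zero_object_monic: "zero_object C Y \<Longrightarrow> monic C X Y f \<Longrightarrow> zero_object C X"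
  by (metis zero_objectI monic_zero idm_in_Hom comp_idm monic_in_Hom zero_object_Hom(1))

lemma zero_object_epic: "zero_object C X \<Longrightarrow> epic C X Y f \<Longrightarrow> zero_object C Y"
  by (metis zero_objectI epic_zero idm_in_Hom idm_comp epic_in_Hom zero_object_Hom(2))

lemma epic_zero_object:
  assumes "epic C X Y 0"
  shows "zero_object C Y"
  by (metis zero_objectI assms epic_zero idm_in_Hom idm_comp epic_in_Hom)

text \<open>The image of \<open>h\<close> is a subobject of \<open>S\<close>, hence zero or all of
  \<open>S\<close>.\<close>

lemma to_simple_zero_or_epic:
  assumes "simple_object C S" "h \<in> Hom C A S"
  shows "h = 0 \<or> epic C A S h"
proof -
  let ?m = "image_map C A S h"
  obtain e where e: "epic C A (image_obj C A S h) e" "?m \<cdot> e = h"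
    and m: "monic C (image_obj C A S h) S ?m" using image_factor[OF assms(2)] .
  consider "zero_object C (image_obj C A S h)" | "iso_mor C (image_obj C A S h) S ?m"
    using assms(1) m unfolding simple_object_def by blast
  then show ?thesis
  proof cases
    case 1
    then have "e = 0" using zero_object_Hom(1) epic_in_Hom[OF e(1)] by blast
    then show ?thesis using e(2) comp_zero_right[OF monic_in_Hom[OF m]] by simp
  next
    case 2
    then show ?thesis using epic_comp[OF e(1) iso_mor_monic_epic(2)[OF 2]] e(2) by simp
  qed
qed

lemma short_exact_lift:
  assumes "short_exact C X f Y g Z" "y \<in> Hom C W Y" "g \<cdot> y = 0"
  obtains x where "x \<in> Hom C W X" "f \<cdot> x = y"
  using kernel_factor[OF short_exact_kernel[OF assms(1)] assms(2,3)] .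

text \<open>The third isomorphism theorem for \<open>A \<subseteq> X' \<subseteq> X\<close>, where
  \<open>g a = 0\<close> says that \<open>A\<close> lies in \<open>X'\<close>: the object
  \<open>B' = X'/A\<close> embeds in \<open>B = X/A\<close> with quotient \<open>S\<close>.\<close>

lemma quotient_short_exact:
  assumes A: "short_exact C A a X b B" and X': "short_exact C X' f X g S" and ga: "g \<cdot> a = 0"
  obtains a' B' b' m n where "short_exact C A a' X' b' B'" "short_exact C B' m B n S"
proof -
  note AD = short_exactD[OF A] and XD = short_exactD[OF X']
  obtain a' where a': "a' \<in> Hom C A X'" "f \<cdot> a' = a" using short_exact_lift[OF X' AD(4) ga] .
  have ma': "monic C A X' a'" using monic_right_factor[OF a'(1) XD(4)] a'(2) AD(1) by simp
  obtain B' b' where b': "is_cokernel C A X' a' B' b'" using cokernel_exists[OF a'(1)] by blast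
  note bD = is_cokernelD[OF b'] and be = cokernel_epic[OF b']
  have ex': "short_exact C A a' X' b' B'" by (rule cokernel_short_exact[OF ma' b'])
  have bf: "b \<cdot> f \<in> Hom C X' B" using comp_in_Hom[OF XD(4) AD(5)] .
  have "(b \<cdot> f) \<cdot> a' = 0" using comp_assoc[OF a'(1) XD(4) AD(5)] a'(2) AD(6) by simp
  then obtain m where m: "m \<in> Hom C B' B" "m \<cdot> b' = b \<cdot> f" using cokernel_factor[OF b' bf] by metis
  obtain n where n: "n \<in> Hom C B S" "n \<cdot> b = g"
    using cokernel_factor[OF exact_epic_cokernel[OF AD(3,2)] XD(5) ga] .
  have mb: "m \<cdot> (b' \<cdot> x) = b \<cdot> (f \<cdot> x)" if "x \<in> Hom C W X'" for W x
    using comp_assoc[OF that bD(2) m(1)] comp_assoc[OF that XD(4) AD(5)] m(2) by simp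
  have nb: "n \<cdot> (b \<cdot> x) = g \<cdot> x" if "x \<in> Hom C W X" for W x
    using comp_assoc[OF that AD(5) n(1)] n(2) by simp
  have "monic C B' B m"
  proof (rule monicI[OF m(1)])
    fix W u assume u: "u \<in> Hom C W B'" "m \<cdot> u = 0"
    obtain W' e x where x: "epic C W' W e" "x \<in> Hom C W' X'" "b' \<cdot> x = u \<cdot> e"
      using epi_pullback[OF be u(1)] .
    note e = epic_in_Hom[OF x(1)]
    have "b \<cdot> (f \<cdot> x) = 0"
      using mb[OF x(2)] comp_zero_restrict[OF u(2,1) m(1) e] x(3) by simp
    then obtain y where y: "y \<in> Hom C W' A" "a \<cdot> y = f \<cdot> x"
      using short_exact_lift[OF A comp_in_Hom[OF x(2) XD(4)]] by metis
    have "f \<cdot> (a' \<cdot> y) = f \<cdot> x" using comp_assoc[OF y(1) a'(1) XD(4)] a'(2) y(2) by simp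
    then have "a' \<cdot> y = x" using monic_cancel[OF XD(1) comp_in_Hom[OF y(1) a'(1)] x(2)] by simp
    then have "u \<cdot> e = 0"
      using comp_assoc[OF y(1) a'(1) bD(2)] bD(3) comp_zero_left[OF y(1)] x(3) by simp
    then show "u = 0" using epic_zero[OF x(1) u(1)] by simp
  qed
  moreover have "epic C B S n" using epic_left_factor[OF AD(5) n(1)] n(2) XD(2) by simp
  moreover have "exact_at C B' m B n S"
  proof (rule exact_atI[OF m(1) n(1)])
    have "(n \<cdot> m) \<cdot> b' = 0" using comp_assoc[OF bD(2) m(1) n(1)] m(2) nb[OF XD(4)] XD(6) by simp
    then show "n \<cdot> m = 0" using epic_zero[OF be comp_in_Hom[OF m(1) n(1)]] by simp
    fix W y assume y: "y \<in> Hom C W B" "n \<cdot> y = 0"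
    obtain W' e x where x: "epic C W' W e" "x \<in> Hom C W' X" "b \<cdot> x = y \<cdot> e"
      using epi_pullback[OF AD(2) y(1)] .
    have "g \<cdot> x = 0"
      using nb[OF x(2)] x(3) comp_zero_restrict[OF y(2,1) n(1) epic_in_Hom[OF x(1)]] by simp
    then obtain z where z: "z \<in> Hom C W' X'" "f \<cdot> z = x" using short_exact_lift[OF X' x(2)] by metis
    have "m \<cdot> (b' \<cdot> z) = y \<cdot> e" using mb[OF z(1)] z(2) x(3) by simp
    then show "\<exists>W' e x. epic C W' W e \<and> x \<in> Hom C W' B' \<and> m \<cdot> x = y \<cdot> e"
      using x(1) comp_in_Hom[OF z(1) bD(2)] by blast
  qed
  ultimately show thesis using that ex' unfolding short_exact_def by blast
qed

text \<open>Here \<open>A\<close> covers the top factor \<open>S\<close>. So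
  \<open>A' = A \<inter> X'\<close> satisfies \<open>A/A' = S\<close>, while
  \<open>A + X' = X\<close> gives \<open>X'/A' = X/A = B\<close>.\<close>

lemma sub_short_exact:
  assumes A: "short_exact C A a X b B" and X': "short_exact C X' f X g S"
    and ga: "epic C A S (g \<cdot> a)"
  obtains A' k a' where "short_exact C A' k A (g \<cdot> a) S" "short_exact C A' a' X' (b \<cdot> f) B"
proof -
  note AD = short_exactD[OF A] and XD = short_exactD[OF X']
  obtain A' k where k: "is_kernel C A S (g \<cdot> a) A' k"
    using kernel_exists[OF epic_in_Hom[OF ga]] by blast
  note kD = is_kernelD[OF k]
  have exA: "short_exact C A' k A (g \<cdot> a) S" using kernel_short_exact[OF ga k] .
  have ak: "a \<cdot> k \<in> Hom C A' X" using comp_in_Hom[OF kD(2) AD(4)] .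
  have "g \<cdot> (a \<cdot> k) = 0" using comp_assoc[OF kD(2) AD(4) XD(5)] kD(3) by simp
  then obtain a' where a': "a' \<in> Hom C A' X'" "f \<cdot> a' = a \<cdot> k"
    using short_exact_lift[OF X' ak] by metis
  have bf: "b \<cdot> f \<in> Hom C X' B" using comp_in_Hom[OF XD(4) AD(5)] .
  have "monic C A' X' a'"
    using monic_right_factor[OF a'(1) XD(4)] a'(2) monic_comp[OF kernel_monic[OF k] AD(1)] by simp
  moreover have "epic C X' B (b \<cdot> f)"
  proof (rule epicI[OF bf])
    fix W v assume v: "v \<in> Hom C B W" "v \<cdot> (b \<cdot> f) = 0"
    have vb: "v \<cdot> b \<in> Hom C X W" using comp_in_Hom[OF AD(5) v(1)] .
    have "(v \<cdot> b) \<cdot> f = 0" using comp_assoc[OF XD(4) AD(5) v(1)] v(2) by simp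
    then obtain w where w: "w \<in> Hom C S W" "w \<cdot> g = v \<cdot> b"
      using cokernel_factor[OF exact_epic_cokernel[OF XD(3,2)] vb] by metis
    have "w \<cdot> (g \<cdot> a) = 0"
      using comp_assoc[OF AD(4) XD(5) w(1)] comp_assoc[OF AD(4,5) v(1)] w(2) AD(6)
        comp_zero_right[OF v(1)] by simp
    then have "w = 0" using epic_zero[OF ga w(1)] by simp
    then have "v \<cdot> b = 0" using w(2) comp_zero_left[OF XD(5)] by simp
    then show "v = 0" using epic_zero[OF AD(2) v(1)] by simp
  qed
  moreover have "exact_at C A' a' X' (b \<cdot> f) B"
  proof (rule exact_atI[OF a'(1) bf])
    show "(b \<cdot> f) \<cdot> a' = 0"
      using comp_assoc[OF a'(1) XD(4) AD(5)] comp_assoc[OF kD(2) AD(4) AD(5)] a'(2) AD(6)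
        comp_zero_left[OF kD(2)] by simp
    fix W x assume x: "x \<in> Hom C W X'" "(b \<cdot> f) \<cdot> x = 0"
    have "b \<cdot> (f \<cdot> x) = 0" using comp_assoc[OF x(1) XD(4) AD(5)] x(2) by simp
    then obtain y where y: "y \<in> Hom C W A" "a \<cdot> y = f \<cdot> x"
      using short_exact_lift[OF A comp_in_Hom[OF x(1) XD(4)]] by metis
    have "(g \<cdot> a) \<cdot> y = 0"
      using comp_assoc[OF y(1) AD(4) XD(5)] comp_assoc[OF x(1) XD(4,5)] y(2) XD(6) comp_zero_left[OF x(1)]
      by simp
    then obtain z where z: "z \<in> Hom C W A'" "k \<cdot> z = y" using kernel_factor[OF k y(1)] by metis
    have "f \<cdot> (a' \<cdot> z) = f \<cdot> x"
      using comp_assoc[OF z(1) a'(1) XD(4)] comp_assoc[OF z(1) kD(2) AD(4)] a'(2) z(2) y(2) by simp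
    then have "a' \<cdot> z = x \<cdot> idm C W"
      using monic_cancel[OF XD(1) comp_in_Hom[OF z(1) a'(1)] x(1)] comp_idm[OF x(1)] by simp
    then show "\<exists>W' e y. epic C W' W e \<and> y \<in> Hom C W' A' \<and> a' \<cdot> y = x \<cdot> e"
      using epic_idm z(1) by blast
  qed
  ultimately show thesis using that exA unfolding short_exact_def by blast
qed

lemma occurrences_Cons:
  "occurrences C S (T # Ts) = (if isomorphic C S T then 1 else 0) + occurrences C S Ts"
  unfolding occurrences_def by simp

text \<open>The top factor \<open>S\<close> of \<open>X\<close> belongs to \<open>B\<close> if
  \<open>A\<close> lies in \<open>X'\<close>, and to \<open>A\<close> if \<open>A\<close> maps onto
  \<open>S\<close>; there is no third case, because a morphism into a simple object is zero or epic.
  Uniqueness and additivity of multiplicities both follow from this splitting.\<close>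

lemma composition_series_split:
  assumes "composition_series C X Ss" "short_exact C A a X b B"
  shows "\<exists>As Bs. composition_series C A As \<and> composition_series C B Bs \<and>
    (\<forall>S. occurrences C S Ss = occurrences C S As + occurrences C S Bs)"
  using assms
proof (induction arbitrary: A a b B rule: composition_series.induct)
  case (zero X)
  note D = short_exactD[OF zero(2)]
  have "zero_object C A" "zero_object C B"
    using zero_object_monic[OF zero(1) D(1)] zero_object_epic[OF zero(1) D(2)] by auto
  then have "composition_series C A []" "composition_series C B []"
    by (auto intro: composition_series.zero)
  moreover have "\<forall>S. occurrences C S [] = occurrences C S [] + occurrences C S []"
    by (simp add: occurrences_def)
  ultimately show ?case by blast
next
  case (step X' Ss f X g S)
  have "g \<cdot> a \<in> Hom C A S"
    using comp_in_Hom short_exactD(4)[OF step(5)] short_exactD(5)[OF step(2)] by blast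
  then consider "g \<cdot> a = 0" | "epic C A S (g \<cdot> a)" using to_simple_zero_or_epic[OF step(3)] by blast
  then show ?case
  proof cases
    case 1
    obtain a' B' b' m n where ex: "short_exact C A a' X' b' B'" "short_exact C B' m B n S"
      using quotient_short_exact[OF step(5,2) 1] .
    obtain As Bs where s: "composition_series C A As" "composition_series C B' Bs"
      "\<forall>S. occurrences C S Ss = occurrences C S As + occurrences C S Bs"
      using step.IH[OF ex(1)] by blast
    have "composition_series C B (S # Bs)" by (rule composition_series.step[OF s(2) ex(2) step(3)])
    moreover have "\<forall>T. occurrences C T (S # Ss) = occurrences C T As + occurrences C T (S # Bs)"
      using s(3) by (simp add: occurrences_Cons)
    ultimately show ?thesis using s(1) by blast
  next
    case 2
    obtain A' k a' where ex: "short_exact C A' k A (g \<cdot> a) S" "short_exact C A' a' X' (b \<cdot> f) B"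
      using sub_short_exact[OF step(5,2) 2] .
    obtain As Bs where s: "composition_series C A' As" "composition_series C B Bs"
      "\<forall>S. occurrences C S Ss = occurrences C S As + occurrences C S Bs"
      using step.IH[OF ex(2)] by blast
    have "composition_series C A (S # As)" by (rule composition_series.step[OF s(1) ex(1) step(3)])
    moreover have "\<forall>T. occurrences C T (S # Ss) = occurrences C T (S # As) + occurrences C T Bs"
      using s(3) by (simp add: occurrences_Cons)
    ultimately show ?thesis using s(2) by blast
  qed
qed

lemma composition_series_zero_object:
  assumes "composition_series C X Ss" "zero_object C X"
  shows "Ss = []"
  using assms
proof cases
  case (step A Ss' f g S)
  then have "zero_object C S" using zero_object_epic[OF assms(2)] short_exactD(2) by blast
  then show ?thesis using step unfolding simple_object_def by blast
qed

lemma composition_series_simple: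
  assumes "composition_series C S Ss" "simple_object C S"
  shows "\<exists>T. Ss = [T] \<and> isomorphic C S T"
  using assms(1)
proof cases
  case zero
  then show ?thesis using assms(2) unfolding simple_object_def by blast
next
  case (step A Ss' f g T)
  note D = short_exactD[OF step(3)]
  consider "zero_object C A" | "iso_mor C A S f" using assms(2) D(1) unfolding simple_object_def by blast
  then show ?thesis
  proof cases
    case 1
    have "f = 0" using zero_object_Hom(2)[OF 1 D(4)] .
    have "monic C S T g"
    proof (rule monicI[OF D(5)])
      fix W u assume u: "u \<in> Hom C W S" "g \<cdot> u = 0"
      obtain x where x: "x \<in> Hom C W A" "f \<cdot> x = u" using short_exact_lift[OF step(3) u] .
      then show "u = 0" using \<open>f = 0\<close> comp_zero_left[OF x(1)] by simp
    qed
    then have "isomorphic C S T" unfolding isomorphic_def using monic_epic_iso[OF _ D(2)] by blast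
    then show ?thesis using composition_series_zero_object[OF step(2) 1] step(1) by blast
  next
    case 2
    have "g = 0" using epic_zero[OF iso_mor_monic_epic(2)[OF 2] D(5,6)] .
    then have "zero_object C T" using epic_zero_object D(2) by blast
    then show ?thesis using step(4) unfolding simple_object_def by blast
  qed
qed

text \<open>Splitting the second series along the top step of the first leaves a series of
  \<open>A\<close>, covered by the induction, and a series of the simple object \<open>T\<close>,
  whose only factor is isomorphic to \<open>T\<close>.\<close>

theorem Jordan_Hoelder:
  assumes "composition_series C X Ss" "composition_series C X Ts"
  shows "occurrences C S Ss = occurrences C S Ts"
  using assms
proof (induction arbitrary: Ts rule: composition_series.induct)
  case (zero X)
  then show ?case using composition_series_zero_object by blast
next
  case (step A Ss f X g T)
  obtain As Bs where s: "composition_series C A As" "composition_series C T Bs"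
    "\<forall>S. occurrences C S Ts = occurrences C S As + occurrences C S Bs"
    using composition_series_split[OF step(5,2)] by blast
  obtain T' where T': "Bs = [T']" "isomorphic C T T'" using composition_series_simple[OF s(2) step(3)] by blast
  have "isomorphic C S T \<longleftrightarrow> isomorphic C S T'"
    using T'(2) isomorphic_sym isomorphic_trans by blast
  then have "occurrences C S Bs = occurrences C S [T]" unfolding T'(1) by (simp add: occurrences_Cons)
  then show ?case using step.IH[OF s(1)] s(3) by (simp add: occurrences_Cons occurrences_def)
qed

lemma occurrences_short_exact:
  assumes "short_exact C A a X b B"
    and "composition_series C A As" "composition_series C X Ss" "composition_series C B Bs"
  shows "occurrences C S Ss = occurrences C S As + occurrences C S Bs"
  using composition_series_split[OF assms(3,1)] Jordan_Hoelder assms(2,4) by metis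

lemma biproduct_short_exact:
  assumes "biproduct C A B P"
  obtains a b where "short_exact C A a P b B"
proof -
  obtain i1 i2 p1 p2 where
    P: "i1 \<in> Hom C A P" "i2 \<in> Hom C B P" "p1 \<in> Hom C P A" "p2 \<in> Hom C P B"
    "p1 \<cdot> i1 = idm C A" "p2 \<cdot> i2 = idm C B" "p1 \<cdot> i2 = 0" "p2 \<cdot> i1 = 0"
    "i1 \<cdot> p1 + i2 \<cdot> p2 = idm C P"
    using assms unfolding biproduct_def by blast
  have m: "monic C A P i1"
    using monic_right_factor[OF P(1,3)] P(5) monic_idm by simp
  have e: "epic C P B p2" using epic_left_factor[OF P(2,4)] P(6) epic_idm by simp
  have "is_kernel C P B p2 A i1"
  proof (rule is_kernelI[OF P(4) m P(8)])
    fix W h assume h: "h \<in> Hom C W P" "p2 \<cdot> h = 0"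
    have ip: "i1 \<cdot> p1 \<in> Hom C P P" "i2 \<cdot> p2 \<in> Hom C P P" using comp_in_Hom P by blast+
    have "h = (i1 \<cdot> p1) \<cdot> h + (i2 \<cdot> p2) \<cdot> h"
      using comp_add_left[OF h(1) ip] P(9) idm_comp[OF h(1)] by simp
    then have "h = i1 \<cdot> (p1 \<cdot> h)"
      using comp_assoc[OF h(1) P(3,1)] comp_assoc[OF h(1) P(4,2)] h(2) comp_zero_right[OF P(2)] by simp
    then show "\<exists>u\<in>Hom C W A. i1 \<cdot> u = h" using comp_in_Hom[OF h(1) P(3)] by metis
  qed
  then show thesis using that short_exactI[OF m _ e] by blast
qed

text \<open>With \<open>I\<close> the image of \<open>f\<close>, the object \<open>I\<close> is a
  quotient of \<open>A\<close>, and exactness makes \<open>B/I\<close> a subobject of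
  \<open>D\<close>. Additivity along the three resulting short exact sequences gives the
  bound.\<close>

lemma occurrences_exact_at:
  assumes ex: "exact_at C A f B g D"
    and s: "composition_series C A As" "composition_series C B Bs" "composition_series C D Ds"
  shows "occurrences C S Bs \<le> occurrences C S As + occurrences C S Ds"
proof -
  note exD = exact_atD[OF ex]
  let ?I = "image_obj C A B f" and ?m = "image_map C A B f"
  have km: "is_kernel C B D g ?I ?m" using ex unfolding exact_at_def by blast
  note mD = is_kernelD[OF km]
  obtain e where e: "epic C A ?I e" "?m \<cdot> e = f" and m: "monic C ?I B ?m" using image_factor[OF exD(1)] .
  obtain K k where k: "is_kernel C A ?I e K k" using kernel_exists[OF epic_in_Hom[OF e(1)]] by blast
  obtain J q where q: "is_cokernel C ?I B ?m J q" using cokernel_exists[OF monic_in_Hom[OF m]] by blast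
  note qD = is_cokernelD[OF q]
  obtain n where n: "n \<in> Hom C J D" "n \<cdot> q = g" using cokernel_factor[OF q exD(2) mD(3)] .
  \<comment> \<open>\<open>J = B/I\<close> embeds in \<open>D\<close>, since a local element of
    \<open>B\<close> killed by \<open>g\<close> lies in \<open>I\<close>.\<close>
  have mn: "monic C J D n"
  proof (rule monicI[OF n(1)])
    fix W u assume u: "u \<in> Hom C W J" "n \<cdot> u = 0"
    obtain W' \<epsilon> x where x: "epic C W' W \<epsilon>" "x \<in> Hom C W' B" "q \<cdot> x = u \<cdot> \<epsilon>"
      using epi_pullback[OF cokernel_epic[OF q] u(1)] .
    have "g \<cdot> x = 0"
      using comp_assoc[OF x(2) qD(2) n(1)] n(2) x(3)
        comp_zero_restrict[OF u(2,1) n(1) epic_in_Hom[OF x(1)]] by simp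
    then obtain z where z: "z \<in> Hom C W' ?I" "?m \<cdot> z = x" using kernel_factor[OF km x(2)] by metis
    have "u \<cdot> \<epsilon> = 0" using comp_assoc[OF z(1) mD(2) qD(2)] z(2) qD(3) comp_zero_left[OF z(1)] x(3) by simp
    then show "u = 0" using epic_zero[OF x(1) u(1)] by simp
  qed
  obtain R r where r: "is_cokernel C J D n R r" using cokernel_exists[OF n(1)] by blast
  have 1: "short_exact C K k A e ?I" using kernel_short_exact[OF e(1) k] .
  have 2: "short_exact C ?I ?m B q J" using cokernel_short_exact[OF m q] .
  have 3: "short_exact C J n D r R" using cokernel_short_exact[OF mn r] .
  obtain Ks Is where 4: "composition_series C K Ks" "composition_series C ?I Is"
    using composition_series_split[OF s(1) 1] by blast
  obtain Js Rs where 5: "composition_series C J Js" "composition_series C R Rs"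
    using composition_series_split[OF s(3) 3] by blast
  show ?thesis
    using occurrences_short_exact[OF 1 4(1) s(1) 4(2)] occurrences_short_exact[OF 2 4(2) s(2) 5(1)]
      occurrences_short_exact[OF 3 5(1) s(3) 5(2)] by simp
qed

end

section \<open>Coherence\<close>

text \<open>A morphism bundled with its source and target, so that the simplifier can decide which
  composites are defined.\<close>

datatype ('o, 'm) arrow = Arrow (src: 'o) (mor: 'm) (trg: 'o)

context tensor_category
begin

definition arr where "arr F \<longleftrightarrow> mor F \<in> Hom C (src F) (trg F)"

definition acomp (infixr \<open>\<odot>\<close> 70) where "E \<odot> F = Arrow (src F) (mor E \<cdot> mor F) (trg E)"

definition atens (infixr \<open>\<star>\<close> 75)
  where "F \<star> E = Arrow (src F \<otimes> src E) (mor F \<boxtimes> mor E) (trg F \<otimes> trg E)"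

definition ide where "ide X = Arrow X (idm C X) X"

definition asc where "asc X Y Z = Arrow ((X \<otimes> Y) \<otimes> Z) (assoc C X Y Z) (X \<otimes> (Y \<otimes> Z))"

definition asi where
  "asi X Y Z = Arrow (X \<otimes> (Y \<otimes> Z)) (inv_mor C ((X \<otimes> Y) \<otimes> Z) (X \<otimes> (Y \<otimes> Z)) (assoc C X Y Z)) ((X \<otimes> Y) \<otimes> Z)"

definition lun where "lun X = Arrow (\<one> \<otimes> X) (lunit C X) X"

definition run where "run X = Arrow (X \<otimes> \<one>) (runit C X) X"

definition aiso where "aiso F \<longleftrightarrow> arr F \<and>
  (\<exists>E. arr E \<and> src E = trg F \<and> trg E = src F \<and> E \<odot> F = ide (src F) \<and> F \<odot> E = ide (trg F))"

lemma src_trg [simp]: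
  "src (E \<odot> F) = src F" "trg (E \<odot> F) = trg E"
  "src (F \<star> E) = src F \<otimes> src E" "trg (F \<star> E) = trg F \<otimes> trg E"
  "src (ide X) = X" "trg (ide X) = X"
  "src (asc X Y Z) = (X \<otimes> Y) \<otimes> Z" "trg (asc X Y Z) = X \<otimes> (Y \<otimes> Z)"
  "src (asi X Y Z) = X \<otimes> (Y \<otimes> Z)" "trg (asi X Y Z) = (X \<otimes> Y) \<otimes> Z"
  "src (lun X) = \<one> \<otimes> X" "trg (lun X) = X" "src (run X) = X \<otimes> \<one>" "trg (run X) = X"
  by (simp_all add: acomp_def atens_def ide_def asc_def asi_def lun_def run_def)

lemma arr_acomp [simp]: "arr E \<Longrightarrow> arr F \<Longrightarrow> src E = trg F \<Longrightarrow> arr (E \<odot> F)"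
  by (auto simp: arr_def acomp_def intro: comp_in_Hom)

lemma arr_atens [simp]: "arr F \<Longrightarrow> arr E \<Longrightarrow> arr (F \<star> E)"
  by (auto simp: arr_def atens_def intro: tensm_in_Hom)

lemma arr_ide [simp]: "arr (ide X)"
  by (simp add: arr_def ide_def idm_in_Hom)

lemma inverse_asc:
  "inverse_mor C ((X \<otimes> Y) \<otimes> Z) (X \<otimes> (Y \<otimes> Z)) (assoc C X Y Z) (mor (asi X Y Z))"
  unfolding asi_def using inv_mor_inverse[OF assoc_iso] by simp

lemma arr_asc [simp]: "arr (asc X Y Z)" and arr_asi [simp]: "arr (asi X Y Z)"
  using inverse_asc[of X Y Z] by (auto simp: arr_def inverse_mor_def asc_def asi_def)

lemma asc_asi [simp]: "asc X Y Z \<odot> asi X Y Z = ide (X \<otimes> (Y \<otimes> Z))"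
  and asi_asc [simp]: "asi X Y Z \<odot> asc X Y Z = ide ((X \<otimes> Y) \<otimes> Z)"
  using inverse_asc[of X Y Z] by (auto simp: inverse_mor_def asc_def acomp_def ide_def asi_def)

lemma aiso_Arrow: "iso_mor C X Y f \<Longrightarrow> aiso (Arrow X f Y)"
  unfolding iso_mor_def inverse_mor_def aiso_def arr_def acomp_def ide_def
  by (metis arrow.sel)

lemma aiso_arr [simp]: "aiso F \<Longrightarrow> arr F"
  by (simp add: aiso_def)

lemma aiso_lun [simp]: "aiso (lun X)" and aiso_run [simp]: "aiso (run X)"
  unfolding lun_def run_def by (simp_all add: aiso_Arrow lunit_iso runit_iso)

lemma aiso_asc [simp]: "aiso (asc X Y Z)" and aiso_asi [simp]: "aiso (asi X Y Z)"
  unfolding aiso_def by (metis arr_asc arr_asi asc_asi asi_asc src_trg(7-10))+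

lemma acomp_assoc [simp]:
  "arr H \<Longrightarrow> arr E \<Longrightarrow> arr F \<Longrightarrow> src H = trg E \<Longrightarrow> src E = trg F \<Longrightarrow> (H \<odot> E) \<odot> F = H \<odot> E \<odot> F"
  by (auto simp: arr_def acomp_def intro: comp_assoc)

lemma acomp_ide [simp]: "arr F \<Longrightarrow> X = src F \<Longrightarrow> F \<odot> ide X = F"
  by (cases F) (auto simp: arr_def acomp_def ide_def intro: comp_idm)

lemma ide_acomp [simp]: "arr F \<Longrightarrow> X = trg F \<Longrightarrow> ide X \<odot> F = F"
  by (cases F) (auto simp: arr_def acomp_def ide_def intro: idm_comp)

lemma ide_tens: "ide (X \<otimes> Y) = ide X \<star> ide Y"
  by (simp add: ide_def atens_def tensm_idm)

lemma interchange:
  "arr E \<Longrightarrow> arr F \<Longrightarrow> arr E' \<Longrightarrow> arr F' \<Longrightarrow> src E = trg F \<Longrightarrow> src E' = trg F' \<Longrightarrow>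
    (E \<star> E') \<odot> (F \<star> F') = (E \<odot> F) \<star> (E' \<odot> F')"
  by (auto simp: arr_def acomp_def atens_def intro: tensm_comp[symmetric])

text \<open>The simplifier nests composites to the right, so inside a longer composite an equation
  for \<open>A \<odot> B\<close> matches only in this form with a tail \<open>Z\<close>.\<close>

lemma acomp_ext:
  "A \<odot> B = R \<Longrightarrow> arr A \<Longrightarrow> arr B \<Longrightarrow> src A = trg B \<Longrightarrow> arr Z \<Longrightarrow> src B = trg Z \<Longrightarrow> A \<odot> B \<odot> Z = R \<odot> Z"
  using acomp_assoc by metis

lemma interchange_ext:
  "arr E \<Longrightarrow> arr F \<Longrightarrow> arr E' \<Longrightarrow> arr F' \<Longrightarrow> src E = trg F \<Longrightarrow> src E' = trg F' \<Longrightarrow>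
    arr Z \<Longrightarrow> trg Z = src F \<otimes> src F' \<Longrightarrow>
    (E \<star> E') \<odot> (F \<star> F') \<odot> Z = ((E \<odot> F) \<star> (E' \<odot> F')) \<odot> Z"
  by (rule acomp_ext[OF interchange]) auto

lemma asi_asc_ext [simp]:
  "arr F \<Longrightarrow> trg F = (X \<otimes> Y) \<otimes> Z \<Longrightarrow> asi X Y Z \<odot> asc X Y Z \<odot> F = F"
  using acomp_ext[OF asi_asc, of X Y Z F] by simp

lemma asc_asi_ext [simp]:
  "arr F \<Longrightarrow> trg F = X \<otimes> (Y \<otimes> Z) \<Longrightarrow> asc X Y Z \<odot> asi X Y Z \<odot> F = F"
  using acomp_ext[OF asc_asi, of X Y Z F] by simp

lemma asc_natural:
  "arr F \<Longrightarrow> arr E \<Longrightarrow> arr H \<Longrightarrow>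
    asc (trg F) (trg E) (trg H) \<odot> ((F \<star> E) \<star> H) = (F \<star> (E \<star> H)) \<odot> asc (src F) (src E) (src H)"
  by (auto simp: arr_def acomp_def atens_def asc_def intro: assoc_natural)

lemma asc_nat:
  "arr F \<Longrightarrow> arr E \<Longrightarrow> arr H \<Longrightarrow> X = trg F \<Longrightarrow> Y = trg E \<Longrightarrow> Z = trg H \<Longrightarrow>
    asc X Y Z \<odot> ((F \<star> E) \<star> H) = (F \<star> (E \<star> H)) \<odot> asc (src F) (src E) (src H)"
  by (simp add: asc_natural)

lemma asc_nat_ext:
  "arr F \<Longrightarrow> arr E \<Longrightarrow> arr H \<Longrightarrow> X = trg F \<Longrightarrow> Y = trg E \<Longrightarrow> Z = trg H \<Longrightarrow> arr K \<Longrightarrow>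
    trg K = (src F \<otimes> src E) \<otimes> src H \<Longrightarrow>
    asc X Y Z \<odot> ((F \<star> E) \<star> H) \<odot> K = (F \<star> (E \<star> H)) \<odot> asc (src F) (src E) (src H) \<odot> K"
  using acomp_ext[OF asc_nat, of F E H X Y Z K] by simp

lemma asi_nat:
  assumes "arr F" "arr E" "arr H" "X = trg F" "Y = trg E" "Z = trg H"
  shows "asi X Y Z \<odot> (F \<star> (E \<star> H)) = ((F \<star> E) \<star> H) \<odot> asi (src F) (src E) (src H)"
proof -
  have "asi X Y Z \<odot> (F \<star> (E \<star> H)) =
      asi X Y Z \<odot> ((F \<star> (E \<star> H)) \<odot> asc (src F) (src E) (src H)) \<odot> asi (src F) (src E) (src H)"
    using assms by simp
  also have "\<dots> = ((F \<star> E) \<star> H) \<odot> asi (src F) (src E) (src H)"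
    unfolding asc_nat[OF assms, symmetric] using assms by simp
  finally show ?thesis .
qed

lemma lun_nat: "arr F \<Longrightarrow> Y = trg F \<Longrightarrow> lun Y \<odot> (ide \<one> \<star> F) = F \<odot> lun (src F)"
  by (auto simp: arr_def acomp_def atens_def lun_def ide_def intro: lunit_natural)

lemma apentagon:
  "asc W X (Y \<otimes> Z) \<odot> asc (W \<otimes> X) Y Z = (ide W \<star> asc X Y Z) \<odot> asc W (X \<otimes> Y) Z \<odot> (asc W X Y \<star> ide Z)"
  using pentagon[of W X Y Z] by (simp add: acomp_def atens_def asc_def ide_def)

lemma aiso_inverse:
  assumes "aiso F"
  obtains E where "arr E" "src E = trg F" "trg E = src F" "E \<odot> F = ide (src F)" "F \<odot> E = ide (trg F)"
  using assms that unfolding aiso_def by (elim conjE exE)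

lemma aiso_acomp [simp]:
  assumes "aiso F" "aiso E" "src E = trg F"
  shows "aiso (E \<odot> F)"
proof -
  obtain F' where F': "arr F'" "src F' = trg F" "trg F' = src F" "F' \<odot> F = ide (src F)" "F \<odot> F' = ide (trg F)"
    using aiso_inverse[OF assms(1)] .
  obtain E' where E': "arr E'" "src E' = trg E" "trg E' = src E" "E' \<odot> E = ide (src E)" "E \<odot> E' = ide (trg E)"
    using aiso_inverse[OF assms(2)] .
  have a: "arr F" "arr E" using assms by auto
  have "(F' \<odot> E') \<odot> (E \<odot> F) = F' \<odot> (E' \<odot> E \<odot> F)" using a assms(3) F' E' by simp
  also have "E' \<odot> E \<odot> F = F" using acomp_ext[OF E'(4), of F] a E' assms(3) by simp
  finally have 1: "(F' \<odot> E') \<odot> (E \<odot> F) = ide (src F)" using F' by simp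
  have "(E \<odot> F) \<odot> (F' \<odot> E') = E \<odot> (F \<odot> F' \<odot> E')" using a assms(3) F' E' by simp
  also have "F \<odot> F' \<odot> E' = E'" using acomp_ext[OF F'(5), of E'] a F' E' assms(3) by simp
  finally have 2: "(E \<odot> F) \<odot> (F' \<odot> E') = ide (trg E)" using E' by simp
  show ?thesis unfolding aiso_def
    by (intro conjI exI[of _ "F' \<odot> E'"]) (use 1 2 a F' E' assms(3) in auto)
qed

lemma aiso_atens [simp]:
  assumes "aiso F" "aiso E"
  shows "aiso (F \<star> E)"
proof -
  obtain F' where F': "arr F'" "src F' = trg F" "trg F' = src F" "F' \<odot> F = ide (src F)" "F \<odot> F' = ide (trg F)"
    using aiso_inverse[OF assms(1)] .
  obtain E' where E': "arr E'" "src E' = trg E" "trg E' = src E" "E' \<odot> E = ide (src E)" "E \<odot> E' = ide (trg E)"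
    using aiso_inverse[OF assms(2)] .
  show ?thesis unfolding aiso_def
    by (intro conjI exI[of _ "F' \<star> E'"]) (use assms F' E' in \<open>auto simp: interchange ide_tens\<close>)
qed

lemma aiso_ide [simp]: "aiso (ide X)"
  unfolding aiso_def by (metis arr_ide acomp_ide src_trg(5,6))

lemma aiso_cancel_left:
  assumes "aiso F" "arr U" "arr V" "trg U = src F" "trg V = src F" "F \<odot> U = F \<odot> V"
  shows "U = V"
proof -
  obtain E where E: "arr E" "src E = trg F" "trg E = src F" "E \<odot> F = ide (src F)"
    using aiso_inverse[OF assms(1)] .
  have "U = E \<odot> F \<odot> U" using acomp_ext[OF E(4), of U] assms(1,2,4) E(1-3) by simp
  also have "\<dots> = E \<odot> F \<odot> V" by (simp only: assms(6))
  also have "\<dots> = V" using acomp_ext[OF E(4), of V] assms(1,3,5) E(1-3) by simp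
  finally show ?thesis .
qed

lemma aiso_cancel_right:
  assumes "aiso F" "arr U" "arr V" "src U = trg F" "src V = trg F" "U \<odot> F = V \<odot> F"
  shows "U = V"
proof -
  obtain E where E: "arr E" "src E = trg F" "trg E = src F" "F \<odot> E = ide (trg F)"
    using aiso_inverse[OF assms(1)] .
  have "U = (U \<odot> F) \<odot> E" using assms(1,2,4) E by simp
  also have "\<dots> = (V \<odot> F) \<odot> E" by (simp only: assms(6))
  also have "\<dots> = V" using assms(1,3,5) E by simp
  finally show ?thesis .
qed

text \<open>Naturality of \<open>lun\<close> makes tensoring with the unit object isomorphic to the
  identity functor.\<close>

lemma ide_unit_tens_cancel:
  assumes "arr U" "arr V" "trg U = trg V" "src U = src V" "ide \<one> \<star> U = ide \<one> \<star> V"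
  shows "U = V"
proof (rule aiso_cancel_right[of "lun (src U)"])
  show "U \<odot> lun (src U) = V \<odot> lun (src U)"
    using lun_nat[of U "trg U"] lun_nat[of V "trg U"] assms by simp
qed (use assms in auto)

text \<open>The two zigzag identities, in the form that makes transposition along the duality injective.\<close>

lemma transpose_back:
  assumes ev: "arr ev" "src ev = V \<otimes> X" "trg ev = \<one>"
    and coev: "arr coev" "src coev = \<one>" "trg coev = X \<otimes> V"
    and zig: "run X \<odot> (ide X \<star> ev) \<odot> asc X V X \<odot> (coev \<star> ide X) = lun X"
    and U: "arr U" "src U = W" "trg U = X \<otimes> A"
  shows "(run X \<star> ide A) \<odot> asi X \<one> A \<odot> (ide X \<star> ((ev \<star> ide A) \<odot> asi V X A \<odot> (ide V \<star> U)))
           \<odot> asc X V W \<odot> (coev \<star> ide W)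
       = (lun X \<star> ide A) \<odot> asi \<one> X A \<odot> (ide \<one> \<star> U)"
proof -
  note t = ev coev U
  \<comment> \<open>Naturality of the associator and interchange move \<open>U\<close> to the right
    end, where it acts before \<open>coev\<close>.\<close>
  have 1: "(ide X \<star> (ide V \<star> U)) \<odot> asc X V W \<odot> (coev \<star> ide W)
      = asc X V (X \<otimes> A) \<odot> (coev \<star> ide (X \<otimes> A)) \<odot> (ide \<one> \<star> U)"
    using t asc_nat_ext[of "ide X" "ide V" U X V "X \<otimes> A" "coev \<star> ide W"]
    by (simp add: interchange flip: ide_tens)
  have 2: "coev \<star> ide (X \<otimes> A) = asc (X \<otimes> V) X A \<odot> ((coev \<star> ide X) \<star> ide A) \<odot> asi \<one> X A"
    using t asc_nat_ext[of coev "ide X" "ide A" "X \<otimes> V" X A "asi \<one> X A"] by (simp add: ide_tens interchange)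
  \<comment> \<open>The pentagon for \<open>X, V, X, A\<close>; what remains afterwards is the
    zigzag composite tensored with \<open>A\<close>.\<close>
  have 3: "(ide X \<star> asi V X A) \<odot> asc X V (X \<otimes> A) \<odot> asc (X \<otimes> V) X A
      = asc X (V \<otimes> X) A \<odot> (asc X V X \<star> ide A)"
    using t by (simp add: apentagon interchange interchange_ext flip: ide_tens)
  have 4: "(ide X \<star> (ev \<star> ide A)) \<odot> asc X (V \<otimes> X) A = asc X \<one> A \<odot> ((ide X \<star> ev) \<star> ide A)"
    using t by (simp add: asc_nat)
  have "(ide X \<star> ((ev \<star> ide A) \<odot> asi V X A \<odot> (ide V \<star> U))) \<odot> asc X V W \<odot> (coev \<star> ide W)
      = (ide X \<star> (ev \<star> ide A)) \<odot> (ide X \<star> asi V X A) \<odot> (ide X \<star> (ide V \<star> U)) \<odot> asc X V W \<odot> (coev \<star> ide W)"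
    using t by (simp add: interchange_ext)
  also have "\<dots> = (ide X \<star> (ev \<star> ide A)) \<odot> ((ide X \<star> asi V X A) \<odot> asc X V (X \<otimes> A) \<odot> asc (X \<otimes> V) X A)
      \<odot> ((coev \<star> ide X) \<star> ide A) \<odot> asi \<one> X A \<odot> (ide \<one> \<star> U)"
    unfolding 1 2 using t by simp
  also have "\<dots> = ((ide X \<star> (ev \<star> ide A)) \<odot> asc X (V \<otimes> X) A) \<odot> (asc X V X \<star> ide A)
      \<odot> ((coev \<star> ide X) \<star> ide A) \<odot> asi \<one> X A \<odot> (ide \<one> \<star> U)"
    unfolding 3 using t by simp
  also have "\<dots> = asc X \<one> A \<odot> ((ide X \<star> ev) \<star> ide A) \<odot> (asc X V X \<star> ide A)
      \<odot> ((coev \<star> ide X) \<star> ide A) \<odot> asi \<one> X A \<odot> (ide \<one> \<star> U)"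
    unfolding 4 using t by simp
  finally have "(run X \<star> ide A) \<odot> asi X \<one> A \<odot> (ide X \<star> ((ev \<star> ide A) \<odot> asi V X A \<odot> (ide V \<star> U)))
           \<odot> asc X V W \<odot> (coev \<star> ide W)
      = ((run X \<odot> (ide X \<star> ev) \<odot> asc X V X \<odot> (coev \<star> ide X)) \<star> ide A) \<odot> asi \<one> X A \<odot> (ide \<one> \<star> U)"
    using t by (simp add: interchange interchange_ext)
  then show ?thesis unfolding zig .
qed

lemma transpose_forth:
  assumes ev: "arr ev" "src ev = V \<otimes> X" "trg ev = \<one>"
    and coev: "arr coev" "src coev = \<one>" "trg coev = X \<otimes> V"
    and H: "arr H" "src H = V \<otimes> T" "trg H = W"
  shows "(ev \<star> ide W) \<odot> asi V X W \<odot> (ide V \<star> ((ide X \<star> H) \<odot> asc X V T \<odot> (coev \<star> ide T)))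
       = (ide \<one> \<star> H) \<odot> asc \<one> V T \<odot> (((ev \<star> ide V) \<odot> asi V X V \<odot> (ide V \<star> coev)) \<star> ide T) \<odot> asi V \<one> T"
proof -
  note t = ev coev H
  have 1: "(ev \<star> ide W) \<odot> asi V X W \<odot> (ide V \<star> (ide X \<star> H))
      = (ide \<one> \<star> H) \<odot> (ev \<star> ide (V \<otimes> T)) \<odot> asi V X (V \<otimes> T)"
    using t by (simp add: asi_nat interchange_ext flip: ide_tens)
  \<comment> \<open>The pentagon for \<open>V, X, V, T\<close>, with two of its associators moved to
    the other side as inverses.\<close>
  have "asc (V \<otimes> X) V T \<odot> (asi V X V \<star> ide T)
      = asi V X (V \<otimes> T) \<odot> (asc V X (V \<otimes> T) \<odot> asc (V \<otimes> X) V T) \<odot> (asi V X V \<star> ide T)"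
    using t by simp
  also have "\<dots> = asi V X (V \<otimes> T) \<odot> (ide V \<star> asc X V T) \<odot> asc V (X \<otimes> V) T"
    unfolding apentagon using t by (simp add: interchange flip: ide_tens)
  finally have two: "asc (V \<otimes> X) V T \<odot> (asi V X V \<star> ide T)
      = asi V X (V \<otimes> T) \<odot> (ide V \<star> asc X V T) \<odot> asc V (X \<otimes> V) T" .
  have "asi V X (V \<otimes> T) \<odot> (ide V \<star> asc X V T)
      = (asi V X (V \<otimes> T) \<odot> (ide V \<star> asc X V T) \<odot> asc V (X \<otimes> V) T) \<odot> asi V (X \<otimes> V) T"
    using t by simp
  then have 2: "asi V X (V \<otimes> T) \<odot> (ide V \<star> asc X V T)
      = asc (V \<otimes> X) V T \<odot> (asi V X V \<star> ide T) \<odot> asi V (X \<otimes> V) T"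
    unfolding two[symmetric] using t by simp
  have 3: "asi V (X \<otimes> V) T \<odot> (ide V \<star> (coev \<star> ide T)) = ((ide V \<star> coev) \<star> ide T) \<odot> asi V \<one> T"
    using t by (simp add: asi_nat)
  have 4: "(ev \<star> ide (V \<otimes> T)) \<odot> asc (V \<otimes> X) V T = asc \<one> V T \<odot> ((ev \<star> ide V) \<star> ide T)"
    using t by (simp add: asc_nat ide_tens)
  have "(ev \<star> ide W) \<odot> asi V X W \<odot> (ide V \<star> ((ide X \<star> H) \<odot> asc X V T \<odot> (coev \<star> ide T)))
     = ((ev \<star> ide W) \<odot> asi V X W \<odot> (ide V \<star> (ide X \<star> H))) \<odot> (ide V \<star> asc X V T) \<odot> (ide V \<star> (coev \<star> ide T))"
    using t by (simp add: interchange interchange_ext)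
  also have "\<dots> = (ide \<one> \<star> H) \<odot> (ev \<star> ide (V \<otimes> T)) \<odot> (asi V X (V \<otimes> T) \<odot> (ide V \<star> asc X V T)) \<odot> (ide V \<star> (coev \<star> ide T))"
    unfolding 1 using t by simp
  also have "\<dots> = (ide \<one> \<star> H) \<odot> ((ev \<star> ide (V \<otimes> T)) \<odot> asc (V \<otimes> X) V T) \<odot> (asi V X V \<star> ide T)
      \<odot> (asi V (X \<otimes> V) T \<odot> (ide V \<star> (coev \<star> ide T)))"
    unfolding 2 using t by simp
  also have "\<dots> = (ide \<one> \<star> H) \<odot> asc \<one> V T \<odot> ((ev \<star> ide V) \<star> ide T) \<odot> (asi V X V \<star> ide T)
      \<odot> ((ide V \<star> coev) \<star> ide T) \<odot> asi V \<one> T"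
    unfolding 3 4 using t by simp
  finally show ?thesis using t by (simp add: interchange_ext)
qed

end

section \<open>The symmetry on neighbouring factors\<close>

context symmetric_tensor_category
begin

definition br where "br X Y = Arrow (X \<otimes> Y) (braid C X Y) (Y \<otimes> X)"

definition sigma where "sigma A B W = asc B A W \<odot> (br A B \<star> ide W) \<odot> asi A B W"

lemma br_simps [simp]: "arr (br X Y)" "src (br X Y) = X \<otimes> Y" "trg (br X Y) = Y \<otimes> X"
  "br Y X \<odot> br X Y = ide (X \<otimes> Y)"
  by (simp_all add: br_def arr_def braid_in_Hom acomp_def ide_def braid_symmetric)

lemma br_nat:
  "arr F \<Longrightarrow> arr E \<Longrightarrow> X = trg F \<Longrightarrow> Y = trg E \<Longrightarrow> br X Y \<odot> (F \<star> E) = (E \<star> F) \<odot> br (src F) (src E)"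
  by (auto simp: br_def arr_def acomp_def atens_def intro: braid_natural)

lemma ahexagon:
  "asc Y Z X \<odot> br X (Y \<otimes> Z) \<odot> asc X Y Z = (ide Y \<star> br X Z) \<odot> asc Y X Z \<odot> (br X Y \<star> ide Z)"
  using hexagon[of Y Z X] by (simp add: acomp_def atens_def asc_def ide_def br_def)

lemma sigma_simps [simp]: "arr (sigma A B W)" "src (sigma A B W) = A \<otimes> (B \<otimes> W)"
  "trg (sigma A B W) = B \<otimes> (A \<otimes> W)"
  by (simp_all add: sigma_def)

lemma sigma_asc: "sigma A B W \<odot> asc A B W = asc B A W \<odot> (br A B \<star> ide W)"
  by (simp add: sigma_def)

lemma sigma_sigma: "sigma B A W \<odot> sigma A B W = ide (A \<otimes> (B \<otimes> W))"
  by (simp add: sigma_def interchange_ext flip: ide_tens)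

lemma sigma_nat:
  assumes "arr F" "arr E" "arr H" "A = trg F" "B = trg E" "W = trg H"
  shows "sigma A B W \<odot> (F \<star> (E \<star> H)) = (E \<star> (F \<star> H)) \<odot> sigma (src F) (src E) (src H)"
proof -
  have "sigma A B W \<odot> (F \<star> (E \<star> H))
      = asc B A W \<odot> ((br A B \<odot> (F \<star> E)) \<star> H) \<odot> asi (src F) (src E) (src H)"
    using assms by (simp add: sigma_def asi_nat interchange_ext)
  also have "\<dots> = asc B A W \<odot> ((E \<star> F) \<star> H) \<odot> (br (src F) (src E) \<star> ide (src H))
      \<odot> asi (src F) (src E) (src H)"
    using assms by (simp add: br_nat interchange_ext)
  also have "\<dots> = (E \<star> (F \<star> H)) \<odot> sigma (src F) (src E) (src H)"
    using assms by (simp add: sigma_def asc_nat_ext)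
  finally show ?thesis .
qed

section \<open>Tensoring with an object preserves monomorphisms and cokernels\<close>

lemma mor_acomp [simp]:
  "mor (E \<odot> F) = mor E \<cdot> mor F"
  by (simp add: acomp_def)

lemma mor_atens [simp]: "mor (E \<star> F) = mor E \<boxtimes> mor F"
  by (simp add: atens_def)

lemma mor_ide [simp]: "mor (ide X) = idm C X"
  by (simp add: ide_def)

lemma arr_Arrow [simp]: "arr (Arrow X f Y) \<longleftrightarrow> f \<in> Hom C X Y"
  by (simp add: arr_def)

lemma arr_Hom: "arr F \<Longrightarrow> mor F \<in> Hom C (src F) (trg F)"
  by (simp add: arr_def)

text \<open>\<open>X \<otimes> -\<close> is right adjoint to \<open>V \<otimes> -\<close> for the
  left dual \<open>V\<close> of \<open>X\<close>, so it preserves monomorphisms. The transpose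
  \<open>P\<close> turns a morphism into \<open>X \<otimes> src F\<close> into one that ends, up to
  the unit, in \<open>src F\<close>; it is compatible with \<open>F\<close> and injective.\<close>

lemma tens_cancel_left:
  assumes F: "arr F"
    and mono: "\<And>U U'. arr U \<Longrightarrow> arr U' \<Longrightarrow> src U = src U' \<Longrightarrow> trg U = src F \<Longrightarrow> trg U' = src F \<Longrightarrow>
      F \<odot> U = F \<odot> U' \<Longrightarrow> U = U'"
    and U: "arr U" "arr U'" "src U = src U'" "trg U = X \<otimes> src F" "trg U' = X \<otimes> src F"
      "(ide X \<star> F) \<odot> U = (ide X \<star> F) \<odot> U'"
  shows "U = U'"
proof -
  define A where "A = src F"
  obtain V e c where ec: "e \<in> Hom C (V \<otimes> X) \<one>" "c \<in> Hom C \<one> (X \<otimes> V)"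
    "runit C X \<cdot> (idm C X \<boxtimes> e) \<cdot> assoc C X V X \<cdot> (c \<boxtimes> idm C X) = lunit C X"
    using rigid_left[of X] unfolding left_dual_def by blast
  define ev coev where "ev = Arrow (V \<otimes> X) e \<one>" and "coev = Arrow \<one> c (X \<otimes> V)"
  have ev: "arr ev" "src ev = V \<otimes> X" "trg ev = \<one>" and coev: "arr coev" "src coev = \<one>" "trg coev = X \<otimes> V"
    using ec by (simp_all add: ev_def coev_def)
  have zig: "run X \<odot> (ide X \<star> ev) \<odot> asc X V X \<odot> (coev \<star> ide X) = lun X"
    using ec(3) by (simp add: ev_def coev_def run_def lun_def acomp_def atens_def ide_def asc_def)
  have F': "src F = A" by (simp add: A_def)
  define P where "P u = (ev \<star> ide A) \<odot> asi V X A \<odot> (ide V \<star> u)" for u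
  have P: "arr (P u)" "src (P u) = V \<otimes> src u" "trg (P u) = \<one> \<otimes> A"
    if "arr u" "trg u = X \<otimes> A" for u using that ev by (simp_all add: P_def)
  have FP: "F \<odot> lun A \<odot> P u
      = lun (trg F) \<odot> (ev \<star> ide (trg F)) \<odot> asi V X (trg F) \<odot> (ide V \<star> ((ide X \<star> F) \<odot> u))"
    if u: "arr u" "trg u = X \<otimes> A" for u
  proof -
    have "F \<odot> lun A \<odot> P u = lun (trg F) \<odot> (ide \<one> \<star> F) \<odot> P u"
      using acomp_ext[OF lun_nat[of F "trg F"], of "P u"] P[OF u] F F' by simp
    also have "(ide \<one> \<star> F) \<odot> P u = ((ev \<star> ide (trg F)) \<odot> (ide (V \<otimes> X) \<star> F)) \<odot> asi V X A \<odot> (ide V \<star> u)"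
      unfolding P_def using F F' ev u by (simp add: interchange interchange_ext)
    also have "\<dots> = (ev \<star> ide (trg F)) \<odot> (((ide V \<star> ide X) \<star> F) \<odot> asi V X A) \<odot> (ide V \<star> u)"
      using F F' ev u by (simp add: ide_tens)
    also have "((ide V \<star> ide X) \<star> F) \<odot> asi V X A = asi V X (trg F) \<odot> (ide V \<star> (ide X \<star> F))"
      using F F' by (simp add: asi_nat)
    finally show ?thesis using F F' ev u by (simp add: interchange)
  qed
  have U': "trg U = X \<otimes> A" "trg U' = X \<otimes> A" using U by (simp_all add: A_def)
  have "F \<odot> lun A \<odot> P U = F \<odot> lun A \<odot> P U'"
    unfolding FP[OF U(1) U'(1)] FP[OF U(2) U'(2)] U(6) ..
  then have "lun A \<odot> P U = lun A \<odot> P U'" using mono P U U' F' by simp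
  then have PP: "P U = P U'" using aiso_cancel_left[OF aiso_lun] P U U' by simp
  \<comment> \<open>\<open>transpose_back\<close> recovers \<open>ide \<one> \<star> U\<close> from
    \<open>P U\<close> up to isomorphisms.\<close>
  have "(lun X \<star> ide A) \<odot> asi \<one> X A \<odot> (ide \<one> \<star> U) = (lun X \<star> ide A) \<odot> asi \<one> X A \<odot> (ide \<one> \<star> U')"
    using transpose_back[OF ev coev zig U(1) refl U'(1)] transpose_back[OF ev coev zig U(2) refl U'(2)]
      PP[unfolded P_def] U(3) by simp
  then have "asi \<one> X A \<odot> (ide \<one> \<star> U) = asi \<one> X A \<odot> (ide \<one> \<star> U')"
    using aiso_cancel_left[of "lun X \<star> ide A"] U U' by simp
  then have "ide \<one> \<star> U = ide \<one> \<star> U'" using aiso_cancel_left[of "asi \<one> X A"] U U' by simp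
  then show ?thesis using ide_unit_tens_cancel U by simp
qed

lemma tens_monic_left:
  assumes "monic C A B f"
  shows "monic C (X \<otimes> A) (X \<otimes> B) (idm C X \<boxtimes> f)"
  unfolding monic_def
proof (intro conjI allI ballI impI)
  note f = monic_in_Hom[OF assms]
  show "idm C X \<boxtimes> f \<in> Hom C (X \<otimes> A) (X \<otimes> B)" using tensm_in_Hom[OF idm_in_Hom f] .
  fix W u v assume uv: "u \<in> Hom C W (X \<otimes> A)" "v \<in> Hom C W (X \<otimes> A)"
    "(idm C X \<boxtimes> f) \<cdot> u = (idm C X \<boxtimes> f) \<cdot> v"
  have "Arrow W u (X \<otimes> A) = Arrow W v (X \<otimes> A)"
  proof (rule tens_cancel_left[of "Arrow A f B" _ _ X])
    fix P Q
    assume P: "arr P" "arr Q" "src P = src Q" "trg P = src (Arrow A f B)" "trg Q = src (Arrow A f B)"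
      "Arrow A f B \<odot> P = Arrow A f B \<odot> Q"
    have "mor P = mor Q"
      using monic_cancel[OF assms, of "mor P" "src P" "mor Q"] P arr_Hom[of P] arr_Hom[of Q]
      by (simp add: acomp_def)
    then show "P = Q" using P by (simp add: arrow.expand)
  qed (use f uv in \<open>simp_all add: acomp_def atens_def ide_def\<close>)
  then show "u = v" by simp
qed

lemma tensm_zero_left: "f \<in> Hom C X Y \<Longrightarrow> 0 \<boxtimes> f = 0"
  using tensm_add_left[of 0 X X 0 f X Y] zero_in_Hom by simp

lemma tensm_zero_right: "f \<in> Hom C X Y \<Longrightarrow> f \<boxtimes> 0 = 0"
  using tensm_add_right[of f X Y 0 X X 0] zero_in_Hom by simp

text \<open>Rigidity supplies an \<open>X\<close> whose left dual is \<open>V\<close>, so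
  \<open>V \<otimes> -\<close> is left adjoint to \<open>X \<otimes> -\<close> and preserves
  cokernels. Here \<open>hat\<close> is the transposition, and \<open>unhat\<close> recovers
  \<open>H\<close> from its transpose up to the isomorphism \<open>\<Theta>\<close>.\<close>

lemma tens_cokernel_left:
  assumes q: "is_cokernel C S T \<pi> Q q"
  shows "is_cokernel C (V \<otimes> S) (V \<otimes> T) (idm C V \<boxtimes> \<pi>) (V \<otimes> Q) (idm C V \<boxtimes> q)"
proof -
  note qD = is_cokernelD[OF q]
  define \<rho> q' where "\<rho> = Arrow S \<pi> T" and "q' = Arrow T q Q"
  have ar [simp]: "arr \<rho>" "src \<rho> = S" "trg \<rho> = T" "arr q'" "src q' = T" "trg q' = Q"
    using qD by (simp_all add: \<rho>_def q'_def)
  obtain X e c where ec: "e \<in> Hom C (V \<otimes> X) \<one>" "c \<in> Hom C \<one> (X \<otimes> V)"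
    "lunit C V \<cdot> (e \<boxtimes> idm C V)
          \<cdot> inv_mor C ((V \<otimes> X) \<otimes> V) (V \<otimes> (X \<otimes> V)) (assoc C V X V) \<cdot> (idm C V \<boxtimes> c) = runit C V"
    using rigid_right[of V] unfolding left_dual_def by blast
  define ev coev where "ev = Arrow (V \<otimes> X) e \<one>" and "coev = Arrow \<one> c (X \<otimes> V)"
  have ev: "arr ev" "src ev = V \<otimes> X" "trg ev = \<one>" and coev: "arr coev" "src coev = \<one>" "trg coev = X \<otimes> V"
    using ec by (simp_all add: ev_def coev_def)
  define \<zeta> where "\<zeta> = (ev \<star> ide V) \<odot> asi V X V \<odot> (ide V \<star> coev)"
  have \<zeta>: "arr \<zeta>" "src \<zeta> = V \<otimes> \<one>" "trg \<zeta> = \<one> \<otimes> V" using ev coev by (simp_all add: \<zeta>_def)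
  have zig: "lun V \<odot> \<zeta> = run V"
    using ec(3) by (simp add: \<zeta>_def ev_def coev_def run_def lun_def acomp_def atens_def ide_def asi_def)
  have \<zeta>iso: "aiso \<zeta>"
  proof -
    obtain l where l: "arr l" "src l = V" "trg l = \<one> \<otimes> V" "l \<odot> lun V = ide (\<one> \<otimes> V)" "lun V \<odot> l = ide V"
      using aiso_inverse[OF aiso_lun[of V]] by auto
    have "aiso l" unfolding aiso_def using l by (intro conjI exI[of _ "lun V"]) auto
    moreover have "\<zeta> = l \<odot> run V" unfolding zig[symmetric] using acomp_ext[OF l(4), of \<zeta>] l \<zeta> by simp
    ultimately show ?thesis using l by simp
  qed
  \<comment> \<open>The unit constraints do not disappear on transposing twice;
    \<open>\<Theta>\<close> collects them together with the zigzag \<open>\<zeta>\<close>. It is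
    invertible and natural, so it can be cancelled.\<close>
  define \<Theta> where "\<Theta> R = lun (V \<otimes> R) \<odot> asc \<one> V R \<odot> (\<zeta> \<star> ide R) \<odot> asi V \<one> R" for R
  have \<Theta>: "aiso (\<Theta> R)" "src (\<Theta> R) = V \<otimes> (\<one> \<otimes> R)" "trg (\<Theta> R) = V \<otimes> R" for R
    using \<zeta> \<zeta>iso by (simp_all add: \<Theta>_def)
  have \<Theta>nat: "\<Theta> Q \<odot> (ide V \<star> (ide \<one> \<star> q')) = (ide V \<star> q') \<odot> \<Theta> T"
  proof -
    have "\<Theta> Q \<odot> (ide V \<star> (ide \<one> \<star> q'))
        = lun (V \<otimes> Q) \<odot> asc \<one> V Q \<odot> ((\<zeta> \<star> ide Q) \<odot> ((ide V \<star> ide \<one>) \<star> q')) \<odot> asi V \<one> T"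
      unfolding \<Theta>_def using \<zeta> by (simp add: asi_nat)
    also have "(\<zeta> \<star> ide Q) \<odot> ((ide V \<star> ide \<one>) \<star> q') = ((ide \<one> \<star> ide V) \<star> q') \<odot> (\<zeta> \<star> ide T)"
      using \<zeta> by (simp add: interchange flip: ide_tens)
    also have "lun (V \<otimes> Q) \<odot> asc \<one> V Q \<odot> (((ide \<one> \<star> ide V) \<star> q') \<odot> (\<zeta> \<star> ide T)) \<odot> asi V \<one> T
        = (lun (V \<otimes> Q) \<odot> (ide \<one> \<star> (ide V \<star> q'))) \<odot> asc \<one> V T \<odot> (\<zeta> \<star> ide T) \<odot> asi V \<one> T"
      using \<zeta> by (simp add: asc_nat_ext)
    also have "lun (V \<otimes> Q) \<odot> (ide \<one> \<star> (ide V \<star> q')) = (ide V \<star> q') \<odot> lun (V \<otimes> T)"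
      by (simp add: lun_nat)
    finally show ?thesis unfolding \<Theta>_def using \<zeta> by simp
  qed
  obtain \<Theta>' where \<Theta>': "arr \<Theta>'" "src \<Theta>' = V \<otimes> Q" "trg \<Theta>' = V \<otimes> (\<one> \<otimes> Q)" "\<Theta>' \<odot> \<Theta> Q = ide (V \<otimes> (\<one> \<otimes> Q))"
    using aiso_inverse[OF \<Theta>(1)[of Q]] \<Theta>(2,3)[of Q] by metis
  have \<Theta>nat': "(ide V \<star> (ide \<one> \<star> q')) = \<Theta>' \<odot> (ide V \<star> q') \<odot> \<Theta> T"
    unfolding \<Theta>nat[symmetric] using acomp_ext[OF \<Theta>'(4), of "ide V \<star> (ide \<one> \<star> q')"] \<Theta>' \<Theta> by simp
  define hat where "hat R H = (ide X \<star> H) \<odot> asc X V R \<odot> (coev \<star> ide R)" for R H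
  have hat: "arr (hat R H)" "src (hat R H) = \<one> \<otimes> R" "trg (hat R H) = X \<otimes> trg H"
    if "arr H" "src H = V \<otimes> R" for R H using that coev by (simp_all add: hat_def)
  have unhat: "lun (trg H) \<odot> (ev \<star> ide (trg H)) \<odot> asi V X (trg H) \<odot> (ide V \<star> hat R H) = H \<odot> \<Theta> R"
    if H: "arr H" "src H = V \<otimes> R" for R H
  proof -
    have "lun (trg H) \<odot> (ev \<star> ide (trg H)) \<odot> asi V X (trg H) \<odot> (ide V \<star> hat R H)
        = (lun (trg H) \<odot> (ide \<one> \<star> H)) \<odot> asc \<one> V R \<odot> (\<zeta> \<star> ide R) \<odot> asi V \<one> R"
      unfolding hat_def transpose_forth[OF ev coev H refl] \<zeta>_def[symmetric] using H \<zeta> by simp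
    then show ?thesis unfolding \<Theta>_def using lun_nat[of H "trg H"] H \<zeta> by simp
  qed
  have hat_pre: "hat R H \<odot> (ide \<one> \<star> k) = hat (src k) (H \<odot> (ide V \<star> k))"
    if "arr H" "src H = V \<otimes> R" "arr k" "trg k = R" for R H k
  proof -
    have "hat R H \<odot> (ide \<one> \<star> k) = (ide X \<star> H) \<odot> asc X V R \<odot> ((ide X \<star> ide V) \<star> k) \<odot> (coev \<star> ide (src k))"
      unfolding hat_def using that coev by (simp add: interchange flip: ide_tens)
    then show ?thesis unfolding hat_def using that coev by (simp add: asc_nat_ext interchange_ext)
  qed
  \<comment> \<open>Existence in the universal property: transpose \<open>H\<close>, factor the
    transpose through \<open>q\<close>, transpose back.\<close>
  have factor: "\<exists>K. arr K \<and> src K = V \<otimes> Q \<and> trg K = trg H \<and> K \<odot> (ide V \<star> q') = H"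
    if H: "arr H" "src H = V \<otimes> T" and z: "mor H \<cdot> (idm C V \<boxtimes> \<pi>) = 0" for H
  proof -
    obtain l where l: "arr l" "src l = T" "trg l = \<one> \<otimes> T" "l \<odot> lun T = ide (\<one> \<otimes> T)"
      using aiso_inverse[OF aiso_lun[of T]] by auto
    have "l \<odot> \<rho> \<odot> lun S = ide \<one> \<star> \<rho>"
      using lun_nat[of \<rho> T] acomp_ext[OF l(4), of "ide \<one> \<star> \<rho>"] l by simp
    then have "hat T H \<odot> l \<odot> \<rho> \<odot> lun S = hat T H \<odot> (ide \<one> \<star> \<rho>)" by simp
    also have "\<dots> = hat S (H \<odot> (ide V \<star> \<rho>))" using hat_pre[OF H, of \<rho>] by simp
    also have "mor \<dots> = 0"
    proof -
      have "mor (H \<odot> (ide V \<star> \<rho>)) = 0" using z by (simp add: \<rho>_def)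
      then have "mor (ide X \<star> (H \<odot> (ide V \<star> \<rho>))) = 0" using tensm_zero_right[OF idm_in_Hom] by simp
      then show ?thesis unfolding hat_def
        using comp_zero_left[OF arr_Hom[of "asc X V S \<odot> (coev \<star> ide S)"]] coev by simp
    qed
    finally have "mor (hat T H \<odot> l \<odot> \<rho> \<odot> lun S) = 0" .
    moreover have "hat T H \<odot> l \<odot> \<rho> \<odot> lun S = ((hat T H \<odot> l) \<odot> \<rho>) \<odot> lun S"
      using hat[OF H] l by simp
    ultimately have "mor (((hat T H \<odot> l) \<odot> \<rho>) \<odot> lun S) = 0" by metis
    then have "(mor (hat T H \<odot> l) \<cdot> \<pi>) \<cdot> mor (lun S) = 0"
      by (simp only: mor_acomp \<rho>_def arrow.sel)
    then have z': "(mor (hat T H \<odot> l) \<cdot> \<pi>) \<cdot> lunit C S = 0" by (simp only: lun_def arrow.sel)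
    have hl: "mor (hat T H \<odot> l) \<in> Hom C T (X \<otimes> trg H)" using arr_Hom[of "hat T H \<odot> l"] hat[OF H] l by simp
    have "mor (hat T H \<odot> l) \<cdot> \<pi> = 0"
      using epic_zero[OF iso_mor_monic_epic(2)[OF lunit_iso[of S]] comp_in_Hom[OF qD(1) hl] z'] .
    then obtain k where k: "k \<in> Hom C Q (X \<otimes> trg H)" "k \<cdot> q = mor (hat T H \<odot> l)"
      using cokernel_factor[OF q hl] by metis
    define K where "K = Arrow Q k (X \<otimes> trg H)"
    have K [simp]: "arr K" "src K = Q" "trg K = X \<otimes> trg H" using k(1) by (simp_all add: K_def)
    have "K \<odot> q' = hat T H \<odot> l" using k hat[OF H] l by (intro arrow.expand) (simp add: K_def q'_def)
    then have "(K \<odot> q') \<odot> lun T = (hat T H \<odot> l) \<odot> lun T" by simp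
    then have "hat T H = K \<odot> q' \<odot> lun T" using hat[OF H] l by simp
    also have "q' \<odot> lun T = lun Q \<odot> (ide \<one> \<star> q')" using lun_nat[of q' Q] by simp
    finally have hatH: "hat T H = (K \<odot> lun Q) \<odot> (ide \<one> \<star> q')" by simp
    define M where "M = lun (trg H) \<odot> (ev \<star> ide (trg H)) \<odot> asi V X (trg H) \<odot> (ide V \<star> (K \<odot> lun Q))"
    have M: "arr M" "src M = V \<otimes> (\<one> \<otimes> Q)" "trg M = trg H" using ev by (simp_all add: M_def)
    have "H \<odot> \<Theta> T = M \<odot> (ide V \<star> (ide \<one> \<star> q'))"
      unfolding unhat[OF H, symmetric] hatH M_def using ev by (simp add: interchange)
    also have "\<dots> = (M \<odot> \<Theta>' \<odot> (ide V \<star> q')) \<odot> \<Theta> T" unfolding \<Theta>nat' using M \<Theta>' \<Theta> by simp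
    finally have "H = M \<odot> \<Theta>' \<odot> (ide V \<star> q')"
      using aiso_cancel_right[OF \<Theta>(1)[of T]] M \<Theta>' \<Theta> H by simp
    then show ?thesis using M \<Theta>' by (intro exI[of _ "M \<odot> \<Theta>'"]) simp
  qed
  show ?thesis
  proof (rule is_cokernelI)
    show "idm C V \<boxtimes> \<pi> \<in> Hom C (V \<otimes> S) (V \<otimes> T)" using tensm_in_Hom[OF idm_in_Hom qD(1)] .
    have iq: "idm C V \<boxtimes> q \<in> Hom C (V \<otimes> T) (V \<otimes> Q)" using tensm_in_Hom[OF idm_in_Hom qD(2)] .
    show "(idm C V \<boxtimes> q) \<cdot> (idm C V \<boxtimes> \<pi>) = 0"
      using tensm_comp[OF idm_in_Hom idm_in_Hom qD(1,2)] qD(3) comp_idm[OF idm_in_Hom]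
        tensm_zero_right[OF idm_in_Hom] by simp
    show "epic C (V \<otimes> T) (V \<otimes> Q) (idm C V \<boxtimes> q)"
      unfolding epic_def
    proof (intro conjI allI ballI impI iq)
      fix W u v assume uv: "u \<in> Hom C (V \<otimes> Q) W" "v \<in> Hom C (V \<otimes> Q) W"
        "u \<cdot> (idm C V \<boxtimes> q) = v \<cdot> (idm C V \<boxtimes> q)"
      define U U' where "U = Arrow (V \<otimes> Q) u W" and "U' = Arrow (V \<otimes> Q) v W"
      have U [simp]: "arr U" "src U = V \<otimes> Q" "trg U = W" "arr U'" "src U' = V \<otimes> Q" "trg U' = W"
        using uv by (simp_all add: U_def U'_def)
      have eq: "U \<odot> (ide V \<star> q') = U' \<odot> (ide V \<star> q')"
        using uv by (intro arrow.expand) (simp add: U_def U'_def q'_def)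
      \<comment> \<open>Uniqueness is checked on transposes: they agree after \<open>q'\<close>, and
        \<open>q\<close> is epic.\<close>
      have "hat Q U \<odot> (ide \<one> \<star> q') = hat Q U' \<odot> (ide \<one> \<star> q')"
        using hat_pre[of U Q q'] hat_pre[of U' Q q'] eq by simp
      moreover obtain l where l: "arr l" "src l = Q" "trg l = \<one> \<otimes> Q" "l \<odot> lun Q = ide (\<one> \<otimes> Q)"
        using aiso_inverse[OF aiso_lun[of Q]] by auto
      have "ide \<one> \<star> q' = l \<odot> q' \<odot> lun T"
        using lun_nat[of q' Q] acomp_ext[OF l(4), of "ide \<one> \<star> q'"] l by simp
      ultimately have "((hat Q U \<odot> l) \<odot> q') \<odot> lun T = ((hat Q U' \<odot> l) \<odot> q') \<odot> lun T"
        using hat[of U Q] hat[of U' Q] l by simp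
      then have "(hat Q U \<odot> l) \<odot> q' = (hat Q U' \<odot> l) \<odot> q'"
        using aiso_cancel_right[OF aiso_lun[of T], of "(hat Q U \<odot> l) \<odot> q'" "(hat Q U' \<odot> l) \<odot> q'"]
          hat[of U Q] hat[of U' Q] l by simp
      then have "mor ((hat Q U \<odot> l) \<odot> q') = mor ((hat Q U' \<odot> l) \<odot> q')" by (rule arg_cong)
      then have "mor (hat Q U \<odot> l) \<cdot> q = mor (hat Q U' \<odot> l) \<cdot> q"
        by (simp only: mor_acomp q'_def arrow.sel)
      then have "mor (hat Q U \<odot> l) = mor (hat Q U' \<odot> l)"
        using epic_cancel[OF cokernel_epic[OF q], of "mor (hat Q U \<odot> l)" "X \<otimes> W" "mor (hat Q U' \<odot> l)"] arr_Hom[of "hat Q U \<odot> l"] arr_Hom[of "hat Q U' \<odot> l"]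
          hat[of U Q] hat[of U' Q] l by simp
      then have "hat Q U \<odot> l = hat Q U' \<odot> l"
        using hat[of U Q] hat[of U' Q] l by (intro arrow.expand) simp
      then have "(hat Q U \<odot> l) \<odot> lun Q = (hat Q U' \<odot> l) \<odot> lun Q" by simp
      then have "hat Q U = hat Q U'" using hat[of U Q] hat[of U' Q] l by simp
      then have "U \<odot> \<Theta> Q = U' \<odot> \<Theta> Q" using unhat[of U Q] unhat[of U' Q] by simp
      then have "U = U'" using aiso_cancel_right[OF \<Theta>(1)[of Q]] \<Theta> by simp
      then show "u = v" by (simp add: U_def U'_def)
    qed
    fix W h assume h: "h \<in> Hom C (V \<otimes> T) W" "h \<cdot> (idm C V \<boxtimes> \<pi>) = 0"
    obtain K where K: "arr K" "src K = V \<otimes> Q" "trg K = W" "K \<odot> (ide V \<star> q') = Arrow (V \<otimes> T) h W"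
      using factor[of "Arrow (V \<otimes> T) h W"] h by auto
    have "mor K \<cdot> (idm C V \<boxtimes> q) = h" using arg_cong[OF K(4), of mor] by (simp add: q'_def)
    then show "\<exists>u\<in>Hom C (V \<otimes> Q) W. u \<cdot> (idm C V \<boxtimes> q) = h" using arr_Hom[OF K(1)] K(2,3) by auto
  qed
qed

end

context symmetric_tensor_category
begin

text \<open>After composition with invertible associators on the right, pentagons and the hexagon
  axiom bring both sides to one expression. The gain is that \<open>X\<close> may cross a whole
  block \<open>Y \<otimes> Z\<close> at once.\<close>

lemma sigma_hexagon:
  "asc Y Z (X \<otimes> W) \<odot> sigma X (Y \<otimes> Z) W
    = (ide Y \<star> sigma X Z W) \<odot> sigma X Y (Z \<otimes> W) \<odot> (ide X \<star> asc Y Z W)"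
proof (rule aiso_cancel_right[of "asc X (Y \<otimes> Z) W \<odot> (asc X Y Z \<star> ide W)"])
  have "(asc Y Z (X \<otimes> W) \<odot> sigma X (Y \<otimes> Z) W) \<odot> asc X (Y \<otimes> Z) W \<odot> (asc X Y Z \<star> ide W)
      = asc Y Z (X \<otimes> W) \<odot> (sigma X (Y \<otimes> Z) W \<odot> asc X (Y \<otimes> Z) W) \<odot> (asc X Y Z \<star> ide W)"
    by simp
  also have "\<dots> = (asc Y Z (X \<otimes> W) \<odot> asc (Y \<otimes> Z) X W) \<odot> (br X (Y \<otimes> Z) \<star> ide W) \<odot> (asc X Y Z \<star> ide W)"
    unfolding sigma_asc by simp
  also have "\<dots> = (ide Y \<star> asc Z X W) \<odot> asc Y (Z \<otimes> X) W \<odot> ((asc Y Z X \<odot> br X (Y \<otimes> Z) \<odot> asc X Y Z) \<star> ide W)"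
    unfolding apentagon by (simp add: interchange interchange_ext)
  also have "\<dots> = (ide Y \<star> asc Z X W) \<odot> asc Y (Z \<otimes> X) W \<odot> ((ide Y \<star> br X Z) \<star> ide W)
      \<odot> (asc Y X Z \<star> ide W) \<odot> ((br X Y \<star> ide Z) \<star> ide W)"
    unfolding ahexagon by (simp add: interchange)
  also have "\<dots> = (ide Y \<star> asc Z X W) \<odot> (ide Y \<star> (br X Z \<star> ide W)) \<odot> asc Y (X \<otimes> Z) W
      \<odot> (asc Y X Z \<star> ide W) \<odot> ((br X Y \<star> ide Z) \<star> ide W)"
    by (simp add: asc_nat_ext)
  also have "\<dots> = (ide Y \<star> (sigma X Z W \<odot> asc X Z W)) \<odot> asc Y (X \<otimes> Z) W
      \<odot> (asc Y X Z \<star> ide W) \<odot> ((br X Y \<star> ide Z) \<star> ide W)"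
    unfolding sigma_asc by (simp add: interchange_ext)
  finally have L: "(asc Y Z (X \<otimes> W) \<odot> sigma X (Y \<otimes> Z) W) \<odot> asc X (Y \<otimes> Z) W \<odot> (asc X Y Z \<star> ide W) = \<dots>" .
  have "((ide Y \<star> sigma X Z W) \<odot> sigma X Y (Z \<otimes> W) \<odot> (ide X \<star> asc Y Z W)) \<odot> asc X (Y \<otimes> Z) W \<odot> (asc X Y Z \<star> ide W)
      = (ide Y \<star> sigma X Z W) \<odot> sigma X Y (Z \<otimes> W) \<odot> ((ide X \<star> asc Y Z W) \<odot> asc X (Y \<otimes> Z) W \<odot> (asc X Y Z \<star> ide W))"
    by simp
  also have "\<dots> = (ide Y \<star> sigma X Z W) \<odot> (sigma X Y (Z \<otimes> W) \<odot> asc X Y (Z \<otimes> W)) \<odot> asc (X \<otimes> Y) Z W"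
    unfolding apentagon[symmetric] by simp
  also have "\<dots> = (ide Y \<star> sigma X Z W) \<odot> asc Y X (Z \<otimes> W) \<odot> ((br X Y \<star> (ide Z \<star> ide W)) \<odot> asc (X \<otimes> Y) Z W)"
    unfolding sigma_asc by (simp add: ide_tens)
  also have "(br X Y \<star> (ide Z \<star> ide W)) \<odot> asc (X \<otimes> Y) Z W = asc (Y \<otimes> X) Z W \<odot> ((br X Y \<star> ide Z) \<star> ide W)"
    by (simp add: asc_nat)
  also have "(ide Y \<star> sigma X Z W) \<odot> asc Y X (Z \<otimes> W) \<odot> asc (Y \<otimes> X) Z W \<odot> ((br X Y \<star> ide Z) \<star> ide W)
      = (ide Y \<star> sigma X Z W) \<odot> (asc Y X (Z \<otimes> W) \<odot> asc (Y \<otimes> X) Z W) \<odot> ((br X Y \<star> ide Z) \<star> ide W)"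
    by simp
  also have "\<dots> = (ide Y \<star> (sigma X Z W \<odot> asc X Z W)) \<odot> asc Y (X \<otimes> Z) W
      \<odot> (asc Y X Z \<star> ide W) \<odot> ((br X Y \<star> ide Z) \<star> ide W)"
    unfolding apentagon by (simp add: interchange_ext)
  finally show "(asc Y Z (X \<otimes> W) \<odot> sigma X (Y \<otimes> Z) W) \<odot> asc X (Y \<otimes> Z) W \<odot> (asc X Y Z \<star> ide W)
    = ((ide Y \<star> sigma X Z W) \<odot> sigma X Y (Z \<otimes> W) \<odot> (ide X \<star> asc Y Z W)) \<odot> asc X (Y \<otimes> Z) W \<odot> (asc X Y Z \<star> ide W)"
    unfolding L by simp
qed simp_all

text \<open>By \<open>sigma_hexagon\<close> both sides amount to \<open>X\<close> crossing the block
  \<open>Y \<otimes> Z\<close>, combined with the exchange of \<open>Y\<close> and \<open>Z\<close>.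
  The order is immaterial, because \<open>sigma\<close> is natural with respect to
  \<open>br Y Z\<close> on the block.\<close>

lemma yang_baxter:
  "(ide Z \<star> sigma X Y W) \<odot> sigma X Z (Y \<otimes> W) \<odot> (ide X \<star> sigma Y Z W)
    = sigma Y Z (X \<otimes> W) \<odot> (ide Y \<star> sigma X Z W) \<odot> sigma X Y (Z \<otimes> W)"
proof (rule aiso_cancel_right[of "ide X \<star> asc Y Z W"])
  have "((ide Z \<star> sigma X Y W) \<odot> sigma X Z (Y \<otimes> W) \<odot> (ide X \<star> sigma Y Z W)) \<odot> (ide X \<star> asc Y Z W)
      = (ide Z \<star> sigma X Y W) \<odot> sigma X Z (Y \<otimes> W) \<odot> (ide X \<star> (sigma Y Z W \<odot> asc Y Z W))"
    by (simp add: interchange)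
  also have "\<dots> = ((ide Z \<star> sigma X Y W) \<odot> sigma X Z (Y \<otimes> W) \<odot> (ide X \<star> asc Z Y W)) \<odot> (ide X \<star> (br Y Z \<star> ide W))"
    unfolding sigma_asc by (simp add: interchange)
  also have "\<dots> = asc Z Y (X \<otimes> W) \<odot> (sigma X (Z \<otimes> Y) W \<odot> (ide X \<star> (br Y Z \<star> ide W)))"
    unfolding sigma_hexagon[symmetric] by simp
  also have "\<dots> = (asc Z Y (X \<otimes> W) \<odot> (br Y Z \<star> ide (X \<otimes> W))) \<odot> sigma X (Y \<otimes> Z) W"
    by (simp add: sigma_nat ide_tens)
  also have "\<dots> = sigma Y Z (X \<otimes> W) \<odot> (asc Y Z (X \<otimes> W) \<odot> sigma X (Y \<otimes> Z) W)"
    unfolding sigma_asc[symmetric] by simp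
  also have "\<dots> = (sigma Y Z (X \<otimes> W) \<odot> (ide Y \<star> sigma X Z W) \<odot> sigma X Y (Z \<otimes> W)) \<odot> (ide X \<star> asc Y Z W)"
    unfolding sigma_hexagon by simp
  finally show "((ide Z \<star> sigma X Y W) \<odot> sigma X Z (Y \<otimes> W) \<odot> (ide X \<star> sigma Y Z W)) \<odot> (ide X \<star> asc Y Z W)
    = (sigma Y Z (X \<otimes> W) \<odot> (ide Y \<star> sigma X Z W) \<odot> sigma X Y (Z \<otimes> W)) \<odot> (ide X \<star> asc Y Z W)" .
qed simp_all

section \<open>The cycle on a list of factors, and its order\<close>

primrec tlist where
  "tlist [] = \<one>"
| "tlist (A # As) = A \<otimes> tlist As"

primrec alist where
  "alist [] = ide \<one>"
| "alist (F # Fs) = F \<star> alist Fs"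

text \<open>The factor \<open>Z\<close> travels from the last place to the front, across all of
  \<open>As\<close>. Mixed lists occur because the cycle on \<open>Y^{\<otimes>n}\<close> has to be
  restricted to words in \<open>X\<close> and \<open>Y\<close>.\<close>

primrec cycl where
  "cycl [] Z = ide (Z \<otimes> \<one>)"
| "cycl (A # As) Z = sigma A Z (tlist As) \<odot> (ide A \<star> cycl As Z)"

lemma alist_simps [simp]:
  "src (alist Fs) = tlist (map src Fs)" "trg (alist Fs) = tlist (map trg Fs)"
  "(\<And>F. F \<in> set Fs \<Longrightarrow> arr F) \<Longrightarrow> arr (alist Fs)"
  by (induction Fs) auto

lemma cycl_simps [simp]:
  "src (cycl As Z) = tlist (As @ [Z])" "trg (cycl As Z) = Z \<otimes> tlist As" "arr (cycl As Z)"
proof -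
  have "src (cycl As Z) = tlist (As @ [Z]) \<and> trg (cycl As Z) = Z \<otimes> tlist As \<and> arr (cycl As Z)"
    by (induction As) auto
  then show "src (cycl As Z) = tlist (As @ [Z])" "trg (cycl As Z) = Z \<otimes> tlist As" "arr (cycl As Z)"
    by auto
qed

lemma cycl_natural:
  assumes "\<And>F. F \<in> set Fs \<Longrightarrow> arr F" "arr E"
  shows "cycl (map trg Fs) (trg E) \<odot> alist (Fs @ [E]) = (E \<star> alist Fs) \<odot> cycl (map src Fs) (src E)"
  using assms(1)
proof (induction Fs)
  case Nil
  then show ?case using assms(2) by simp
next
  case (Cons F Fs)
  then have IH: "cycl (map trg Fs) (trg E) \<odot> alist (Fs @ [E]) = (E \<star> alist Fs) \<odot> cycl (map src Fs) (src E)"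
    and F: "arr F" by auto
  have Fs: "arr (alist Fs)" "arr (alist (Fs @ [E]))"
    by (rule alist_simps(3); use Cons.prems assms(2) in auto)+
  have "cycl (map trg (F # Fs)) (trg E) \<odot> alist ((F # Fs) @ [E])
     = sigma (trg F) (trg E) (tlist (map trg Fs)) \<odot> (F \<star> (cycl (map trg Fs) (trg E) \<odot> alist (Fs @ [E])))"
    using F Fs assms(2) by (simp add: interchange)
  also have "\<dots> = (sigma (trg F) (trg E) (tlist (map trg Fs)) \<odot> (F \<star> (E \<star> alist Fs)))
      \<odot> (ide (src F) \<star> cycl (map src Fs) (src E))"
    unfolding IH using F Fs assms(2) by (simp add: interchange)
  also have "\<dots> = ((E \<star> (F \<star> alist Fs)) \<odot> sigma (src F) (src E) (tlist (map src Fs)))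
      \<odot> (ide (src F) \<star> cycl (map src Fs) (src E))"
    using F Fs assms(2) by (simp add: sigma_nat)
  finally show ?case using F Fs assms(2) by simp
qed

primrec apow where
  "apow F 0 = ide (src F)"
| "apow F (Suc n) = F \<odot> apow F n"

lemma apow_simps [simp]:
  assumes "arr F" "trg F = src F"
  shows "arr (apow F n)" "src (apow F n) = src F" "trg (apow F n) = src F"
proof -
  have "arr (apow F n) \<and> src (apow F n) = src F \<and> trg (apow F n) = src F"
    using assms by (induction n) auto
  then show "arr (apow F n)" "src (apow F n) = src F" "trg (apow F n) = src F" by auto
qed

lemma apow_commute:
  assumes "arr F" "trg F = src F"
  shows "apow F n \<odot> F = F \<odot> apow F n"
  using assms by (induction n) auto

lemma apow_tens:
  assumes "arr F" "trg F = src F"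
  shows "apow (ide X \<star> F) n = ide X \<star> apow F n"
  using assms by (induction n) (auto simp: interchange ide_tens)

text \<open>The index is one less than the number of factors: this is the cycle on
  \<open>n + 1\<close> copies of \<open>X\<close>.\<close>

definition pcyc where "pcyc X n = cycl (replicate n X) X"

definition tp where "tp X n = tlist (replicate n X)"

lemma tp_simps [simp]: "tp X 0 = \<one>" "tp X (Suc n) = X \<otimes> tp X n"
  by (simp_all add: tp_def)

lemma pcyc_simps [simp]: "arr (pcyc X n)" "src (pcyc X n) = tp X (Suc n)" "trg (pcyc X n) = tp X (Suc n)"
proof -
  have "replicate n X @ [X] = replicate (Suc n) X" by (simp add: replicate_append_same)
  then show "arr (pcyc X n)" "src (pcyc X n) = tp X (Suc n)" "trg (pcyc X n) = tp X (Suc n)"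
    by (simp_all add: pcyc_def tp_def)
qed

lemma pcyc_0: "pcyc X 0 = ide (X \<otimes> \<one>)"
  by (simp add: pcyc_def)

lemma pcyc_Suc: "pcyc X (Suc n) = sigma X X (tp X n) \<odot> (ide X \<star> pcyc X n)"
  by (simp add: pcyc_def tp_def)

text \<open>The transposition of the factors \<open>i\<close> and \<open>i + 1\<close> (counted from 0) of the \<open>n\<close>-th tensor power.\<close>

primrec transp where
  "transp X n 0 = sigma X X (tp X (n - 2))"
| "transp X n (Suc i) = ide X \<star> transp X (n - 1) i"

lemma transp_simps:
  "i + 2 \<le> n \<Longrightarrow> arr (transp X n i) \<and> src (transp X n i) = tp X n \<and> trg (transp X n i) = tp X n"
proof (induction i arbitrary: n)
  case 0
  then obtain m where "n = Suc (Suc m)" by (metis add_2_eq_Suc le_Suc_ex plus_nat.add_0)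
  then show ?case by simp
next
  case (Suc i)
  then obtain m where "n = Suc m" "i + 2 \<le> m" by (cases n) auto
  then show ?case using Suc.IH[of m] by simp
qed

text \<open>The case \<open>i = 0\<close> is the Yang-Baxter relation; for larger \<open>i\<close> a
  factor \<open>X\<close> is split off and \<open>sigma\<close> is natural. The bound
  \<open>i + 2 \<le> n\<close> keeps the transposition away from the last of the
  \<open>n + 1\<close> factors, the one that jumps to the front.\<close>

lemma pcyc_transp:
  "i + 2 \<le> n \<Longrightarrow> pcyc X n \<odot> transp X (Suc n) i = transp X (Suc n) (Suc i) \<odot> pcyc X n"
proof (induction i arbitrary: n)
  case 0
  then obtain m where n: "n = Suc (Suc m)" by (metis add_2_eq_Suc le_Suc_ex plus_nat.add_0)
  let ?s = "sigma X X (X \<otimes> tp X m)" and ?t = "ide X \<star> sigma X X (tp X m)"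
  have "pcyc X n \<odot> transp X (Suc n) 0
      = ?s \<odot> ?t \<odot> ((ide X \<star> (ide X \<star> pcyc X m)) \<odot> ?s)"
    unfolding n pcyc_Suc by (simp add: interchange_ext)
  also have "\<dots> = (?s \<odot> ?t \<odot> ?s) \<odot> (ide X \<star> (ide X \<star> pcyc X m))"
    using sigma_nat[of "ide X" "ide X" "pcyc X m" X X "X \<otimes> tp X m"] by simp
  also have "\<dots> = (?t \<odot> ?s \<odot> ?t) \<odot> (ide X \<star> (ide X \<star> pcyc X m))"
    unfolding yang_baxter by simp
  also have "\<dots> = transp X (Suc n) (Suc 0) \<odot> pcyc X n"
    unfolding n pcyc_Suc by (simp add: interchange)
  finally show ?case .
next
  case (Suc i)
  then obtain m where n: "n = Suc m" "i + 2 \<le> m" by (cases n) auto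
  note t = transp_simps[of i "Suc m" X] transp_simps[of i m X]
  have "pcyc X n \<odot> transp X (Suc n) (Suc i)
      = sigma X X (tp X m) \<odot> (ide X \<star> (pcyc X m \<odot> transp X (Suc m) i))"
    unfolding n pcyc_Suc using n(2) t by (simp add: interchange)
  also have "\<dots> = (sigma X X (tp X m) \<odot> (ide X \<star> (ide X \<star> transp X m i))) \<odot> (ide X \<star> pcyc X m)"
    unfolding Suc.IH[OF n(2)] using n(2) t by (simp add: interchange)
  also have "\<dots> = (ide X \<star> (ide X \<star> transp X m i)) \<odot> pcyc X n"
    unfolding n pcyc_Suc using sigma_nat[of "ide X" "ide X" "transp X m i" X X "tp X m"] n(2) t by simp
  finally show ?case unfolding n by simp
qed

primrec transp_prod where
  "transp_prod X n 0 = ide (tp X n)"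
| "transp_prod X n (Suc k) = transp_prod X n k \<odot> transp X n k"

lemma transp_prod_simps:
  "k < n \<Longrightarrow> arr (transp_prod X n k) \<and> src (transp_prod X n k) = tp X n \<and> trg (transp_prod X n k) = tp X n"
  by (induction k) (use transp_simps[of _ n X] in auto)

text \<open>Tensoring with \<open>X\<close> on the left shifts every transposition by one position.
  This is the recursion that \<open>pcyc\<close> obeys.\<close>

lemma transp_prod_shift:
  "k < n \<Longrightarrow> transp_prod X (Suc n) (Suc k) = transp X (Suc n) 0 \<odot> (ide X \<star> transp_prod X n k)"
proof (induction k)
  case 0
  then show ?case using transp_simps[of 0 "Suc n" X] by (simp flip: ide_tens)
next
  case (Suc k)
  have "transp_prod X (Suc n) (Suc (Suc k)) = (transp X (Suc n) 0 \<odot> (ide X \<star> transp_prod X n k)) \<odot> (ide X \<star> transp X n k)"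
    using Suc by simp
  then show ?case
    using transp_simps[of 0 "Suc n" X] transp_prod_simps[of k n X] transp_simps[of k n X] Suc.prems
    by (simp add: interchange)
qed

lemma pcyc_transp_prod: "pcyc X n = transp_prod X (Suc n) n"
proof (induction n)
  case (Suc n)
  have "pcyc X (Suc n) = transp X (Suc (Suc n)) 0 \<odot> (ide X \<star> transp_prod X (Suc n) n)"
    unfolding pcyc_Suc Suc by simp
  then show ?case using transp_prod_shift[of n "Suc n" X] by simp
qed (simp add: pcyc_0)

lemma apow_pcyc_transp:
  "k < n \<Longrightarrow> apow (pcyc X n) k \<odot> transp X (Suc n) 0 = transp X (Suc n) k \<odot> apow (pcyc X n) k"
proof (induction k)
  case 0
  then show ?case using transp_simps[of 0 "Suc n" X] by simp
next
  case (Suc k)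
  note t = transp_simps[of 0 "Suc n" X] transp_simps[of k "Suc n" X] transp_simps[of "Suc k" "Suc n" X]
  have "apow (pcyc X n) (Suc k) \<odot> transp X (Suc n) 0
      = pcyc X n \<odot> (apow (pcyc X n) k \<odot> transp X (Suc n) 0)"
    using t Suc.prems by simp
  also have "\<dots> = (pcyc X n \<odot> transp X (Suc n) k) \<odot> apow (pcyc X n) k"
    unfolding Suc.IH[OF Suc_lessD[OF Suc.prems]] using t Suc.prems by simp
  also have "\<dots> = transp X (Suc n) (Suc k) \<odot> pcyc X n \<odot> apow (pcyc X n) k"
    using pcyc_transp[of k n X] t Suc.prems by simp
  finally show ?case by simp
qed

text \<open>With \<open>c\<close> the cycle on \<open>n + 1\<close> factors and \<open>c'\<close> the one on the last \<open>n\<close> factors, \<open>c' = s\<^sub>0 c\<close> and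
  \<open>c s\<^sub>i = s\<^bsub>i+1\<^esub> c\<close> give \<open>c'\<^sup>n = s\<^sub>0 \<dots> s\<^bsub>n-1\<^esub> c\<^sup>n = c\<^bsup>n+1\<^esup>\<close>.\<close>

lemma pcyc_order: "apow (pcyc X n) (Suc n) = ide (tp X (Suc n))"
proof (induction n)
  case 0
  then show ?case by (simp add: pcyc_0)
next
  case (Suc n)
  let ?N = "Suc n" and ?c = "pcyc X (Suc n)" and ?s = "transp X (Suc (Suc n)) 0"
  have c': "ide X \<star> pcyc X n = ?s \<odot> ?c"
    unfolding pcyc_Suc using acomp_ext[OF sigma_sigma, of X X "tp X n" "ide X \<star> pcyc X n"] by simp
  \<comment> \<open>All partial products at once: \<open>c'^k = s_0 ... s_{k-1} c^k\<close>. One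
    more factor \<open>c' = s_0 c\<close> arrives on the right, and its \<open>s_0\<close> crosses
    \<open>c^k\<close> as \<open>s_k\<close>.\<close>
  have "apow (ide X \<star> pcyc X n) k = transp_prod X (Suc ?N) k \<odot> apow ?c k" if "k \<le> ?N" for k
    using that
  proof (induction k)
    case 0
    then show ?case by simp
  next
    case (Suc k)
    note t = transp_simps[of 0 "Suc ?N" X] transp_simps[of k "Suc ?N" X] transp_prod_simps[of k "Suc ?N" X]
    have "apow (ide X \<star> pcyc X n) (Suc k) = apow (ide X \<star> pcyc X n) k \<odot> (ide X \<star> pcyc X n)"
      using apow_commute[of "ide X \<star> pcyc X n" k] by simp
    also have "\<dots> = (transp_prod X (Suc ?N) k \<odot> apow ?c k) \<odot> ?s \<odot> ?c"
      unfolding Suc.IH[OF Suc_leD[OF Suc.prems]] unfolding c' ..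
    also have "\<dots> = transp_prod X (Suc ?N) k \<odot> (apow ?c k \<odot> ?s) \<odot> ?c"
      using t Suc.prems by simp
    also have "\<dots> = (transp_prod X (Suc ?N) k \<odot> transp X (Suc ?N) k) \<odot> (apow ?c k \<odot> ?c)"
      using apow_pcyc_transp[of k ?N X] t Suc.prems by simp
    finally show ?case using apow_commute[of ?c k] by simp
  qed
  \<comment> \<open>For \<open>k = n + 1\<close> the product of transpositions is the cycle
    \<open>c\<close> on \<open>n + 2\<close> factors itself, so
    \<open>c'^{n+1} = c^{n+2}\<close>.\<close>
  from this[of ?N] have "apow (ide X \<star> pcyc X n) ?N = ?c \<odot> apow ?c ?N"
    unfolding pcyc_transp_prod[of X ?N, symmetric] by simp
  moreover have "apow (ide X \<star> pcyc X n) ?N = ide (tp X (Suc ?N))"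
    using apow_tens[of "pcyc X n" X ?N] Suc.IH by (simp add: ide_tens del: apow.simps)
  ultimately show ?case by simp
qed

lemma tp_eq: "tp X n = tpow C X n"
  by (induction n) auto

lemma mor_pcyc: "mor (pcyc X n) = cyc C X (Suc n)"
proof (induction n)
  case (Suc n)
  have "mor (sigma X X W) = swap_front C X W" for W
    unfolding sigma_def swap_front_def by (simp add: asc_def asi_def br_def)
  then show ?case by (simp add: pcyc_Suc Suc tp_eq)
qed (simp add: pcyc_0)

lemma mor_apow: "trg F = src F \<Longrightarrow> mor (apow F n) = endo_pow C (src F) (mor F) n"
  by (induction n) auto

lemma cyc_in_Hom: "cyc C X n \<in> Hom C (tpow C X n) (tpow C X n)"
proof (cases n)
  case 0
  then show ?thesis using idm_in_Hom by simp
next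
  case (Suc m)
  then show ?thesis using arr_Hom[OF pcyc_simps(1), of X m] unfolding pcyc_simps mor_pcyc tp_eq by simp
qed

lemma cyc_order: "endo_pow C (tpow C X n) (cyc C X n) n = idm C (tpow C X n)"
proof (cases n)
  case (Suc m)
  then show ?thesis using arg_cong[OF pcyc_order[of X m], of mor]
    by (simp add: mor_apow mor_pcyc flip: tp_eq del: apow.simps cyc.simps endo_pow.simps tp_simps tpow.simps)
qed simp

end

section \<open>Polynomials in an endomorphism\<close>

text \<open>The norm identity needs cancellation of \<open>1 - X\<close>. This is legitimate for
  polynomials, which form a domain, but not in an endomorphism ring; hence the identities are proved
  here and carried over by \<open>peval\<close>.\<close>

lemma one_minus_X_power_CHAR:
  assumes p: "p = CHAR('a::field)" "p > 0"
  shows "(1 - [:0, 1:]) ^ p = 1 - [:0, 1:: 'a:] ^ p"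
    and "(1 - [:0, 1:]) ^ (p - 1) = (\<Sum>k<p. [:0, 1:: 'a:] ^ k)"
proof -
  let ?X = "[:0, 1:] :: 'a poly"
  have "prime CHAR('a)" using p prime_CHAR_semidom by blast
  then have "((1 - ?X) + ?X) ^ p = (1 - ?X) ^ p + ?X ^ p"
    by (intro freshmans_dream) (simp_all add: p)
  then show 1: "(1 - ?X) ^ p = 1 - ?X ^ p" by (simp add: algebra_simps)
  have "(1 - ?X) * (1 - ?X) ^ (p - 1) = (1 - ?X) ^ p"
    using p(2) by (metis power_eq_if less_irrefl)
  also have "\<dots> = (1 - ?X) * (\<Sum>k<p. ?X ^ k)" unfolding 1 by (rule one_diff_power_eq)
  finally have "1 - ?X = 0 \<or> (1 - ?X) ^ (p - 1) = (\<Sum>k<p. ?X ^ k)" by (simp only: mult_cancel_left)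
  moreover have "1 - ?X \<noteq> 0" by (simp add: one_pCons)
  ultimately show "(1 - ?X) ^ (p - 1) = (\<Sum>k<p. ?X ^ k)" by blast
qed

context linear_category
begin

lemma endo_pow_in_Hom: "f \<in> Hom C A A \<Longrightarrow> endo_pow C A f n \<in> Hom C A A"
  by (induction n) (auto intro: idm_in_Hom comp_in_Hom)

lemma endo_pow_add:
  assumes "f \<in> Hom C A A"
  shows "endo_pow C A f (m + n) = endo_pow C A f m \<cdot> endo_pow C A f n"
  by (induction m)
    (simp_all add: idm_comp[OF endo_pow_in_Hom[OF assms]]
      comp_assoc[OF endo_pow_in_Hom[OF assms] endo_pow_in_Hom[OF assms] assms])

lemma endo_pow_commute:
  assumes "f \<in> Hom C A A" "g \<in> Hom C B B" "h \<in> Hom C A B" "h \<cdot> f = g \<cdot> h"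
  shows "h \<cdot> endo_pow C A f n = endo_pow C B g n \<cdot> h"
proof (induction n)
  case 0
  then show ?case using comp_idm[OF assms(3)] idm_comp[OF assms(3)] by simp
next
  case (Suc n)
  note fn = endo_pow_in_Hom[OF assms(1), of n] and gn = endo_pow_in_Hom[OF assms(2), of n]
  show ?case
    using comp_assoc[OF fn assms(1,3)] comp_assoc[OF fn assms(3,2)] comp_assoc[OF assms(3) gn assms(2)]
      assms(4) Suc by simp
qed

text \<open>Horner evaluation: the ring homomorphism from polynomials to \<open>End A\<close> that
  sends the variable to \<open>c\<close>.\<close>

definition peval where "peval A c P = fold_coeffs (\<lambda>a r. scal C a (idm C A) + c \<cdot> r) P 0"

lemma peval_0: "peval A c 0 = 0"
  by (simp add: peval_def)

lemma peval_pCons: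
  assumes "c \<in> Hom C A A"
  shows "peval A c (pCons a P) = scal C a (idm C A) + c \<cdot> peval A c P"
  using comp_zero_right[OF assms] by (cases "a = 0"; cases "P = 0") (simp_all add: peval_def)

lemma peval_in_Hom: "c \<in> Hom C A A \<Longrightarrow> peval A c P \<in> Hom C A A"
  by (induction P) (auto simp: peval_0 peval_pCons intro: hom)

lemma peval_add:
  assumes c: "c \<in> Hom C A A"
  shows "peval A c (P + Q) = peval A c P + peval A c Q"
proof (induction P Q rule: poly_induct2)
  case (pCons a P b Q)
  then show ?case
    using comp_add_right[OF peval_in_Hom[OF c] peval_in_Hom[OF c] c]
    by (simp add: peval_pCons[OF c] scale_left_distrib algebra_simps)
qed (simp add: peval_0)

lemma peval_smult:
  assumes c: "c \<in> Hom C A A"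
  shows "peval A c (smult a P) = scal C a (peval A c P)"
  by (induction P)
    (simp_all add: peval_0 peval_pCons[OF c] scale_right_distrib comp_scal_right[OF peval_in_Hom[OF c] c])

lemma peval_mult:
  assumes c: "c \<in> Hom C A A"
  shows "peval A c (P * Q) = peval A c P \<cdot> peval A c Q"
proof (induction P)
  case 0
  then show ?case by (simp add: peval_0 comp_zero_left[OF peval_in_Hom[OF c]])
next
  case (pCons a P)
  note e = peval_in_Hom[OF c]
  have "(scal C a (idm C A) + c \<cdot> peval A c P) \<cdot> peval A c Q = scal C a (peval A c Q) + c \<cdot> (peval A c P \<cdot> peval A c Q)"
    using comp_add_left[OF e scal_in_Hom[OF idm_in_Hom] comp_in_Hom[OF e c]]
      comp_scal_left[OF e idm_in_Hom] idm_comp[OF e] comp_assoc[OF e e c] by simp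
  then show ?case using pCons by (simp add: peval_add[OF c] peval_smult[OF c] peval_pCons[OF c])
qed

lemma peval_1: "c \<in> Hom C A A \<Longrightarrow> peval A c 1 = idm C A"
  by (simp add: one_pCons peval_pCons peval_0 comp_zero_right)

lemma peval_power: "c \<in> Hom C A A \<Longrightarrow> peval A c (P ^ n) = endo_pow C A (peval A c P) n"
  by (induction n) (simp_all add: peval_1 peval_mult)

lemma peval_X: "c \<in> Hom C A A \<Longrightarrow> peval A c [:0, 1:] = c"
  by (simp add: peval_pCons peval_0 comp_zero_right comp_idm)

lemma peval_sum:
  assumes c: "c \<in> Hom C A A"
  shows "peval A c (sum P I) = (\<Sum>i\<in>I. peval A c (P i))"
  by (induction I rule: infinite_finite_induct) (simp_all add: peval_0 peval_add[OF c])

lemma peval_diff: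
  assumes c: "c \<in> Hom C A A"
  shows "peval A c (P - Q) = peval A c P - peval A c Q"
  using peval_add[OF c, of "P - Q" Q] by (simp add: algebra_simps)

lemma endo_pow_one_minus_CHAR:
  assumes p: "p = CHAR('k)" "p > 0" and c: "c \<in> Hom C A A"
  shows "endo_pow C A (idm C A - c) p = idm C A - endo_pow C A c p"
    and "endo_pow C A (idm C A - c) (p - 1) = (\<Sum>k<p. endo_pow C A c k)"
proof -
  have D: "idm C A - c = peval A c (1 - [:0, 1:])"
    unfolding peval_diff[OF c] peval_1[OF c] peval_X[OF c] ..
  have pw: "endo_pow C A (idm C A - c) n = peval A c ((1 - [:0, 1:]) ^ n)" for n
    unfolding D by (rule peval_power[OF c, symmetric])
  have pX: "peval A c ([:0, 1:] ^ n) = endo_pow C A c n" for n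
    using peval_power[OF c, of "[:0, 1:]" n] peval_X[OF c] by simp
  show "endo_pow C A (idm C A - c) p = idm C A - endo_pow C A c p"
    unfolding pw one_minus_X_power_CHAR(1)[OF p] peval_diff[OF c] peval_1[OF c] pX ..
  show "endo_pow C A (idm C A - c) (p - 1) = (\<Sum>k<p. endo_pow C A c k)"
    unfolding pw one_minus_X_power_CHAR(2)[OF p] peval_sum[OF c] pX ..
qed

end

section \<open>Exactness of the tensor product\<close>

context symmetric_tensor_category
begin

lemma iso_braid: "iso_mor C (X \<otimes> Y) (Y \<otimes> X) (braid C X Y)"
  unfolding iso_mor_def inverse_mor_def using braid_in_Hom braid_symmetric by blast

text \<open>The symmetry conjugates \<open>f \<boxtimes> idm C X\<close> into
  \<open>idm C X \<boxtimes> f\<close>.\<close>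

lemma tens_monic_right:
  assumes "monic C A B f"
  shows "monic C (A \<otimes> X) (B \<otimes> X) (f \<boxtimes> idm C X)"
proof -
  note f = monic_in_Hom[OF assms]
  have "monic C (A \<otimes> X) (X \<otimes> B) ((idm C X \<boxtimes> f) \<cdot> braid C A X)"
    by (rule monic_comp[OF iso_mor_monic_epic(1)[OF iso_braid] tens_monic_left[OF assms]])
  then have "monic C (A \<otimes> X) (X \<otimes> B) (braid C B X \<cdot> (f \<boxtimes> idm C X))"
    using braid_natural[OF f idm_in_Hom] by simp
  then show ?thesis
    using monic_right_factor[OF tensm_in_Hom[OF f idm_in_Hom] braid_in_Hom] by blast
qed

lemma tens_epic_left:
  assumes "epic C A B f"
  shows "epic C (X \<otimes> A) (X \<otimes> B) (idm C X \<boxtimes> f)"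
  using assms kernel_exists[OF epic_in_Hom[OF assms]] epic_cokernel_of_kernel tens_cokernel_left cokernel_epic
  by metis

lemma tens_cokernel_right:
  assumes q: "is_cokernel C S T \<pi> Q q"
  shows "is_cokernel C (S \<otimes> V) (T \<otimes> V) (\<pi> \<boxtimes> idm C V) (Q \<otimes> V) (q \<boxtimes> idm C V)"
proof (rule is_cokernelI)
  note qD = is_cokernelD[OF q] and q' = tens_cokernel_left[OF q, of V]
  note q'D = is_cokernelD[OF q']
  have p: "\<pi> \<boxtimes> idm C V \<in> Hom C (S \<otimes> V) (T \<otimes> V)" and qi: "q \<boxtimes> idm C V \<in> Hom C (T \<otimes> V) (Q \<otimes> V)"
    using tensm_in_Hom qD idm_in_Hom by auto
  show "\<pi> \<boxtimes> idm C V \<in> Hom C (S \<otimes> V) (T \<otimes> V)" by (rule p)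
  have "epic C (V \<otimes> T) (Q \<otimes> V) (braid C V Q \<cdot> (idm C V \<boxtimes> q))"
    using epic_comp[OF cokernel_epic[OF q'] iso_mor_monic_epic(2)[OF iso_braid]] .
  then have "epic C (V \<otimes> T) (Q \<otimes> V) ((q \<boxtimes> idm C V) \<cdot> braid C V T)"
    using braid_natural[OF idm_in_Hom qD(2)] by simp
  then show "epic C (T \<otimes> V) (Q \<otimes> V) (q \<boxtimes> idm C V)"
    using epic_left_factor[OF braid_in_Hom qi] by blast
  show "(q \<boxtimes> idm C V) \<cdot> (\<pi> \<boxtimes> idm C V) = 0"
    using tensm_comp[OF qD(1,2) idm_in_Hom idm_in_Hom] qD(3) tensm_zero_left[OF idm_in_Hom]
      comp_idm[OF idm_in_Hom] by simp
  fix W h assume h: "h \<in> Hom C (T \<otimes> V) W" "h \<cdot> (\<pi> \<boxtimes> idm C V) = 0"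
  have hb: "h \<cdot> braid C V T \<in> Hom C (V \<otimes> T) W" using comp_in_Hom[OF braid_in_Hom h(1)] .
  have "(h \<cdot> braid C V T) \<cdot> (idm C V \<boxtimes> \<pi>) = (h \<cdot> (\<pi> \<boxtimes> idm C V)) \<cdot> braid C V S"
    using comp_assoc[OF q'D(1) braid_in_Hom h(1)] comp_assoc[OF braid_in_Hom p h(1)]
      braid_natural[OF idm_in_Hom qD(1)] by simp
  then have "(h \<cdot> braid C V T) \<cdot> (idm C V \<boxtimes> \<pi>) = 0" using h(2) comp_zero_left[OF braid_in_Hom] by simp
  then obtain u where u: "u \<in> Hom C (V \<otimes> Q) W" "u \<cdot> (idm C V \<boxtimes> q) = h \<cdot> braid C V T"
    using cokernel_factor[OF q' hb] by metis
  have "(u \<cdot> braid C Q V) \<cdot> (q \<boxtimes> idm C V) = (u \<cdot> (idm C V \<boxtimes> q)) \<cdot> braid C T V"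
    using comp_assoc[OF qi braid_in_Hom u(1)] comp_assoc[OF braid_in_Hom q'D(2) u(1)]
      braid_natural[OF qD(2) idm_in_Hom] by simp
  also have "\<dots> = h" using comp_assoc[OF braid_in_Hom braid_in_Hom h(1)] u(2) braid_symmetric comp_idm[OF h(1)]
    by simp
  finally show "\<exists>u\<in>Hom C (Q \<otimes> V) W. u \<cdot> (q \<boxtimes> idm C V) = h"
    using comp_in_Hom[OF braid_in_Hom u(1)] by blast
qed

lemma tensm_id_split:
  assumes "f \<in> Hom C A B" "g \<in> Hom C A' B'"
  shows "f \<boxtimes> g = (f \<boxtimes> idm C B') \<cdot> (idm C A \<boxtimes> g)" "f \<boxtimes> g = (idm C B \<boxtimes> g) \<cdot> (f \<boxtimes> idm C A')"
  using tensm_comp[OF idm_in_Hom assms(1) assms(2) idm_in_Hom]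
    tensm_comp[OF assms(1) idm_in_Hom idm_in_Hom assms(2)]
    comp_idm[OF assms(1)] idm_comp[OF assms(1)] comp_idm[OF assms(2)] idm_comp[OF assms(2)] by auto

lemma tensm_sum_right:
  assumes "f \<in> Hom C A B" "\<And>i. i \<in> I \<Longrightarrow> g i \<in> Hom C A' B'"
  shows "f \<boxtimes> sum g I = (\<Sum>i\<in>I. f \<boxtimes> g i)"
  using assms(2)
proof (induction I rule: infinite_finite_induct)
  case (insert i I)
  then show ?case
    using tensm_add_right[OF assms(1), of "g i" A' B' "sum g I"] sum_in_Hom[of I g A' B'] by simp
qed (simp_all add: tensm_zero_right[OF assms(1)])

lemma tpow_map_in_Hom: "f \<in> Hom C X Y \<Longrightarrow> tpow_map C f n \<in> Hom C (tpow C X n) (tpow C Y n)"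
  by (induction n) (auto intro: tensm_in_Hom idm_in_Hom)

lemma tpow_map_monic: "monic C X Y f \<Longrightarrow> monic C (tpow C X n) (tpow C Y n) (tpow_map C f n)"
proof (induction n)
  case 0
  then show ?case using monic_idm by simp
next
  case (Suc n)
  note f = monic_in_Hom[OF Suc.prems]
  show ?case
    using tensm_id_split(1)[OF f tpow_map_in_Hom[OF f]] monic_comp[OF tens_monic_left tens_monic_right] Suc
    by simp
qed

lemma tpow_map_epic: "epic C X Y f \<Longrightarrow> epic C (tpow C X n) (tpow C Y n) (tpow_map C f n)"
proof (induction n)
  case 0
  then show ?case using epic_idm by simp
next
  case (Suc n)
  note f = epic_in_Hom[OF Suc.prems]
  obtain K k where "is_kernel C X Y f K k" using kernel_exists[OF f] by blast
  then have "epic C (X \<otimes> V) (Y \<otimes> V) (f \<boxtimes> idm C V)" for V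
    using cokernel_epic[OF tens_cokernel_right] epic_cokernel_of_kernel Suc.prems by blast
  then show ?case
    using tensm_id_split(1)[OF f tpow_map_in_Hom[OF f]] epic_comp[OF tens_epic_left] Suc by simp
qed

text \<open>This is \<open>cycl_natural\<close> for a list of equal arrows.\<close>

lemma cyc_tpow_map:
  assumes "f \<in> Hom C X Y"
  shows "tpow_map C f n \<cdot> cyc C X n = cyc C Y n \<cdot> tpow_map C f n"
proof (cases n)
  case 0
  then show ?thesis by simp
next
  case (Suc m)
  define F where "F = Arrow X f Y"
  have F: "arr F" "src F = X" "trg F = Y" using assms by (simp_all add: F_def)
  have m: "mor (alist (replicate k F)) = tpow_map C f k" for k by (induction k) (simp_all add: F_def)
  have "cycl (replicate m Y) Y \<odot> alist (replicate (Suc m) F) = alist (replicate (Suc m) F) \<odot> cycl (replicate m X) X"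
    using cycl_natural[of "replicate m F" F] F by (simp add: replicate_append_same)
  from arg_cong[OF this, of mor]
  have "mor (pcyc Y m) \<cdot> tpow_map C f n = tpow_map C f n \<cdot> mor (pcyc X m)"
    by (simp only: mor_acomp m Suc pcyc_def)
  then show ?thesis unfolding mor_pcyc Suc by simp
qed

end

section \<open>Finite sums of subobjects\<close>

context abelian_category
begin

text \<open>Local membership of \<open>t\<close> in the sum of the images of the \<open>m i\<close>,
  without choosing an object that represents this sum.\<close>

definition spanned where
  "spanned I A m T W t \<longleftrightarrow> t \<in> Hom C W T \<and> (\<exists>W' e \<tau>. epic C W' W e \<and>
     (\<forall>i\<in>I. \<tau> i \<in> Hom C W' (A i)) \<and> t \<cdot> e = (\<Sum>i\<in>I. m i \<cdot> \<tau> i))"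

text \<open>\<open>S\<close> is the direct sum of the \<open>A i\<close>, built one summand at a
  time; the \<open>\<rho> i\<close> are its projections, and \<open>\<pi>\<close> is the map with
  components \<open>m i\<close>.\<close>

lemma joint_image:
  assumes "finite I" "\<And>i. i \<in> I \<Longrightarrow> m i \<in> Hom C (A i) T"
  shows "\<exists>S \<pi> \<rho>. \<pi> \<in> Hom C S T \<and> (\<forall>i\<in>I. \<exists>\<iota>\<in>Hom C (A i) S. \<pi> \<cdot> \<iota> = m i) \<and>
    (\<forall>i\<in>I. \<rho> i \<in> Hom C S (A i)) \<and> \<pi> = (\<Sum>i\<in>I. m i \<cdot> \<rho> i)"
  using assms
proof (induction I rule: finite_induct)
  case empty
  then show ?case using zero_object_exists zero_in_Hom by auto
next
  case (insert k I)
  then obtain S \<pi> \<rho> where S: "\<pi> \<in> Hom C S T" "\<forall>i\<in>I. \<exists>\<iota>\<in>Hom C (A i) S. \<pi> \<cdot> \<iota> = m i"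
    "\<forall>i\<in>I. \<rho> i \<in> Hom C S (A i)" "\<pi> = (\<Sum>i\<in>I. m i \<cdot> \<rho> i)" by auto
  have mk: "m k \<in> Hom C (A k) T" and mI: "i \<in> I \<Longrightarrow> m i \<in> Hom C (A i) T" for i using insert by auto
  obtain P i1 i2 p1 p2 where
    P: "i1 \<in> Hom C (A k) P" "i2 \<in> Hom C S P" "p1 \<in> Hom C P (A k)" "p2 \<in> Hom C P S"
    "p1 \<cdot> i1 = idm C (A k)" "p2 \<cdot> i2 = idm C S" "p1 \<cdot> i2 = 0" "p2 \<cdot> i1 = 0"
    using biproduct_exists[of "A k" S] unfolding biproduct_def by blast
  define \<pi>' where "\<pi>' = m k \<cdot> p1 + \<pi> \<cdot> p2"
  define \<rho>' where "\<rho>' i = (if i = k then p1 else \<rho> i \<cdot> p2)" for i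
  have mp: "m k \<cdot> p1 \<in> Hom C P T" "\<pi> \<cdot> p2 \<in> Hom C P T" using comp_in_Hom P mk S(1) by blast+
  have \<pi>': "\<pi>' \<in> Hom C P T" unfolding \<pi>'_def using mp by (rule add_in_Hom)
  have 1: "\<pi>' \<cdot> i1 = m k"
    unfolding \<pi>'_def using comp_add_left[OF P(1) mp] comp_assoc[OF P(1) P(3) mk] comp_assoc[OF P(1) P(4) S(1)]
      P(5,8) comp_idm[OF mk] comp_zero_right[OF S(1)] by simp
  have 2: "\<pi>' \<cdot> i2 = \<pi>"
    unfolding \<pi>'_def using comp_add_left[OF P(2) mp] comp_assoc[OF P(2) P(3) mk] comp_assoc[OF P(2) P(4) S(1)]
      P(6,7) comp_idm[OF S(1)] comp_zero_right[OF mk] by simp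
  have "\<exists>\<iota>\<in>Hom C (A i) P. \<pi>' \<cdot> \<iota> = m i" if "i \<in> insert k I" for i
  proof (cases "i = k")
    case True
    show ?thesis unfolding True by (rule bexI[of _ i1], rule 1, rule P(1))
  next
    case False
    then have "i \<in> I" using that by simp
    with S(2) obtain \<iota> where \<iota>: "\<iota> \<in> Hom C (A i) S" "\<pi> \<cdot> \<iota> = m i" by (auto elim: bexE)
    have "\<pi>' \<cdot> (i2 \<cdot> \<iota>) = m i" using comp_assoc[OF \<iota>(1) P(2) \<pi>'] 2 \<iota>(2) by simp
    then show ?thesis using comp_in_Hom[OF \<iota>(1) P(2)] by (rule bexI)
  qed
  moreover have "\<forall>i\<in>insert k I. \<rho>' i \<in> Hom C P (A i)"
    unfolding \<rho>'_def using P S(3) comp_in_Hom by auto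
  moreover have "\<pi>' = (\<Sum>i\<in>insert k I. m i \<cdot> \<rho>' i)"
  proof -
    have "(\<Sum>i\<in>insert k I. m i \<cdot> \<rho>' i) = m k \<cdot> p1 + (\<Sum>i\<in>I. m i \<cdot> \<rho>' i)"
      using insert(1,2) by (simp add: \<rho>'_def)
    also have "(\<Sum>i\<in>I. m i \<cdot> \<rho>' i) = (\<Sum>i\<in>I. (m i \<cdot> \<rho> i) \<cdot> p2)"
    proof (rule sum.cong[OF refl])
      fix i assume i: "i \<in> I"
      then have "i \<noteq> k" "\<rho> i \<in> Hom C S (A i)" using insert(2) S(3) by auto
      then show "m i \<cdot> \<rho>' i = (m i \<cdot> \<rho> i) \<cdot> p2"
        using comp_assoc[OF P(4) _ mI[OF i]] by (simp add: \<rho>'_def)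
    qed
    also have "\<dots> = (\<Sum>i\<in>I. m i \<cdot> \<rho> i) \<cdot> p2"
      by (rule comp_sum_left[symmetric, OF _ P(4)]) (use S(3) mI comp_in_Hom in blast)
    finally show ?thesis unfolding \<pi>'_def S(4) ..
  qed
  ultimately show ?case using \<pi>' by blast
qed

text \<open>Membership becomes one equation \<open>q \<cdot> t = 0\<close>, from which closure under
  sums, restriction and local descent can be read off. The presentation by \<open>S\<close>,
  \<open>\<pi>\<close> and \<open>\<rho>\<close> is returned too, because
  \<open>tens_cokernel_left\<close> applies to it.\<close>

lemma spanned_cokernel:
  assumes "finite I" "\<And>i. i \<in> I \<Longrightarrow> m i \<in> Hom C (A i) T"
  obtains S \<pi> Q q \<rho> where "is_cokernel C S T \<pi> Q q"
    "\<forall>W. \<forall>t\<in>Hom C W T. spanned I A m T W t \<longleftrightarrow> q \<cdot> t = 0"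
    "\<forall>i\<in>I. q \<cdot> m i = 0" "\<forall>i\<in>I. \<rho> i \<in> Hom C S (A i)" "\<pi> = (\<Sum>i\<in>I. m i \<cdot> \<rho> i)"
proof -
  have "\<exists>S \<pi> \<rho>. \<pi> \<in> Hom C S T \<and> (\<forall>i\<in>I. \<exists>\<iota>\<in>Hom C (A i) S. \<pi> \<cdot> \<iota> = m i) \<and>
    (\<forall>i\<in>I. \<rho> i \<in> Hom C S (A i)) \<and> \<pi> = (\<Sum>i\<in>I. m i \<cdot> \<rho> i)"
    by (rule joint_image) (use assms in auto)
  then obtain S \<pi> \<rho> where S': "\<pi> \<in> Hom C S T" "\<forall>i\<in>I. \<exists>\<iota>\<in>Hom C (A i) S. \<pi> \<cdot> \<iota> = m i"
    "\<forall>i\<in>I. \<rho> i \<in> Hom C S (A i)" "\<pi> = (\<Sum>i\<in>I. m i \<cdot> \<rho> i)"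
    by (elim exE conjE)
  note S = S'(1) bspec[OF S'(2)] bspec[OF S'(3)] S'(4)
  obtain Q q where q: "is_cokernel C S T \<pi> Q q" using cokernel_exists[OF S(1)] by blast
  note qD = is_cokernelD[OF q]
  have qm: "q \<cdot> m i = 0" if "i \<in> I" for i
  proof -
    obtain \<iota> where \<iota>: "\<iota> \<in> Hom C (A i) S" "\<pi> \<cdot> \<iota> = m i" using S(2)[OF \<open>i \<in> I\<close>] by (auto elim: bexE)
    then show ?thesis using comp_assoc[OF \<iota>(1) qD(1,2)] qD(3) comp_zero_left[OF \<iota>(1)] by simp
  qed
  have "spanned I A m T W t \<longleftrightarrow> q \<cdot> t = 0" if t: "t \<in> Hom C W T" for W t
  proof
    assume "spanned I A m T W t"
    then obtain W' e \<tau> where e: "epic C W' W e" and \<tau>: "\<And>i. i \<in> I \<Longrightarrow> \<tau> i \<in> Hom C W' (A i)"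
      and eq: "t \<cdot> e = (\<Sum>i\<in>I. m i \<cdot> \<tau> i)" unfolding spanned_def by blast
    have "(q \<cdot> t) \<cdot> e = q \<cdot> (\<Sum>i\<in>I. m i \<cdot> \<tau> i)" using comp_assoc[OF epic_in_Hom[OF e] t qD(2)] eq by simp
    also have "\<dots> = (\<Sum>i\<in>I. q \<cdot> (m i \<cdot> \<tau> i))"
      by (rule comp_sum_right[OF _ qD(2)]) (use \<tau> assms(2) comp_in_Hom in blast)
    also have "\<dots> = 0"
      by (rule sum.neutral) (use comp_assoc[OF \<tau> assms(2) qD(2)] qm comp_zero_left[OF \<tau>] in auto)
    finally show "q \<cdot> t = 0" using epic_zero[OF e] comp_in_Hom[OF t qD(2)] by blast
  next
    assume z: "q \<cdot> t = 0"
    obtain W' e s where s: "epic C W' W e" "s \<in> Hom C W' S" "\<pi> \<cdot> s = t \<cdot> e"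
      using exact_at_lift[OF cokernel_exact[OF q] t z] .
    have "t \<cdot> e = (\<Sum>i\<in>I. (m i \<cdot> \<rho> i) \<cdot> s)"
      unfolding s(3)[symmetric] S(4)
      by (rule comp_sum_left[OF _ s(2)]) (use S(3) assms(2) comp_in_Hom in blast)
    also have "\<dots> = (\<Sum>i\<in>I. m i \<cdot> (\<rho> i \<cdot> s))"
      by (rule sum.cong[OF refl]) (use comp_assoc[OF s(2) S(3) assms(2)] in auto)
    finally show "spanned I A m T W t"
      unfolding spanned_def using t s(1) comp_in_Hom[OF s(2) S(3)]
      by (intro conjI exI[of _ W'] exI[of _ e] exI[of _ "\<lambda>i. \<rho> i \<cdot> s"]) auto
  qed
  then have "\<forall>W. \<forall>t\<in>Hom C W T. spanned I A m T W t \<longleftrightarrow> q \<cdot> t = 0" by blast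
  moreover have "\<forall>i\<in>I. q \<cdot> m i = 0" using qm by blast
  ultimately show thesis by (rule that[OF q _ _ S'(3,4)])
qed

end

section \<open>The filtration of a tensor power induced by a subobject\<close>

locale tensor_short_exact = symmetric_tensor_category C
  for C :: "('k::field, 'o, 'm::ab_group_add, 'z) symm_tensor_cat_scheme" (structure) +
  fixes X Y Z :: 'o and f g :: 'm
  assumes ses: "short_exact C X f Y g Z"
begin

lemmas sesD = short_exactD[OF ses]

text \<open>\<open>True\<close> stands for a factor \<open>X\<close>, embedded by \<open>f\<close>;
  \<open>False\<close> stands for a factor \<open>Y\<close>.\<close>

definition letter where "letter b = (if b then Arrow X f Y else ide Y)"

definition wobj where "wobj w = tlist (map (src \<circ> letter) w)"

definition wmap where "wmap w = mor (alist (map letter w))"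

definition words where "words n j = {w. length w = n \<and> j \<le> length (filter id w)}"

abbreviation "TY \<equiv> tpow C Y"

text \<open>The \<open>F_j\<close> of the overview, for a tensor power of any length
  \<open>n\<close>: the arguments split off one factor and look at the remaining ones.\<close>

abbreviation "Fil n j \<equiv> spanned (words n j) wobj wmap (TY n)"

lemma letter_simps [simp]: "arr (letter b)" "trg (letter b) = Y" "src (letter True) = X" "src (letter False) = Y"
  using sesD(4) by (simp_all add: letter_def)

lemma wmap_simps [simp]: "wmap [] = idm C \<one>" "wmap (True # w) = f \<boxtimes> wmap w"
  "wmap (False # w) = idm C Y \<boxtimes> wmap w"
  by (simp_all add: wmap_def letter_def)

lemma wobj_simps [simp]: "wobj [] = \<one>" "wobj (True # w) = X \<otimes> wobj w" "wobj (False # w) = Y \<otimes> wobj w"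
  by (simp_all add: wobj_def)

lemma wmap_in_Hom: "wmap w \<in> Hom C (wobj w) (TY (length w))"
proof (induction w)
  case (Cons b w)
  then show ?case using tensm_in_Hom sesD(4) idm_in_Hom by (cases b) auto
qed (simp add: idm_in_Hom)

lemma words_wmap_in_Hom: "w \<in> words n j \<Longrightarrow> wmap w \<in> Hom C (wobj w) (TY n)"
  using wmap_in_Hom by (auto simp: words_def)

lemma finite_words: "finite (words n j)"
  unfolding words_def using finite_lists_length_eq[of "UNIV :: bool set" n] by (rule rev_finite_subset) auto

lemma words_mono: "j \<le> j' \<Longrightarrow> words n j' \<subseteq> words n j"
  by (auto simp: words_def)

lemma Fil_in_Hom: "Fil n j W t \<Longrightarrow> t \<in> Hom C W (TY n)"
  by (simp add: spanned_def)

lemma Fil_kernel: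
  obtains Q q where "q \<in> Hom C (TY n) Q"
    "\<And>W t. t \<in> Hom C W (TY n) \<Longrightarrow> Fil n j W t \<longleftrightarrow> q \<cdot> t = 0"
    "\<And>w. w \<in> words n j \<Longrightarrow> q \<cdot> wmap w = 0"
proof -
  obtain S \<pi> Q q \<rho> where q: "is_cokernel C S (TY n) \<pi> Q q"
    "\<forall>W. \<forall>t\<in>Hom C W (TY n). Fil n j W t \<longleftrightarrow> q \<cdot> t = 0" "\<forall>w\<in>words n j. q \<cdot> wmap w = 0"
    "\<forall>w\<in>words n j. \<rho> w \<in> Hom C S (wobj w)" "\<pi> = (\<Sum>w\<in>words n j. wmap w \<cdot> \<rho> w)"
    using spanned_cokernel[of "words n j" wmap wobj "TY n", OF finite_words words_wmap_in_Hom] .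
  show thesis by (rule that[OF is_cokernelD(2)[OF q(1)] bspec[OF spec[OF q(2)]] bspec[OF q(3)]])
qed

lemma Fil_diff: "Fil n j W s \<Longrightarrow> Fil n j W t \<Longrightarrow> Fil n j W (s - t)"
proof (rule Fil_kernel[of n j])
  fix Q q assume st: "Fil n j W s" "Fil n j W t" and q: "q \<in> Hom C (TY n) Q"
    "\<And>W t. t \<in> Hom C W (TY n) \<Longrightarrow> Fil n j W t \<longleftrightarrow> q \<cdot> t = 0"
  show ?thesis
    using q(2)[OF Fil_in_Hom[OF st(1)]] q(2)[OF Fil_in_Hom[OF st(2)]]
      q(2)[OF diff_in_Hom[OF Fil_in_Hom[OF st(1)] Fil_in_Hom[OF st(2)]]] st
      comp_diff_right[OF Fil_in_Hom[OF st(1)] Fil_in_Hom[OF st(2)] q(1)] by simp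
qed

lemma Fil_zero: "Fil n j W 0"
proof (rule Fil_kernel[of n j])
  fix Q q assume q: "q \<in> Hom C (TY n) Q"
    "\<And>W t. t \<in> Hom C W (TY n) \<Longrightarrow> Fil n j W t \<longleftrightarrow> q \<cdot> t = 0"
  show ?thesis using q(2)[OF zero_in_Hom] comp_zero_right[OF q(1)] by simp
qed

lemma Fil_add: "Fil n j W s \<Longrightarrow> Fil n j W t \<Longrightarrow> Fil n j W (s + t)"
  using Fil_diff[of n j W s "0 - t"] Fil_diff[of n j W 0 t] Fil_zero by simp

lemma Fil_sum: "(\<And>i. i \<in> I \<Longrightarrow> Fil n j W (s i)) \<Longrightarrow> Fil n j W (sum s I)"
  by (induction I rule: infinite_finite_induct) (auto intro: Fil_zero Fil_add)

lemma Fil_scal: "Fil n j W s \<Longrightarrow> Fil n j W (scal C a s)"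
proof (rule Fil_kernel[of n j])
  fix Q q assume s: "Fil n j W s" and q: "q \<in> Hom C (TY n) Q"
    "\<And>W t. t \<in> Hom C W (TY n) \<Longrightarrow> Fil n j W t \<longleftrightarrow> q \<cdot> t = 0"
  show ?thesis
    using q(2)[OF Fil_in_Hom[OF s]] q(2)[OF scal_in_Hom[OF Fil_in_Hom[OF s]]] s
      comp_scal_right[OF Fil_in_Hom[OF s] q(1)] by simp
qed

lemma Fil_comp: "Fil n j W t \<Longrightarrow> e \<in> Hom C V W \<Longrightarrow> Fil n j V (t \<cdot> e)"
proof (rule Fil_kernel[of n j])
  fix Q q assume t: "Fil n j W t" and e: "e \<in> Hom C V W" and q: "q \<in> Hom C (TY n) Q"
    "\<And>W t. t \<in> Hom C W (TY n) \<Longrightarrow> Fil n j W t \<longleftrightarrow> q \<cdot> t = 0"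
  show ?thesis
    using q(2)[OF Fil_in_Hom[OF t]] q(2)[OF comp_in_Hom[OF e Fil_in_Hom[OF t]]] t
      comp_zero_restrict[OF _ Fil_in_Hom[OF t] q(1) e] by simp
qed

lemma Fil_local: "epic C V W e \<Longrightarrow> t \<in> Hom C W (TY n) \<Longrightarrow> Fil n j V (t \<cdot> e) \<Longrightarrow> Fil n j W t"
proof (rule Fil_kernel[of n j])
  fix Q q assume e: "epic C V W e" and t: "t \<in> Hom C W (TY n)" and te: "Fil n j V (t \<cdot> e)"
    and q: "q \<in> Hom C (TY n) Q" "\<And>W t. t \<in> Hom C W (TY n) \<Longrightarrow> Fil n j W t \<longleftrightarrow> q \<cdot> t = 0"
  have "(q \<cdot> t) \<cdot> e = 0" using q(2)[OF Fil_in_Hom[OF te]] te comp_assoc[OF epic_in_Hom[OF e] t q(1)] by simp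
  then have "q \<cdot> t = 0" using epic_zero[OF e comp_in_Hom[OF t q(1)]] by simp
  then show ?thesis using q(2)[OF t] by simp
qed

lemma Fil_wmap: "w \<in> words n j \<Longrightarrow> u \<in> Hom C W (wobj w) \<Longrightarrow> Fil n j W (wmap w \<cdot> u)"
proof (rule Fil_kernel[of n j])
  fix Q q assume w: "w \<in> words n j" and u: "u \<in> Hom C W (wobj w)" and q: "q \<in> Hom C (TY n) Q"
    "\<And>W t. t \<in> Hom C W (TY n) \<Longrightarrow> Fil n j W t \<longleftrightarrow> q \<cdot> t = 0"
    "\<And>w. w \<in> words n j \<Longrightarrow> q \<cdot> wmap w = 0"
  note wH = words_wmap_in_Hom[OF w]
  show ?thesis
    using q(2)[OF comp_in_Hom[OF u wH]] comp_assoc[OF u wH q(1)] q(3)[OF w] comp_zero_left[OF u] by simp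
qed

lemma Fil_decompose:
  assumes "Fil n j W t"
  obtains W' e \<tau> where "epic C W' W e" "\<forall>w\<in>words n j. \<tau> w \<in> Hom C W' (wobj w)"
    "t \<cdot> e = (\<Sum>w\<in>words n j. wmap w \<cdot> \<tau> w)"
  using assms unfolding spanned_def by auto

text \<open>By locality and closure under sums, only the generators \<open>wmap w\<close> have to be
  followed.\<close>

lemma Fil_map:
  assumes t: "Fil n j W t" and \<phi>: "\<phi> \<in> Hom C (TY n) (TY n')"
    and gen: "\<And>w. w \<in> words n j \<Longrightarrow> \<exists>v \<kappa>. v \<in> words n' j' \<and> \<kappa> \<in> Hom C (wobj w) (wobj v) \<and> \<phi> \<cdot> wmap w = wmap v \<cdot> \<kappa>"
  shows "Fil n' j' W (\<phi> \<cdot> t)"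
proof -
  note tH = Fil_in_Hom[OF t]
  obtain W' e \<tau> where e: "epic C W' W e" and \<tau>w: "\<forall>w\<in>words n j. \<tau> w \<in> Hom C W' (wobj w)"
    and eq: "t \<cdot> e = (\<Sum>w\<in>words n j. wmap w \<cdot> \<tau> w)" using Fil_decompose[OF t] .
  note \<tau> = bspec[OF \<tau>w]
  have "(\<phi> \<cdot> t) \<cdot> e = \<phi> \<cdot> (\<Sum>w\<in>words n j. wmap w \<cdot> \<tau> w)"
    using comp_assoc[OF epic_in_Hom[OF e] tH \<phi>] eq by simp
  also have "\<dots> = (\<Sum>w\<in>words n j. \<phi> \<cdot> (wmap w \<cdot> \<tau> w))"
    by (rule comp_sum_right[OF _ \<phi>]) (rule comp_in_Hom[OF \<tau> words_wmap_in_Hom])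
  also have "Fil n' j' W' \<dots>"
  proof (rule Fil_sum)
    fix w assume w: "w \<in> words n j"
    obtain v \<kappa> where v: "v \<in> words n' j'" "\<kappa> \<in> Hom C (wobj w) (wobj v)" "\<phi> \<cdot> wmap w = wmap v \<cdot> \<kappa>"
      using gen[OF w] by (elim exE conjE)
    have "\<phi> \<cdot> (wmap w \<cdot> \<tau> w) = wmap v \<cdot> (\<kappa> \<cdot> \<tau> w)"
      using comp_assoc[OF \<tau>[OF w] words_wmap_in_Hom[OF w] \<phi>]
        comp_assoc[OF \<tau>[OF w] v(2) words_wmap_in_Hom[OF v(1)]] v(3) by simp
    then show "Fil n' j' W' (\<phi> \<cdot> (wmap w \<cdot> \<tau> w))"
      using Fil_wmap[OF v(1) comp_in_Hom[OF \<tau>[OF w] v(2)]] by simp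
  qed
  finally show ?thesis using Fil_local[OF e comp_in_Hom[OF tH \<phi>]] by simp
qed

lemma Fil_mono:
  assumes "j \<le> j'" "Fil n j' W t"
  shows "Fil n j W t"
proof -
  have "Fil n j W (idm C (TY n) \<cdot> t)"
  proof (rule Fil_map[OF assms(2) idm_in_Hom])
    fix w assume w: "w \<in> words n j'"
    then have "w \<in> words n j" using words_mono[OF assms(1)] by blast
    then show "\<exists>v \<kappa>. v \<in> words n j \<and> \<kappa> \<in> Hom C (wobj w) (wobj v) \<and> idm C (TY n) \<cdot> wmap w = wmap v \<cdot> \<kappa>"
      using idm_comp[OF words_wmap_in_Hom[OF w]] comp_idm[OF words_wmap_in_Hom[OF w]] idm_in_Hom
      by (intro exI[of _ w] exI[of _ "idm C (wobj w)"]) simp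
  qed
  then show ?thesis using idm_comp[OF Fil_in_Hom[OF assms(2)]] by simp
qed

text \<open>Naturality of \<open>cycl\<close> in its factors; \<open>\<kappa>\<close> is the cycle
  on the mixed list of factors of the word.\<close>

lemma cyc_wmap_snoc:
  "\<exists>\<kappa>\<in>Hom C (wobj (w @ [b])) (wobj (b # w)). cyc C Y (Suc (length w)) \<cdot> wmap (w @ [b]) = wmap (b # w) \<cdot> \<kappa>"
proof -
  let ?Fs = "map letter w" and ?E = "letter b"
  define k where "k = cycl (map src ?Fs) (src ?E)"
  have t: "map trg ?Fs = replicate (length w) Y" by (induction w) auto
  have a: "\<And>F. F \<in> set ?Fs \<Longrightarrow> arr F" by auto
  have "pcyc Y (length w) \<odot> alist (?Fs @ [?E]) = (?E \<star> alist ?Fs) \<odot> k"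
    using cycl_natural[of ?Fs ?E, OF a letter_simps(1)] unfolding t k_def pcyc_def letter_simps .
  from arg_cong[OF this, of mor]
  have "mor (pcyc Y (length w)) \<cdot> mor (alist (map letter (w @ [b]))) = mor (alist (map letter (b # w))) \<cdot> mor k"
    by (simp only: mor_acomp map_append list.map alist.simps)
  then have "cyc C Y (Suc (length w)) \<cdot> wmap (w @ [b]) = wmap (b # w) \<cdot> mor k"
    unfolding mor_pcyc wmap_def .
  moreover have "mor k \<in> Hom C (wobj (w @ [b])) (wobj (b # w))"
    using arr_Hom[of k] by (simp add: k_def wobj_def)
  ultimately show ?thesis by (rule bexI)
qed

lemma cyc_wmap_rotate1:
  assumes "w \<noteq> []" "length w = n"
  shows "\<exists>\<kappa>\<in>Hom C (wobj (rotate1 w)) (wobj w). cyc C Y n \<cdot> wmap (rotate1 w) = wmap w \<cdot> \<kappa>"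
  using assms cyc_wmap_snoc[of "tl w" "hd w"] by (cases w) auto

lemma cyc_pow_wmap_rotate:
  assumes "w \<noteq> []" "length w = n"
  shows "\<exists>\<kappa>\<in>Hom C (wobj (rotate k w)) (wobj w). endo_pow C (TY n) (cyc C Y n) k \<cdot> wmap (rotate k w) = wmap w \<cdot> \<kappa>"
proof (induction k)
  case 0
  have "wmap w \<in> Hom C (wobj w) (TY n)" using wmap_in_Hom[of w] assms(2) by simp
  then show ?case
    by (intro bexI[of _ "idm C (wobj w)"]) (simp_all add: idm_comp comp_idm idm_in_Hom)
next
  case (Suc k)
  let ?E = "endo_pow C (TY n) (cyc C Y n)" and ?v = "rotate k w"
  note c = cyc_in_Hom[of Y n]
  note E = endo_pow_in_Hom[OF c, of k]
  obtain \<kappa> where \<kappa>: "\<kappa> \<in> Hom C (wobj ?v) (wobj w)" "?E k \<cdot> wmap ?v = wmap w \<cdot> \<kappa>" using Suc by (elim bexE)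
  obtain \<kappa>' where \<kappa>': "\<kappa>' \<in> Hom C (wobj (rotate1 ?v)) (wobj ?v)" "cyc C Y n \<cdot> wmap (rotate1 ?v) = wmap ?v \<cdot> \<kappa>'"
    using cyc_wmap_rotate1[of ?v n] assms by auto
  have wH: "wmap (rotate1 ?v) \<in> Hom C (wobj (rotate1 ?v)) (TY n)" "wmap ?v \<in> Hom C (wobj ?v) (TY n)"
    "wmap w \<in> Hom C (wobj w) (TY n)"
    using wmap_in_Hom[of "rotate1 ?v"] wmap_in_Hom[of ?v] wmap_in_Hom[of w] assms(2) by simp_all
  have "?E (Suc k) = ?E k \<cdot> cyc C Y n"
    using endo_pow_add[OF c, of k 1] comp_idm[OF c] by simp
  then have "?E (Suc k) \<cdot> wmap (rotate1 ?v) = wmap w \<cdot> (\<kappa> \<cdot> \<kappa>')"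
    using comp_assoc[OF wH(1) c E] comp_assoc[OF \<kappa>'(1) wH(2) E] comp_assoc[OF \<kappa>'(1) \<kappa>(1) wH(3)] \<kappa> \<kappa>' by simp
  then show ?case
    unfolding rotate_Suc by (rule bexI[of _ "\<kappa> \<cdot> \<kappa>'"]) (rule comp_in_Hom[OF \<kappa>'(1) \<kappa>(1)])
qed

text \<open>The exponent \<open>n - k\<close> plays the role of \<open>-k\<close>, since
  \<open>endo_pow\<close> has natural exponents. This power brings the letter in position
  \<open>k\<close> to the front.\<close>

lemma cyc_pow_wmap:
  assumes "w \<noteq> []" "length w = n" "k \<le> n"
  shows "\<exists>\<kappa>\<in>Hom C (wobj w) (wobj (rotate k w)).
    endo_pow C (TY n) (cyc C Y n) (n - k) \<cdot> wmap w = wmap (rotate k w) \<cdot> \<kappa>"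
proof -
  have "rotate (n - k) (rotate k w) = w" using assms by (simp add: rotate_rotate)
  then show ?thesis using cyc_pow_wmap_rotate[of "rotate k w" n "n - k"] assms by simp
qed

lemma rotate_words: "w \<in> words n j \<Longrightarrow> rotate k w \<in> words n j"
proof -
  have "length (filter id (rotate1 v)) = length (filter id v)" for v by (cases v) auto
  then have "length (filter id (rotate k w)) = length (filter id w)" by (induction k) auto
  then show "w \<in> words n j \<Longrightarrow> rotate k w \<in> words n j" by (simp add: words_def)
qed

lemma Fil_cyc_pow:
  assumes "Fil n j W t" "k \<le> n"
  shows "Fil n j W (endo_pow C (TY n) (cyc C Y n) k \<cdot> t)"
proof (cases "n = 0")
  case True
  then show ?thesis using assms idm_comp[OF Fil_in_Hom[OF assms(1)]] by simp
next
  case False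
  show ?thesis
  proof (rule Fil_map[OF assms(1) endo_pow_in_Hom[OF cyc_in_Hom]])
    fix w assume w: "w \<in> words n j"
    then have "w \<noteq> []" "length w = n" using False by (auto simp: words_def)
    then obtain \<kappa> where "\<kappa> \<in> Hom C (wobj w) (wobj (rotate (n - k) w))"
      "endo_pow C (TY n) (cyc C Y n) k \<cdot> wmap w = wmap (rotate (n - k) w) \<cdot> \<kappa>"
      using cyc_pow_wmap[of w n "n - k"] assms(2) by auto
    then show "\<exists>v \<kappa>. v \<in> words n j \<and> \<kappa> \<in> Hom C (wobj w) (wobj v) \<and>
        endo_pow C (TY n) (cyc C Y n) k \<cdot> wmap w = wmap v \<cdot> \<kappa>"
      using rotate_words[OF w] by (intro exI conjI)
  qed
qed

text \<open>Telescoping: \<open>t - c^{k+1} t = (t - c^k t) + c^k (t - c t)\<close>, and the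
  filtration is stable under \<open>c^k\<close>.\<close>

lemma Fil_diff_cyc_pow:
  assumes t: "t \<in> Hom C W (TY n)" and d: "Fil n j W (t - cyc C Y n \<cdot> t)" and "k \<le> n"
  shows "Fil n j W (t - endo_pow C (TY n) (cyc C Y n) k \<cdot> t)"
  using assms(3)
proof (induction k)
  case 0
  then show ?case using idm_comp[OF t] Fil_zero by simp
next
  case (Suc k)
  let ?c = "cyc C Y n" and ?E = "endo_pow C (TY n) (cyc C Y n)"
  note c = cyc_in_Hom[of Y n]
  note E = endo_pow_in_Hom[OF c, of k]
  have "?E (Suc k) = ?E k \<cdot> ?c"
    using endo_pow_add[OF c, of k 1] comp_idm[OF c] by simp
  then have "?E k \<cdot> (t - ?c \<cdot> t) = ?E k \<cdot> t - ?E (Suc k) \<cdot> t"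
    using comp_diff_right[OF t comp_in_Hom[OF t c] E] comp_assoc[OF t c E] by simp
  then have eq: "t - ?E (Suc k) \<cdot> t = (t - ?E k \<cdot> t) + ?E k \<cdot> (t - ?c \<cdot> t)" by simp
  show ?case
    unfolding eq by (rule Fil_add[OF Suc.IH[OF Suc_leD[OF Suc.prems]] Fil_cyc_pow[OF d Suc_leD[OF Suc.prems]]])
qed

text \<open>Distributing the tensor product over the sum of words prefixes each word with the letter
  \<open>b\<close>, which raises the number of letters \<open>X\<close> only if \<open>b\<close> is
  an \<open>X\<close>.\<close>

lemma Fil_letter:
  assumes \<rho>: "\<forall>w\<in>words m j. \<rho> w \<in> Hom C S (wobj w)"
    and s: "s \<in> Hom C W (src (letter b) \<otimes> S)"
  shows "Fil (Suc m) (if b then Suc j else j) W ((mor (letter b) \<boxtimes> (\<Sum>w\<in>words m j. wmap w \<cdot> \<rho> w)) \<cdot> s)"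
proof -
  let ?l = "mor (letter b)"
  have l: "?l \<in> Hom C (src (letter b)) Y" using arr_Hom[of "letter b"] by simp
  have wr: "wmap w \<cdot> \<rho> w \<in> Hom C S (TY m)" if "w \<in> words m j" for w
    using comp_in_Hom[OF bspec[OF \<rho> that] words_wmap_in_Hom[OF that]] .
  have "?l \<boxtimes> (\<Sum>w\<in>words m j. wmap w \<cdot> \<rho> w) = (\<Sum>w\<in>words m j. ?l \<boxtimes> (wmap w \<cdot> \<rho> w))"
    by (rule tensm_sum_right[OF l wr])
  also have "\<dots> \<cdot> s = (\<Sum>w\<in>words m j. (?l \<boxtimes> (wmap w \<cdot> \<rho> w)) \<cdot> s)"
    by (rule comp_sum_left[OF _ s]) (rule tensm_in_Hom[OF l wr])
  also have "Fil (Suc m) (if b then Suc j else j) W \<dots>"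
  proof (rule Fil_sum)
    fix w assume w: "w \<in> words m j"
    then have w': "b # w \<in> words (Suc m) (if b then Suc j else j)" by (simp add: words_def)
    note \<rho>w = bspec[OF \<rho> w]
    note xr = tensm_in_Hom[OF idm_in_Hom \<rho>w] and lw = tensm_in_Hom[OF l words_wmap_in_Hom[OF w]]
    have "(?l \<boxtimes> (wmap w \<cdot> \<rho> w)) \<cdot> s = wmap (b # w) \<cdot> ((idm C (src (letter b)) \<boxtimes> \<rho> w) \<cdot> s)"
      using tensm_comp[OF idm_in_Hom l \<rho>w words_wmap_in_Hom[OF w]] comp_idm[OF l]
        comp_assoc[OF s xr lw] by (simp add: wmap_def)
    then show "Fil (Suc m) (if b then Suc j else j) W ((?l \<boxtimes> (wmap w \<cdot> \<rho> w)) \<cdot> s)"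
      using Fil_wmap[OF w'] comp_in_Hom[OF s xr] by (simp add: wobj_def)
  qed
  finally show ?thesis .
qed

text \<open>The intersection of \<open>X \<otimes> Y\<^bsup>\<otimes>m\<^esup>\<close> with \<open>Y \<otimes> F\<^sub>j\<close> is \<open>X \<otimes> F\<^sub>j\<close>; here \<open>q\<close> is the projection of
  \<open>Y\<^bsup>\<otimes>m\<^esup>\<close> modulo \<open>F\<^sub>j\<close>.\<close>

lemma Fil_intersection:
  obtains Q q where "q \<in> Hom C (TY m) Q" "\<And>w. w \<in> words m j \<Longrightarrow> q \<cdot> wmap w = 0"
    "\<And>W a. a \<in> Hom C W (X \<otimes> TY m) \<Longrightarrow> (idm C Y \<boxtimes> q) \<cdot> ((f \<boxtimes> idm C (TY m)) \<cdot> a) = 0 \<Longrightarrow>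
       Fil (Suc m) (Suc j) W ((f \<boxtimes> idm C (TY m)) \<cdot> a)"
proof -
  obtain S \<pi> Q q \<rho> where q: "is_cokernel C S (TY m) \<pi> Q q"
    and q1: "\<forall>W. \<forall>t\<in>Hom C W (TY m). Fil m j W t \<longleftrightarrow> q \<cdot> t = 0"
    and q2: "\<forall>w\<in>words m j. q \<cdot> wmap w = 0" and q3: "\<forall>w\<in>words m j. \<rho> w \<in> Hom C S (wobj w)"
    and \<pi>: "\<pi> = (\<Sum>w\<in>words m j. wmap w \<cdot> \<rho> w)"
    using spanned_cokernel[of "words m j" wmap wobj "TY m", OF finite_words words_wmap_in_Hom] .
  note qw = bspec[OF q2]
  note qD = is_cokernelD[OF q] and fH = sesD(4)
  have "Fil (Suc m) (Suc j) W ((f \<boxtimes> idm C (TY m)) \<cdot> a)"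
    if a: "a \<in> Hom C W (X \<otimes> TY m)" and z: "(idm C Y \<boxtimes> q) \<cdot> ((f \<boxtimes> idm C (TY m)) \<cdot> a) = 0" for W a
  proof -
    note xq = tensm_in_Hom[OF idm_in_Hom[of X] qD(2)] and yq = tensm_in_Hom[OF idm_in_Hom[of Y] qD(2)]
    note ft = tensm_in_Hom[OF fH idm_in_Hom[of "TY m"]] and fq = tensm_in_Hom[OF fH idm_in_Hom[of Q]]
    \<comment> \<open>The maps \<open>f\<close> and \<open>q\<close> act on different factors, so
      they can be interchanged. Since \<open>f \<boxtimes> idm C Q\<close> is monic,
      \<open>idm C X \<boxtimes> q\<close> already kills \<open>a\<close>, and as
      \<open>X \<otimes> -\<close> preserves the cokernel, \<open>a\<close> lifts locally to
      \<open>X \<otimes> S\<close>.\<close>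
    have "(f \<boxtimes> idm C Q) \<cdot> ((idm C X \<boxtimes> q) \<cdot> a) = 0"
      using z comp_assoc[OF a ft yq] comp_assoc[OF a xq fq] tensm_id_split[OF fH qD(2)] by simp
    then have "(idm C X \<boxtimes> q) \<cdot> a = 0"
      using monic_zero[OF tens_monic_right[OF sesD(1)] comp_in_Hom[OF a xq]] by simp
    then obtain W' e s where s: "epic C W' W e" "s \<in> Hom C W' (X \<otimes> S)" "(idm C X \<boxtimes> \<pi>) \<cdot> s = a \<cdot> e"
      using exact_at_lift[OF cokernel_exact[OF tens_cokernel_left[OF q]] a] by metis
    note xp = tensm_in_Hom[OF idm_in_Hom[of X] qD(1)]
    have "((f \<boxtimes> idm C (TY m)) \<cdot> a) \<cdot> e = (f \<boxtimes> \<pi>) \<cdot> s"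
      using comp_assoc[OF epic_in_Hom[OF s(1)] a ft] comp_assoc[OF s(2) xp ft] s(3)
        tensm_id_split(1)[OF fH qD(1)] by simp
    also have "Fil (Suc m) (Suc j) W' \<dots>"
      using Fil_letter[OF q3, of s W' True] s(2) by (simp add: letter_def \<pi>)
    finally show ?thesis using Fil_local[OF s(1), of _ "Suc m"] comp_in_Hom[OF a ft] by simp
  qed
  note int = this
  show thesis by (rule that[OF qD(2) qw int])
qed

lemma sum_factor:
  assumes "\<phi> \<in> Hom C A T" "\<And>i. i \<in> I \<Longrightarrow> \<exists>a\<in>Hom C W A. s i = \<phi> \<cdot> a"
  shows "\<exists>a\<in>Hom C W A. sum s I = \<phi> \<cdot> a"
proof -
  obtain a where a: "\<And>i. i \<in> I \<Longrightarrow> a i \<in> Hom C W A" "\<And>i. i \<in> I \<Longrightarrow> s i = \<phi> \<cdot> a i"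
    using assms(2) by metis
  have "sum s I = (\<Sum>i\<in>I. \<phi> \<cdot> a i)" by (rule sum.cong[OF refl a(2)])
  also have "\<dots> = \<phi> \<cdot> sum a I" by (rule comp_sum_right[symmetric, OF a(1) assms(1)])
  finally show ?thesis using sum_in_Hom[of I a W A, OF a(1)] by (rule bexI)
qed

text \<open>On the \<open>j\<close>-th graded piece let \<open>P\<^sub>k\<close> be the projection onto the words with an \<open>X\<close> in position \<open>k\<close>.
  Then \<open>P\<^sub>k = c\<^sup>k P\<^sub>0 c\<^bsup>-k\<^esup>\<close> and \<open>\<Sum>\<^sub>k P\<^sub>k = j\<close>, so that an invariant \<open>t\<close> satisfies
  \<open>j t = \<Sum>\<^sub>k c\<^sup>k P\<^sub>0 t\<close>.  Below, \<open>y k\<close> represents \<open>P\<^sub>k t\<close>.\<close>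

lemma invariant_graded_is_norm:
  assumes n: "n = Suc m" and j: "of_nat j \<noteq> (0 :: 'k)"
    and t: "Fil n j W t" and d: "Fil n (Suc j) W (t - cyc C Y n \<cdot> t)"
  shows "\<exists>W' e y. epic C W' W e \<and> Fil n j W' y \<and>
    Fil n (Suc j) W' (t \<cdot> e - (\<Sum>k<n. endo_pow C (TY n) (cyc C Y n) k) \<cdot> y)"
proof (rule Fil_intersection[of m j])
  let ?E = "endo_pow C (TY n) (cyc C Y n)" and ?f1 = "f \<boxtimes> idm C (TY m)"
  fix Q q assume q: "q \<in> Hom C (TY m) Q" and qw: "\<And>w. w \<in> words m j \<Longrightarrow> q \<cdot> wmap w = 0"
    and int: "\<And>W a. a \<in> Hom C W (X \<otimes> TY m) \<Longrightarrow> (idm C Y \<boxtimes> q) \<cdot> (?f1 \<cdot> a) = 0 \<Longrightarrow>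
       Fil (Suc m) (Suc j) W (?f1 \<cdot> a)"
  note c = cyc_in_Hom[of Y n] and tH = Fil_in_Hom[OF t]
  note E = endo_pow_in_Hom[OF c]
  have f1: "?f1 \<in> Hom C (X \<otimes> TY m) (TY n)" unfolding n using tensm_in_Hom[OF sesD(4) idm_in_Hom] by simp
  have yq: "idm C Y \<boxtimes> q \<in> Hom C (TY n) (Y \<otimes> Q)" unfolding n using tensm_in_Hom[OF idm_in_Hom q] by simp
  \<comment> \<open>Deleting the first letter leaves at least \<open>j\<close> letters
    \<open>X\<close> in two cases: a word of \<open>F_j\<close> that begins with \<open>Y\<close>,
    or any word of \<open>F_{j+1}\<close>. Both are therefore killed by
    \<open>idm C Y \<boxtimes> q\<close>.\<close>
  have qFalse: "(idm C Y \<boxtimes> q) \<cdot> wmap (False # w) = 0" if "w \<in> words m j" for w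
    using tensm_comp[OF idm_in_Hom idm_in_Hom words_wmap_in_Hom[OF that] q] qw[OF that]
      tensm_zero_right[OF comp_in_Hom[OF idm_in_Hom idm_in_Hom]] by simp
  have qTrue: "(idm C Y \<boxtimes> q) \<cdot> wmap (True # w) = 0" if "w \<in> words m j" for w
    using tensm_comp[OF sesD(4) idm_in_Hom words_wmap_in_Hom[OF that] q] qw[OF that]
      tensm_zero_right[OF comp_in_Hom[OF sesD(4) idm_in_Hom]] by simp
  have qFil: "(idm C Y \<boxtimes> q) \<cdot> s = 0" if s: "Fil n (Suc j) V s" for V s
  proof -
    obtain V' e \<sigma> where e: "epic C V' V e" and \<sigma>: "\<forall>w\<in>words n (Suc j). \<sigma> w \<in> Hom C V' (wobj w)"
      and eq: "s \<cdot> e = (\<Sum>w\<in>words n (Suc j). wmap w \<cdot> \<sigma> w)" using Fil_decompose[OF s] .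
    have "((idm C Y \<boxtimes> q) \<cdot> s) \<cdot> e = (\<Sum>w\<in>words n (Suc j). (idm C Y \<boxtimes> q) \<cdot> (wmap w \<cdot> \<sigma> w))"
      unfolding comp_assoc[OF epic_in_Hom[OF e] Fil_in_Hom[OF s] yq] eq
      by (rule comp_sum_right[OF _ yq]) (rule comp_in_Hom[OF bspec[OF \<sigma>] words_wmap_in_Hom])
    also have "\<dots> = 0"
    proof (rule sum.neutral, rule ballI)
      fix w assume w: "w \<in> words n (Suc j)"
      then obtain b v where v: "w = b # v" "v \<in> words m j" unfolding n words_def by (cases w) (auto split: if_splits)
      have "(idm C Y \<boxtimes> q) \<cdot> wmap w = 0" using qTrue[OF v(2)] qFalse[OF v(2)] v(1) by (cases b) auto
      then show "(idm C Y \<boxtimes> q) \<cdot> (wmap w \<cdot> \<sigma> w) = 0"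
        using comp_assoc[OF bspec[OF \<sigma> w] words_wmap_in_Hom[OF w] yq] comp_zero_left[OF bspec[OF \<sigma> w]] by simp
    qed
    finally show ?thesis using epic_zero[OF e comp_in_Hom[OF Fil_in_Hom[OF s] yq]] by simp
  qed
  obtain W' e \<tau> where e: "epic C W' W e" and \<tau>w: "\<forall>w\<in>words n j. \<tau> w \<in> Hom C W' (wobj w)"
    and eq: "t \<cdot> e = (\<Sum>w\<in>words n j. wmap w \<cdot> \<tau> w)" using Fil_decompose[OF t] .
  note \<tau> = bspec[OF \<tau>w] and eH = epic_in_Hom[OF e]
  note teH = comp_in_Hom[OF eH tH]
  define y where "y k = (\<Sum>w\<in>{w\<in>words n j. w ! k}. wmap w \<cdot> \<tau> w)" for k
  \<comment> \<open>The complementary part of \<open>t\<close>: the words with a \<open>Y\<close> in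
    position \<open>k\<close>.\<close>
  define z where "z k = (\<Sum>w\<in>{w\<in>words n j. \<not> w ! k}. wmap w \<cdot> \<tau> w)" for k
  have yz: "t \<cdot> e = y k + z k" for k
    unfolding eq y_def z_def using finite_words
    by (subst sum.union_disjoint[symmetric]) (auto intro: sum.cong)
  have gen: "Fil n j W' (wmap w \<cdot> \<tau> w)" if "w \<in> words n j" for w using Fil_wmap[OF that \<tau>[OF that]] .
  have y: "Fil n j W' (y k)" and z: "Fil n j W' (z k)" for k
    unfolding y_def z_def by (rule Fil_sum, rule gen, simp)+
  note yH = Fil_in_Hom[OF y] and zH = Fil_in_Hom[OF z]
  \<comment> \<open>Position \<open>k\<close> is rotated to the front. If it holds a
    \<open>Y\<close>, the tail \<open>v\<close> keeps all \<open>j\<close> letters \<open>X\<close>;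
    if it holds an \<open>X\<close>, no bound on the tail is recorded, which is the value
    \<open>0\<close>.\<close>
  have rot: "\<exists>v \<kappa>. v \<in> words m (if w ! k then 0 else j) \<and> \<kappa> \<in> Hom C W' (wobj ((w ! k) # v)) \<and>
      ?E (n - k) \<cdot> (wmap w \<cdot> \<tau> w) = wmap ((w ! k) # v) \<cdot> \<kappa>" if w: "w \<in> words n j" and k: "k < n" for w k
  proof -
    have lw: "length w = n" "w \<noteq> []" using w k by (auto simp: words_def)
    have "hd (rotate k w) = w ! k" using lw k by (simp add: hd_rotate_conv_nth)
    then obtain v where v: "rotate k w = (w ! k) # v" using lw by (cases "rotate k w") auto
    obtain \<kappa> where \<kappa>: "\<kappa> \<in> Hom C (wobj w) (wobj (rotate k w))" "?E (n - k) \<cdot> wmap w = wmap (rotate k w) \<cdot> \<kappa>"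
      using cyc_pow_wmap[OF lw(2,1) less_imp_le[OF k]] by (elim bexE)
    have r: "rotate k w \<in> words n j" using rotate_words[OF w] .
    have "?E (n - k) \<cdot> (wmap w \<cdot> \<tau> w) = wmap (rotate k w) \<cdot> (\<kappa> \<cdot> \<tau> w)"
      using comp_assoc[OF \<tau>[OF w] words_wmap_in_Hom[OF w] E[of "n - k"]] \<kappa>(2)
        comp_assoc[OF \<tau>[OF w] \<kappa>(1) words_wmap_in_Hom[OF r]] by simp
    moreover have "v \<in> words m (if w ! k then 0 else j)" using r v unfolding n words_def by auto
    ultimately show ?thesis
      using comp_in_Hom[OF \<tau>[OF w] \<kappa>(1)] unfolding v by (intro exI conjI)
  qed
  have yA: "\<exists>a\<in>Hom C W' (X \<otimes> TY m). ?E (n - k) \<cdot> y k = ?f1 \<cdot> a" if k: "k < n" for k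
  proof -
    have "?E (n - k) \<cdot> y k = (\<Sum>w\<in>{w\<in>words n j. w ! k}. ?E (n - k) \<cdot> (wmap w \<cdot> \<tau> w))"
      unfolding y_def by (rule comp_sum_right[OF _ E]) (use \<tau> comp_in_Hom words_wmap_in_Hom in blast)
    moreover have "\<exists>a\<in>Hom C W' (X \<otimes> TY m). \<dots> = ?f1 \<cdot> a"
    proof (rule sum_factor[OF f1])
      fix w assume "w \<in> {w\<in>words n j. w ! k}"
      then have w: "w \<in> words n j" "w ! k = True" by auto
      obtain v \<kappa> where v: "v \<in> words m 0" "\<kappa> \<in> Hom C W' (X \<otimes> wobj v)"
        "?E (n - k) \<cdot> (wmap w \<cdot> \<tau> w) = wmap (True # v) \<cdot> \<kappa>"
        using rot[OF w(1) k] w(2) by auto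
      note xv = tensm_in_Hom[OF idm_in_Hom[of X] words_wmap_in_Hom[OF v(1)]]
      have "?E (n - k) \<cdot> (wmap w \<cdot> \<tau> w) = ?f1 \<cdot> ((idm C X \<boxtimes> wmap v) \<cdot> \<kappa>)"
        using v(3) tensm_id_split(1)[OF sesD(4) words_wmap_in_Hom[OF v(1)]] comp_assoc[OF v(2) xv f1] by simp
      then show "\<exists>a\<in>Hom C W' (X \<otimes> TY m). ?E (n - k) \<cdot> (wmap w \<cdot> \<tau> w) = ?f1 \<cdot> a"
        using comp_in_Hom[OF v(2) xv] by (rule bexI)
    qed
    ultimately show ?thesis by simp
  qed
  have zB: "(idm C Y \<boxtimes> q) \<cdot> (?E (n - k) \<cdot> z k) = 0" if k: "k < n" for k
  proof -
    have 1: "?E (n - k) \<cdot> z k = (\<Sum>w\<in>{w\<in>words n j. \<not> w ! k}. ?E (n - k) \<cdot> (wmap w \<cdot> \<tau> w))"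
      unfolding z_def by (rule comp_sum_right[OF _ E]) (use \<tau> comp_in_Hom words_wmap_in_Hom in blast)
    have "(idm C Y \<boxtimes> q) \<cdot> (?E (n - k) \<cdot> z k)
        = (\<Sum>w\<in>{w\<in>words n j. \<not> w ! k}. (idm C Y \<boxtimes> q) \<cdot> (?E (n - k) \<cdot> (wmap w \<cdot> \<tau> w)))"
      unfolding 1 by (rule comp_sum_right[OF _ yq]) (use \<tau> comp_in_Hom E words_wmap_in_Hom in blast)
    also have "\<dots> = 0"
    proof (rule sum.neutral, rule ballI)
      fix w assume "w \<in> {w\<in>words n j. \<not> w ! k}"
      then have w: "w \<in> words n j" "w ! k = False" by auto
      obtain v \<kappa> where v: "v \<in> words m j" "\<kappa> \<in> Hom C W' (wobj (False # v))"
        "?E (n - k) \<cdot> (wmap w \<cdot> \<tau> w) = wmap (False # v) \<cdot> \<kappa>"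
        using rot[OF w(1) k] unfolding w(2) if_False by (elim exE conjE)
      have vH: "wmap (False # v) \<in> Hom C (wobj (False # v)) (TY n)"
        using wmap_in_Hom[of "False # v"] v(1) unfolding n words_def by simp
      show "(idm C Y \<boxtimes> q) \<cdot> (?E (n - k) \<cdot> (wmap w \<cdot> \<tau> w)) = 0"
        unfolding v(3) using comp_assoc[OF v(2) vH yq] qFalse[OF v(1)] comp_zero_left[OF v(2)] by simp
    qed
    finally show ?thesis .
  qed
  have En: "?E n = idm C (TY n)" by (rule cyc_order)
  have te: "Fil n (Suc j) W' (t \<cdot> e - ?E k \<cdot> (t \<cdot> e))" if "k \<le> n" for k
    using Fil_comp[OF Fil_diff_cyc_pow[OF tH d that] eH] comp_diff_left[OF eH tH comp_in_Hom[OF tH E[of k]]]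
      comp_assoc[OF eH tH E[of k]] by simp
  \<comment> \<open>Both \<open>y 0\<close> and \<open>c^{n-k} (y k)\<close> come from
    \<open>X \<otimes> Y^{\<otimes>m}\<close>. Their difference is \<open>t - c^{n-k} t\<close>,
    which lies in \<open>F_{j+1}\<close> by invariance, minus \<open>z 0 - c^{n-k} (z k)\<close>;
    both are killed by \<open>idm C Y \<boxtimes> q\<close>, so the intersection property
    \<open>int\<close> applies.\<close>
  have dk: "Fil n (Suc j) W' (y 0 - ?E (n - k) \<cdot> y k)" if k: "k < n" for k
  proof -
    have "0 < n" using n by simp
    obtain a0 where a0: "a0 \<in> Hom C W' (X \<otimes> TY m)" "y 0 = ?f1 \<cdot> a0"
      using yA[OF \<open>0 < n\<close>] En idm_comp[OF yH] by auto
    obtain a where a: "a \<in> Hom C W' (X \<otimes> TY m)" "?E (n - k) \<cdot> y k = ?f1 \<cdot> a" using yA[OF k] by (elim bexE)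
    have A: "y 0 - ?E (n - k) \<cdot> y k = ?f1 \<cdot> (a0 - a)" using comp_diff_right[OF a0(1) a(1) f1] a0(2) a(2) by simp
    have z0: "(idm C Y \<boxtimes> q) \<cdot> z 0 = 0" using zB[OF \<open>0 < n\<close>] En idm_comp[OF zH] by simp
    note Ey = comp_in_Hom[OF yH[of k] E[of "n - k"]] and Ez = comp_in_Hom[OF zH[of k] E[of "n - k"]]
    have "?E (n - k) \<cdot> (t \<cdot> e) = ?E (n - k) \<cdot> y k + ?E (n - k) \<cdot> z k"
      using comp_add_right[OF yH[of k] zH[of k] E[of "n - k"]] yz[of k] by simp
    then have "y 0 - ?E (n - k) \<cdot> y k = (t \<cdot> e - ?E (n - k) \<cdot> (t \<cdot> e)) - (z 0 - ?E (n - k) \<cdot> z k)"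
      using yz[of 0] by simp
    then have B: "(idm C Y \<boxtimes> q) \<cdot> (y 0 - ?E (n - k) \<cdot> y k) = 0"
      using comp_diff_right[OF Fil_in_Hom[OF te[of "n - k"]] diff_in_Hom[OF zH[of 0] Ez] yq]
        comp_diff_right[OF zH[of 0] Ez yq] qFil[OF te[of "n - k"]] z0 zB[OF k] by simp
    show ?thesis using int[OF diff_in_Hom[OF a0(1) a(1)] B[unfolded A], folded A n] .
  qed
  \<comment> \<open>Applying \<open>c^k\<close> undoes the rotation, because
    \<open>c^n = 1\<close>.\<close>
  have dk': "Fil n (Suc j) W' (?E k \<cdot> y 0 - y k)" if k: "k < n" for k
  proof -
    have "?E k \<cdot> (?E (n - k) \<cdot> y k) = y k"
      using comp_assoc[OF yH[of k] E[of "n - k"] E[of k]] endo_pow_add[OF c, of k "n - k"] k En idm_comp[OF yH] by simp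
    then show ?thesis
      using Fil_cyc_pow[OF dk[OF k] less_imp_le[OF k]] comp_diff_right[OF yH[of 0] comp_in_Hom[OF yH[of k] E[of "n - k"]] E[of k]]
      by simp
  qed
  let ?N = "\<Sum>k<n. ?E k"
  have N: "?N \<in> Hom C (TY n) (TY n)" by (rule sum_in_Hom) (rule E)
  have Ny: "Fil n (Suc j) W' (?N \<cdot> y 0 - (\<Sum>k<n. y k))"
    unfolding comp_sum_left[OF E yH] sum_subtractf[symmetric] by (rule Fil_sum) (simp add: dk')
  \<comment> \<open>A word enters \<open>y k\<close> exactly for the positions \<open>k\<close> that
    hold an \<open>X\<close>, so the sum over \<open>k\<close> weights it by its number of letters
    \<open>X\<close>.\<close>
  have count: "(\<Sum>k<n. if w ! k then s else 0) = scal C (of_nat (length (filter id w))) s"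
    if "w \<in> words n j" for w s
  proof -
    have l: "length (filter id w) = card {k. k < n \<and> w ! k}"
      using that by (simp add: words_def length_filter_conv_card)
    have "(\<Sum>k<n. if w ! k then s else 0) = (\<Sum>k\<in>{k. k < n \<and> w ! k}. s)"
      by (rule sum.mono_neutral_cong_right) auto
    also have "\<dots> = scal C (of_nat (length (filter id w))) s"
      unfolding l by (simp add: scale_sum_left[of "\<lambda>_. 1", simplified, symmetric])
    finally show ?thesis .
  qed
  have "(\<Sum>k<n. y k) = (\<Sum>w\<in>words n j. \<Sum>k<n. if w ! k then wmap w \<cdot> \<tau> w else 0)"
    unfolding y_def sum.inter_filter[OF finite_words] by (rule sum.swap)
  also have "\<dots> = (\<Sum>w\<in>words n j. scal C (of_nat (length (filter id w))) (wmap w \<cdot> \<tau> w))"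
    by (rule sum.cong[OF refl]) (rule count)
  finally have "(\<Sum>k<n. y k) - scal C (of_nat j) (t \<cdot> e)
      = (\<Sum>w\<in>words n j. scal C (of_nat (length (filter id w)) - of_nat j) (wmap w \<cdot> \<tau> w))"
    unfolding eq by (simp add: scale_sum_right sum_subtractf scale_left_diff_distrib)
  \<comment> \<open>The coefficient vanishes for words with exactly \<open>j\<close> letters
    \<open>X\<close>, and all other words of \<open>F_j\<close> belong to
    \<open>F_{j+1}\<close>.\<close>
  also have "Fil n (Suc j) W' \<dots>"
  proof (rule Fil_sum)
    fix w assume w: "w \<in> words n j"
    show "Fil n (Suc j) W' (scal C (of_nat (length (filter id w)) - of_nat j) (wmap w \<cdot> \<tau> w))"
    proof (cases "length (filter id w) = j")
      case True
      then show ?thesis using Fil_zero by simp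
    next
      case False
      then have "w \<in> words n (Suc j)" using w by (simp add: words_def)
      then show ?thesis using Fil_scal Fil_wmap \<tau>[OF w] by blast
    qed
  qed
  finally have "Fil n (Suc j) W' ((\<Sum>k<n. y k) - scal C (of_nat j) (t \<cdot> e))" .
  from Fil_add[OF Ny this] have "Fil n (Suc j) W' (?N \<cdot> y 0 - scal C (of_nat j) (t \<cdot> e))" by simp
  \<comment> \<open>Scaling by \<open>-1/j\<close> isolates \<open>t\<close>; the witness is
    \<open>y 0\<close> divided by \<open>j\<close>.\<close>
  then have "Fil n (Suc j) W' (scal C (- inverse (of_nat j)) (?N \<cdot> y 0 - scal C (of_nat j) (t \<cdot> e)))" by (rule Fil_scal)
  then have "Fil n (Suc j) W' (t \<cdot> e - ?N \<cdot> scal C (inverse (of_nat j)) (y 0))"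
    using j by (simp add: comp_scal_right[OF yH N] scale_right_diff_distrib)
  moreover have "Fil n j W' (scal C (inverse (of_nat j)) (y 0))" by (rule Fil_scal[OF y])
  ultimately show ?thesis using e by blast
qed

section \<open>The two ends of the filtration\<close>

lemma wmap_replicate_False:
  "wobj (replicate n False) = TY n" "wmap (replicate n False) = idm C (TY n)"
  by (induction n) (simp_all add: tensm_idm)

lemma wmap_replicate_True:
  "wobj (replicate n True) = tpow C X n" "wmap (replicate n True) = tpow_map C f n"
  by (induction n) simp_all

lemma words_top: "words n n = {replicate n True}"
proof -
  have "w = replicate n True" if "length w = n" "n \<le> length (filter id w)" for w
    using that
  proof (induction w arbitrary: n)
    case (Cons b w)
    have "b"
    proof (rule ccontr)
      assume "\<not> b"
      then have "length (filter id (b # w)) = length (filter id w)" by simp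
      then show False using length_filter_le[of id w] Cons.prems by (simp only: list.size)
    qed
    then show ?case using Cons by auto
  qed simp
  then show ?thesis by (auto simp: words_def)
qed

lemma Fil_top:
  assumes "Fil n n W t"
  shows "\<exists>W' e x. epic C W' W e \<and> x \<in> Hom C W' (tpow C X n) \<and> tpow_map C f n \<cdot> x = t \<cdot> e"
proof -
  obtain W' e \<tau> where "epic C W' W e" "\<forall>w\<in>words n n. \<tau> w \<in> Hom C W' (wobj w)"
    "t \<cdot> e = (\<Sum>w\<in>words n n. wmap w \<cdot> \<tau> w)" using Fil_decompose[OF assms] .
  then show ?thesis
    unfolding words_top by (intro exI[of _ W'] exI[of _ e] exI[of _ "\<tau> (replicate n True)"])
      (simp add: wmap_replicate_True)
qed

lemma Fil_tpow_map: "x \<in> Hom C W (tpow C X n) \<Longrightarrow> Fil n n W (tpow_map C f n \<cdot> x)"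
  using Fil_wmap[of "replicate n True" n n x W] by (simp add: words_top wmap_replicate_True)

text \<open>A letter \<open>X\<close> contributes a tensor factor \<open>g f = 0\<close>.\<close>

lemma tpow_map_wmap: "True \<in> set w \<Longrightarrow> tpow_map C g (length w) \<cdot> wmap w = 0"
proof (induction w)
  case (Cons b w)
  note gn = tpow_map_in_Hom[OF sesD(5), of "length w"] and wH = wmap_in_Hom[of w]
  show ?case
  proof (cases b)
    case True
    then show ?thesis
      using tensm_comp[OF sesD(4,5) wH gn] sesD(6) tensm_zero_left[OF comp_in_Hom[OF wH gn]] by simp
  next
    case False
    then show ?thesis
      using tensm_comp[OF idm_in_Hom sesD(5) wH gn] Cons tensm_zero_right[OF comp_in_Hom[OF idm_in_Hom sesD(5)]]
      by simp
  qed
qed simp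

lemma tpow_map_Fil:
  assumes t: "Fil n j W t" and "1 \<le> j"
  shows "tpow_map C g n \<cdot> t = 0"
proof -
  note gn = tpow_map_in_Hom[OF sesD(5), of n]
  obtain W' e \<tau> where e: "epic C W' W e" and \<tau>: "\<forall>w\<in>words n j. \<tau> w \<in> Hom C W' (wobj w)"
    and eq: "t \<cdot> e = (\<Sum>w\<in>words n j. wmap w \<cdot> \<tau> w)" using Fil_decompose[OF t] .
  have "(tpow_map C g n \<cdot> t) \<cdot> e = (\<Sum>w\<in>words n j. tpow_map C g n \<cdot> (wmap w \<cdot> \<tau> w))"
    unfolding comp_assoc[OF epic_in_Hom[OF e] Fil_in_Hom[OF t] gn] eq
    by (rule comp_sum_right[OF _ gn]) (rule comp_in_Hom[OF bspec[OF \<tau>] words_wmap_in_Hom])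
  also have "\<dots> = 0"
  proof (rule sum.neutral, rule ballI)
    fix w assume w: "w \<in> words n j"
    then have "filter id w \<noteq> []" using assms(2) unfolding words_def by auto
    then have "True \<in> set w" by (auto simp: filter_empty_conv)
    then have "tpow_map C g n \<cdot> wmap w = 0" using tpow_map_wmap w unfolding words_def by blast
    then show "tpow_map C g n \<cdot> (wmap w \<cdot> \<tau> w) = 0"
      using comp_assoc[OF bspec[OF \<tau> w] words_wmap_in_Hom[OF w] gn] comp_zero_left[OF bspec[OF \<tau> w]] by simp
  qed
  finally show ?thesis using epic_zero[OF e comp_in_Hom[OF Fil_in_Hom[OF t] gn]] by simp
qed

text \<open>Writing \<open>g_n\<close> for the \<open>n\<close>-th tensor power of \<open>g\<close>,
  the kernel of \<open>g \<otimes> g_n\<close> is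
  \<open>X \<otimes> Y^{\<otimes>n} + Y \<otimes> Ker g_n\<close>. The first summand is a word with
  one \<open>X\<close>, the second is covered by induction.\<close>

lemma Fil_1_of_kernel:
  "t \<in> Hom C W (TY n) \<Longrightarrow> tpow_map C g n \<cdot> t = 0 \<Longrightarrow> Fil n 1 W t"
proof (induction n arbitrary: W t)
  case 0
  then have "t = 0" using idm_comp[of t W "\<one>"] by simp
  show ?case unfolding \<open>t = 0\<close> by (rule Fil_zero)
next
  case (Suc n)
  let ?gn = "tpow_map C g n"
  note gn = tpow_map_in_Hom[OF sesD(5), of n]
  have t: "t \<in> Hom C W (Y \<otimes> TY n)" "(g \<boxtimes> ?gn) \<cdot> t = 0" using Suc.prems by simp_all
  note yg = tensm_in_Hom[OF idm_in_Hom[of Y] gn] and xg = tensm_in_Hom[OF idm_in_Hom[of X] gn]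
  note g1 = tensm_in_Hom[OF sesD(5) idm_in_Hom[of "tpow C Z n"]]
  note f1 = tensm_in_Hom[OF sesD(4) idm_in_Hom[of "TY n"]] and f2 = tensm_in_Hom[OF sesD(4) idm_in_Hom[of "tpow C Z n"]]
  \<comment> \<open>Right exactness puts the image of \<open>t\<close> in
    \<open>Y \<otimes> Z^{\<otimes>n}\<close> locally into
    \<open>X \<otimes> Z^{\<otimes>n}\<close>.\<close>
  have "(g \<boxtimes> idm C (tpow C Z n)) \<cdot> ((idm C Y \<boxtimes> ?gn) \<cdot> t) = 0"
    using t comp_assoc[OF t(1) yg g1] tensm_id_split(1)[OF sesD(5) gn] by simp
  then obtain W1 e1 v where v: "epic C W1 W e1" "v \<in> Hom C W1 (X \<otimes> tpow C Z n)"
    "(f \<boxtimes> idm C (tpow C Z n)) \<cdot> v = ((idm C Y \<boxtimes> ?gn) \<cdot> t) \<cdot> e1"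
    using exact_at_lift[OF cokernel_exact[OF tens_cokernel_right[OF exact_epic_cokernel[OF sesD(3,2)]]]
      comp_in_Hom[OF t(1) yg]] by metis
  obtain W2 e2 v' where v': "epic C W2 W1 e2" "v' \<in> Hom C W2 (X \<otimes> TY n)" "(idm C X \<boxtimes> ?gn) \<cdot> v' = v \<cdot> e2"
    using epi_pullback[OF tens_epic_left[OF tpow_map_epic[OF sesD(2)]] v(2)] .
  note e1 = epic_in_Hom[OF v(1)] and e2 = epic_in_Hom[OF v'(1)]
  define e where "e = e1 \<cdot> e2"
  have e: "epic C W2 W e" unfolding e_def by (rule epic_comp[OF v'(1) v(1)])
  note eH = epic_in_Hom[OF e]
  \<comment> \<open>\<open>v'\<close> lifts that element to
    \<open>X \<otimes> Y^{\<otimes>n}\<close>; the corrected \<open>t'\<close> is killed by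
    \<open>idm C Y \<boxtimes> ?gn\<close>.\<close>
  define t' where "t' = t \<cdot> e - (f \<boxtimes> idm C (TY n)) \<cdot> v'"
  note te = comp_in_Hom[OF eH t(1)] and fv = comp_in_Hom[OF v'(2) f1]
  have t': "t' \<in> Hom C W2 (Y \<otimes> TY n)" unfolding t'_def by (rule diff_in_Hom[OF te fv])
  have "(idm C Y \<boxtimes> ?gn) \<cdot> (t \<cdot> e) = (((idm C Y \<boxtimes> ?gn) \<cdot> t) \<cdot> e1) \<cdot> e2"
    using comp_assoc[OF eH t(1) yg] comp_assoc[OF e2 e1 comp_in_Hom[OF t(1) yg]] by (simp add: e_def)
  also have "\<dots> = (f \<boxtimes> idm C (tpow C Z n)) \<cdot> ((idm C X \<boxtimes> ?gn) \<cdot> v')"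
    unfolding v(3)[symmetric] v'(3) by (rule comp_assoc[OF e2 v(2) f2])
  also have "\<dots> = (idm C Y \<boxtimes> ?gn) \<cdot> ((f \<boxtimes> idm C (TY n)) \<cdot> v')"
    using comp_assoc[OF v'(2) xg f2] comp_assoc[OF v'(2) f1 yg] tensm_id_split[OF sesD(4) gn] by simp
  finally have z: "(idm C Y \<boxtimes> ?gn) \<cdot> t' = 0"
    unfolding t'_def using comp_diff_right[OF te fv yg] by simp
  obtain S \<pi> Q q \<rho> where q: "is_cokernel C S (TY n) \<pi> Q q"
    and q1: "\<forall>W. \<forall>t\<in>Hom C W (TY n). Fil n 1 W t \<longleftrightarrow> q \<cdot> t = 0"
    and q2: "\<forall>w\<in>words n 1. q \<cdot> wmap w = 0" and q3: "\<forall>w\<in>words n 1. \<rho> w \<in> Hom C S (wobj w)"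
    and \<pi>: "\<pi> = (\<Sum>w\<in>words n 1. wmap w \<cdot> \<rho> w)"
    using spanned_cokernel[of "words n 1" wmap wobj "TY n", OF finite_words words_wmap_in_Hom] .
  note qD = is_cokernelD[OF q]
  obtain K \<kappa> where \<kappa>: "is_kernel C (TY n) (tpow C Z n) ?gn K \<kappa>" using kernel_exists[OF gn] by blast
  note \<kappa>D = is_kernelD[OF \<kappa>]
  \<comment> \<open>The induction hypothesis is applied to the universal local element, the kernel
    inclusion \<open>\<kappa>\<close>. Thus \<open>q\<close> factors through \<open>?gn\<close>, and
    the vanishing of \<open>t'\<close> passes from \<open>?gn\<close> to \<open>q\<close> under
    \<open>Y \<otimes> -\<close>.\<close>
  have "q \<cdot> \<kappa> = 0" using q1 \<kappa>D(2) Suc.IH[OF \<kappa>D(2,3)] by blast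
  then obtain r where r: "r \<in> Hom C (tpow C Z n) Q" "r \<cdot> ?gn = q"
    using cokernel_factor[OF epic_cokernel_of_kernel[OF tpow_map_epic[OF sesD(2)] \<kappa>] qD(2)] by metis
  have "(idm C Y \<boxtimes> q) \<cdot> t' = (idm C Y \<boxtimes> r) \<cdot> ((idm C Y \<boxtimes> ?gn) \<cdot> t')"
    using comp_assoc[OF t' yg tensm_in_Hom[OF idm_in_Hom[of Y] r(1)]]
      tensm_comp[OF idm_in_Hom idm_in_Hom gn r(1)] r(2) comp_idm[OF idm_in_Hom] by simp
  then have "(idm C Y \<boxtimes> q) \<cdot> t' = 0"
    using z comp_zero_right[OF tensm_in_Hom[OF idm_in_Hom[of Y] r(1)]] by simp
  then obtain W3 e3 s where s: "epic C W3 W2 e3" "s \<in> Hom C W3 (Y \<otimes> S)" "(idm C Y \<boxtimes> \<pi>) \<cdot> s = t' \<cdot> e3"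
    using exact_at_lift[OF cokernel_exact[OF tens_cokernel_left[OF q]] t'] by metis
  have "Fil (Suc n) 1 W3 (t' \<cdot> e3)"
    using Fil_letter[OF q3, of s W3 False] s(2) unfolding s(3)[symmetric] by (simp add: \<pi> letter_def)
  then have "Fil (Suc n) 1 W2 t'" using Fil_local[OF s(1), of t' "Suc n"] t' by simp
  moreover have "Fil (Suc n) 1 W2 (wmap (True # replicate n False) \<cdot> v')"
    by (rule Fil_wmap) (simp_all add: words_def wmap_replicate_False v'(2))
  then have "Fil (Suc n) 1 W2 ((f \<boxtimes> idm C (TY n)) \<cdot> v')" by (simp add: wmap_replicate_False)
  ultimately have "Fil (Suc n) 1 W2 (t' + (f \<boxtimes> idm C (TY n)) \<cdot> v')" by (rule Fil_add)
  then have "Fil (Suc n) 1 W2 (t \<cdot> e)" unfolding t'_def by simp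
  then show ?case by (rule Fil_local[OF e Suc.prems(1)])
qed

end

section \<open>Powers of \<open>D\<close>\<close>

locale char_symmetric_tensor_category = symmetric_tensor_category C
  for C :: "('k::field, 'o, 'm::ab_group_add, 'z) symm_tensor_cat_scheme" (structure) +
  fixes p :: nat
  assumes p_CHAR: "p = CHAR('k)" and p_pos: "p > 0"
begin

abbreviation "T X \<equiv> tpow C X p"

abbreviation "dp i X \<equiv> Dpow C p X i"

lemma D_in_Hom: "idm C (T X) - cyc C X p \<in> Hom C (T X) (T X)"
  by (rule diff_in_Hom[OF idm_in_Hom cyc_in_Hom])

lemma dp_in_Hom: "dp i X \<in> Hom C (T X) (T X)"
  unfolding Dpow_def by (rule endo_pow_in_Hom[OF D_in_Hom])

lemma dp_1: "dp (Suc 0) X = idm C (T X) - cyc C X p"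
  by (simp add: Dpow_def comp_idm[OF D_in_Hom])

lemma dp_add: "dp (i + j) X = dp i X \<cdot> dp j X"
  unfolding Dpow_def by (rule endo_pow_add[OF D_in_Hom])

lemma dp_p: "dp p X = 0"
  unfolding Dpow_def endo_pow_one_minus_CHAR(1)[OF p_CHAR p_pos cyc_in_Hom] cyc_order by simp

lemma dp_norm: "dp (p - 1) X = (\<Sum>k<p. endo_pow C (T X) (cyc C X p) k)"
  unfolding Dpow_def by (rule endo_pow_one_minus_CHAR(2)[OF p_CHAR p_pos cyc_in_Hom])

lemma dp_dp: "x \<in> Hom C W (T X) \<Longrightarrow> dp i X \<cdot> (dp j X \<cdot> x) = dp (i + j) X \<cdot> x"
  unfolding dp_add using comp_assoc[OF _ dp_in_Hom dp_in_Hom] by simp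

lemma dp_dp_p: "x \<in> Hom C W (T X) \<Longrightarrow> i + j = p \<Longrightarrow> dp i X \<cdot> (dp j X \<cdot> x) = 0"
  using dp_dp[of x W X i j] dp_p comp_zero_left by simp

lemma tpow_map_dp:
  assumes f: "f \<in> Hom C X Y"
  shows "tpow_map C f p \<cdot> dp i X = dp i Y \<cdot> tpow_map C f p"
proof -
  note fp = tpow_map_in_Hom[OF f, of p]
  have "tpow_map C f p \<cdot> (idm C (T X) - cyc C X p) = (idm C (T Y) - cyc C Y p) \<cdot> tpow_map C f p"
    unfolding comp_diff_right[OF idm_in_Hom cyc_in_Hom fp] comp_diff_left[OF fp idm_in_Hom cyc_in_Hom]
      comp_idm[OF fp] idm_comp[OF fp] cyc_tpow_map[OF f] ..
  then show ?thesis unfolding Dpow_def by (rule endo_pow_commute[OF D_in_Hom D_in_Hom fp])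
qed

lemma tpow_map_dp_comp:
  assumes f: "f \<in> Hom C X Y" and x: "x \<in> Hom C W (T X)"
  shows "tpow_map C f p \<cdot> (dp i X \<cdot> x) = dp i Y \<cdot> (tpow_map C f p \<cdot> x)"
  using comp_assoc[OF x dp_in_Hom tpow_map_in_Hom[OF f], of i] comp_assoc[OF x tpow_map_in_Hom[OF f] dp_in_Hom, of i]
    tpow_map_dp[OF f, of i] by simp

end

section \<open>Acyclicity of the kernel of \<open>be\<close> modulo
  \<open>X^{\<otimes>p}\<close>\<close>

locale char_tensor_short_exact =
  char_symmetric_tensor_category C p + tensor_short_exact C X Y Z f g
  for C :: "('k::field, 'o, 'm::ab_group_add, 'z) symm_tensor_cat_scheme" (structure)
    and p :: nat and X Y Z :: 'o and f g :: 'm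
begin

definition "al = tpow_map C f p"

definition "be = tpow_map C g p"

lemma al: "al \<in> Hom C (T X) (T Y)" and be: "be \<in> Hom C (T Y) (T Z)"
  unfolding al_def be_def by (rule tpow_map_in_Hom[OF sesD(4)], rule tpow_map_in_Hom[OF sesD(5)])

lemma al_monic: "monic C (T X) (T Y) al" and be_epic: "epic C (T Y) (T Z) be"
  unfolding al_def be_def by (rule tpow_map_monic[OF sesD(1)], rule tpow_map_epic[OF sesD(2)])

lemma al_dp: "x \<in> Hom C W (T X) \<Longrightarrow> al \<cdot> (dp i X \<cdot> x) = dp i Y \<cdot> (al \<cdot> x)"
  unfolding al_def by (rule tpow_map_dp_comp[OF sesD(4)])

lemma be_dp: "x \<in> Hom C W (T Y) \<Longrightarrow> be \<cdot> (dp i Y \<cdot> x) = dp i Z \<cdot> (be \<cdot> x)"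
  unfolding be_def by (rule tpow_map_dp_comp[OF sesD(5)])

lemma be_al: "x \<in> Hom C W (T X) \<Longrightarrow> be \<cdot> (al \<cdot> x) = 0"
  using tpow_map_Fil[OF Fil_tpow_map[of x W p]] p_pos unfolding al_def be_def by simp

text \<open>The kernel of \<open>Y\<^bsup>\<otimes>p\<^esup> \<rightarrow> Z\<^bsup>\<otimes>p\<^esup>\<close> modulo \<open>X\<^bsup>\<otimes>p\<^esup>\<close> has no cohomology with respect to \<open>D\<close>.\<close>

lemma acyclic_1:
  assumes k: "k \<in> Hom C W (T Y)" "be \<cdot> k = 0" and x: "x \<in> Hom C W (T X)" "dp (Suc 0) Y \<cdot> k = al \<cdot> x"
  shows "\<exists>W' e k' x'. epic C W' W e \<and> k' \<in> Hom C W' (T Y) \<and> be \<cdot> k' = 0 \<and> x' \<in> Hom C W' (T X) \<and>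
    k \<cdot> e = dp (p - 1) Y \<cdot> k' + al \<cdot> x'"
proof -
  \<comment> \<open>Modulo norms of elements of the kernel of \<open>be\<close>, the element
    \<open>k\<close> is pushed down the filtration one step at a time until it reaches
    \<open>F_p\<close>.\<close>
  have claim: "\<exists>W' e y t. epic C W' W e \<and> y \<in> Hom C W' (T Y) \<and> be \<cdot> y = 0 \<and> Fil p j W' t \<and>
      k \<cdot> e = dp (p - 1) Y \<cdot> y + t" if "1 \<le> j" "j \<le> p" for j
    using that
  proof (induction j rule: nat_induct_at_least)
    case base
    have "Fil p 1 W k" using Fil_1_of_kernel[OF k(1)] k(2) unfolding be_def by simp
    then show ?case
      using epic_idm[of W] zero_in_Hom comp_zero_right[OF dp_in_Hom] comp_zero_right[OF be] comp_idm[OF k(1)]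
      by (intro exI[of _ W] exI[of _ "idm C W"] exI[of _ 0] exI[of _ k]) simp
  next
    case (Suc j)
    then obtain W1 e y t where e: "epic C W1 W e" and y: "y \<in> Hom C W1 (T Y)" "be \<cdot> y = 0"
      and t: "Fil p j W1 t" and eq: "k \<cdot> e = dp (p - 1) Y \<cdot> y + t" by auto
    note eH = epic_in_Hom[OF e] and tH = Fil_in_Hom[OF t]
    \<comment> \<open>\<open>D D^{p-1} = 0\<close>, so \<open>D t = D k\<close>. This comes from
      \<open>X^{\<otimes>p} = F_p\<close>, hence \<open>t\<close> is invariant modulo
      \<open>F_{j+1}\<close>.\<close>
    have "dp (Suc 0) Y \<cdot> t = dp (Suc 0) Y \<cdot> (k \<cdot> e) - dp (Suc 0) Y \<cdot> (dp (p - 1) Y \<cdot> y)"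
      using comp_add_right[OF comp_in_Hom[OF y(1) dp_in_Hom] tH dp_in_Hom] eq by simp
    also have "dp (Suc 0) Y \<cdot> (dp (p - 1) Y \<cdot> y) = 0"
      by (rule dp_dp_p[OF y(1)]) (use p_pos in simp)
    also have "dp (Suc 0) Y \<cdot> (k \<cdot> e) = al \<cdot> (x \<cdot> e)"
      by (rule comp_eq_restrict[OF x(2) k(1) dp_in_Hom x(1) al eH])
    finally have "t - cyc C Y p \<cdot> t = al \<cdot> (x \<cdot> e)"
      unfolding dp_1 comp_diff_left[OF tH idm_in_Hom cyc_in_Hom] idm_comp[OF tH] by simp
    then have "Fil p (Suc j) W1 (t - cyc C Y p \<cdot> t)"
      using Fil_mono[OF Suc.prems Fil_tpow_map[OF comp_in_Hom[OF eH x(1)]]] unfolding al_def by simp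
    \<comment> \<open>Here \<open>0 < j < p\<close> enters: \<open>p\<close> does not divide
      \<open>j\<close>.\<close>
    moreover have "of_nat j \<noteq> (0 :: 'k)"
      using Suc.hyps Suc.prems unfolding of_nat_eq_0_iff_char_dvd p_CHAR[symmetric] by (auto dest: dvd_imp_le)
    moreover obtain m where "p = Suc m" using p_pos by (cases p) auto
    ultimately obtain W2 e' y' where y': "epic C W2 W1 e'" "Fil p j W2 y'"
      "Fil p (Suc j) W2 (t \<cdot> e' - dp (p - 1) Y \<cdot> y')"
      using invariant_graded_is_norm[OF _ _ t] unfolding dp_norm by blast
    note e'H = epic_in_Hom[OF y'(1)] and y'H = Fil_in_Hom[OF y'(2)]
    have ye: "y \<cdot> e' \<in> Hom C W2 (T Y)" by (rule comp_in_Hom[OF e'H y(1)])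
    have "k \<cdot> (e \<cdot> e') = dp (p - 1) Y \<cdot> (y \<cdot> e' + y') + (t \<cdot> e' - dp (p - 1) Y \<cdot> y')"
      using comp_assoc[OF e'H eH k(1)] eq comp_add_left[OF e'H comp_in_Hom[OF y(1) dp_in_Hom[of _ "p - 1"]] tH]
        comp_assoc[OF e'H y(1) dp_in_Hom[of _ "p - 1"]] comp_add_right[OF ye y'H dp_in_Hom[of _ "p - 1"]] by simp
    moreover have "be \<cdot> (y \<cdot> e' + y') = 0"
      using comp_add_right[OF ye y'H be] comp_zero_restrict[OF y(2,1) be e'H]
        tpow_map_Fil[OF y'(2)] Suc.hyps unfolding be_def by simp
    ultimately show ?case
      using epic_comp[OF y'(1) e] add_in_Hom[OF ye y'H] y'(3)
      by (intro exI[of _ W2] exI[of _ "e \<cdot> e'"] exI[of _ "y \<cdot> e' + y'"]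
          exI[of _ "t \<cdot> e' - dp (p - 1) Y \<cdot> y'"] conjI)
  qed
  have "1 \<le> p" using p_pos by simp
  then obtain W1 e y t where e: "epic C W1 W e" and y: "y \<in> Hom C W1 (T Y)" "be \<cdot> y = 0"
    and t: "Fil p p W1 t" and eq: "k \<cdot> e = dp (p - 1) Y \<cdot> y + t" using claim[of p] by auto
  note eH = epic_in_Hom[OF e] and tH = Fil_in_Hom[OF t]
  obtain W2 e' x' where x': "epic C W2 W1 e'" "x' \<in> Hom C W2 (T X)" "al \<cdot> x' = t \<cdot> e'"
    using Fil_top[OF t] unfolding al_def by (elim exE conjE)
  note e'H = epic_in_Hom[OF x'(1)]
  have "k \<cdot> (e \<cdot> e') = dp (p - 1) Y \<cdot> (y \<cdot> e') + al \<cdot> x'"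
    using comp_assoc[OF e'H eH k(1)] eq comp_add_left[OF e'H comp_in_Hom[OF y(1) dp_in_Hom[of _ "p - 1"]] tH]
      comp_assoc[OF e'H y(1) dp_in_Hom[of _ "p - 1"]] x'(3) by simp
  then show ?thesis
    using epic_comp[OF x'(1) e] comp_in_Hom[OF e'H y(1)] comp_zero_restrict[OF y(2,1) be e'H] x'(2)
    by (intro exI[of _ W2] exI[of _ "e \<cdot> e'"] exI[of _ "y \<cdot> e'"] exI[of _ x'] conjI)
qed

text \<open>Induction on \<open>i\<close>. The case \<open>1\<close>, applied to
  \<open>D^i k\<close>, gives \<open>D^i k = D^{p-1} k' + x'\<close>; then
  \<open>k - D^{p-1-i} k'\<close> satisfies the hypothesis for \<open>i\<close>, with
  \<open>x'\<close> in place of \<open>x\<close>. Admitting a right-hand side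
  \<open>al \<cdot> x\<close> rather than \<open>0\<close> keeps the induction going, and the
  connecting morphism is well defined for the same reason.\<close>

lemma acyclic:
  assumes "1 \<le> i" "i \<le> p" and k: "k \<in> Hom C W (T Y)" "be \<cdot> k = 0"
    and x: "x \<in> Hom C W (T X)" "dp i Y \<cdot> k = al \<cdot> x"
  shows "\<exists>W' e k' x'. epic C W' W e \<and> k' \<in> Hom C W' (T Y) \<and> be \<cdot> k' = 0 \<and> x' \<in> Hom C W' (T X) \<and>
    k \<cdot> e = dp (p - i) Y \<cdot> k' + al \<cdot> x'"
  using assms
proof (induction i arbitrary: W k x rule: nat_induct_at_least)
  case base
  then show ?case using acyclic_1[of k W x] by simp
next
  case (Suc i)
  define k1 where "k1 = dp i Y \<cdot> k"
  have k1: "k1 \<in> Hom C W (T Y)" unfolding k1_def by (rule comp_in_Hom[OF Suc.prems(2) dp_in_Hom])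
  have "be \<cdot> k1 = 0" unfolding k1_def using be_dp[OF Suc.prems(2)] Suc.prems(3) comp_zero_right[OF dp_in_Hom] by simp
  moreover have "dp (Suc 0) Y \<cdot> k1 = al \<cdot> x" unfolding k1_def using dp_dp[OF Suc.prems(2)] Suc.prems(5) by simp
  ultimately obtain W1 e k' x' where e: "epic C W1 W e" and k': "k' \<in> Hom C W1 (T Y)" "be \<cdot> k' = 0"
    and x': "x' \<in> Hom C W1 (T X)" and eq: "k1 \<cdot> e = dp (p - 1) Y \<cdot> k' + al \<cdot> x'"
    using acyclic_1[OF k1 _ Suc.prems(4)] by auto
  note eH = epic_in_Hom[OF e]
  define k2 where "k2 = k \<cdot> e - dp (p - Suc i) Y \<cdot> k'"
  note ke = comp_in_Hom[OF eH Suc.prems(2)] and dk = comp_in_Hom[OF k'(1) dp_in_Hom[of _ "p - Suc i"]]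
  have k2: "k2 \<in> Hom C W1 (T Y)" unfolding k2_def by (rule diff_in_Hom[OF ke dk])
  have "be \<cdot> k2 = 0"
    unfolding k2_def using comp_diff_right[OF ke dk be] comp_zero_restrict[OF Suc.prems(3,2) be eH]
      be_dp[OF k'(1)] k'(2) comp_zero_right[OF dp_in_Hom] by simp
  moreover have "dp i Y \<cdot> k2 = al \<cdot> x'"
  proof -
    have "dp i Y \<cdot> k2 = dp i Y \<cdot> (k \<cdot> e) - dp i Y \<cdot> (dp (p - Suc i) Y \<cdot> k')"
      unfolding k2_def by (rule comp_diff_right[OF ke dk dp_in_Hom])
    also have "dp i Y \<cdot> (dp (p - Suc i) Y \<cdot> k') = dp (p - 1) Y \<cdot> k'"
      using dp_dp[OF k'(1), of i "p - Suc i"] Suc.prems(1) by simp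
    also have "dp i Y \<cdot> (k \<cdot> e) = k1 \<cdot> e" unfolding k1_def by (rule comp_assoc[OF eH Suc.prems(2) dp_in_Hom, symmetric])
    finally show ?thesis using eq by simp
  qed
  ultimately obtain W2 e' k'' x'' where e': "epic C W2 W1 e'" and k'': "k'' \<in> Hom C W2 (T Y)" "be \<cdot> k'' = 0"
    and x'': "x'' \<in> Hom C W2 (T X)" and eq2: "k2 \<cdot> e' = dp (p - i) Y \<cdot> k'' + al \<cdot> x''"
    using Suc.IH[OF Suc_leD[OF Suc.prems(1)] k2 _ x'] by auto
  note e'H = epic_in_Hom[OF e']
  \<comment> \<open>\<open>D^{p-i} = D^{p-i-1} D\<close> merges the two corrections into a single
    preimage.\<close>
  define h where "h = k' \<cdot> e' + dp (Suc 0) Y \<cdot> k''"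
  note ke' = comp_in_Hom[OF e'H k'(1)] and dk'' = comp_in_Hom[OF k''(1) dp_in_Hom[of _ "Suc 0"]]
  have h: "h \<in> Hom C W2 (T Y)" unfolding h_def by (rule add_in_Hom[OF ke' dk''])
  have "be \<cdot> h = 0"
    unfolding h_def using comp_add_right[OF ke' dk'' be] comp_zero_restrict[OF k'(2,1) be e'H]
      be_dp[OF k''(1)] k''(2) comp_zero_right[OF dp_in_Hom] by simp
  moreover have "k \<cdot> (e \<cdot> e') = dp (p - Suc i) Y \<cdot> h + al \<cdot> x''"
  proof -
    have "dp (p - Suc i) Y \<cdot> (dp (Suc 0) Y \<cdot> k'') = dp (p - i) Y \<cdot> k''"
      using dp_dp[OF k''(1), of "p - Suc i" "Suc 0"] Suc.prems(1) by (simp add: Suc_diff_Suc)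
    then have "dp (p - Suc i) Y \<cdot> h = (dp (p - Suc i) Y \<cdot> k') \<cdot> e' + dp (p - i) Y \<cdot> k''"
      unfolding h_def comp_add_right[OF ke' dk'' dp_in_Hom] comp_assoc[OF e'H k'(1) dp_in_Hom] by simp
    moreover have "k2 \<cdot> e' = k \<cdot> (e \<cdot> e') - (dp (p - Suc i) Y \<cdot> k') \<cdot> e'"
      unfolding k2_def using comp_diff_left[OF e'H ke dk] comp_assoc[OF e'H eH Suc.prems(2)] by simp
    ultimately show ?thesis using eq2 by (simp add: algebra_simps)
  qed
  ultimately show ?case
    using epic_comp[OF e' e] h x''
    by (intro exI[of _ W2] exI[of _ "e \<cdot> e'"] exI[of _ h] exI[of _ x''] conjI)
qed

end

section \<open>Cohomology classes and the long exact sequence\<close>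

context abelian_category
begin

text \<open>\<open>R\<close> is a morphism given by its graph on local elements. Its value
  \<open>d\<close> on the identity of \<open>A\<close>, available after an epimorphism
  \<open>e\<close>, vanishes on the kernel of \<open>e\<close> by functionality and so descends to
  \<open>\<delta>\<close>. Closure under differences shows that \<open>\<delta>\<close> computes
  every related pair.\<close>

lemma local_relation_morphism:
  assumes typed: "\<And>W a b. R W a b \<Longrightarrow> a \<in> Hom C W A \<and> b \<in> Hom C W B"
    and restrict: "\<And>V W e a b. R W a b \<Longrightarrow> e \<in> Hom C V W \<Longrightarrow> R V (a \<cdot> e) (b \<cdot> e)"
    and diff: "\<And>W a b a' b'. R W a b \<Longrightarrow> R W a' b' \<Longrightarrow> R W (a - a') (b - b')"
    and functional: "\<And>W b. R W 0 b \<Longrightarrow> b = 0"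
    and total: "\<And>W a. a \<in> Hom C W A \<Longrightarrow> \<exists>W' e b. epic C W' W e \<and> R W' (a \<cdot> e) b"
  shows "\<exists>\<delta>\<in>Hom C A B. \<forall>W a b. R W a b \<longrightarrow> b = \<delta> \<cdot> a"
proof -
  obtain U e d where e: "epic C U A e" and R: "R U (idm C A \<cdot> e) d" using total[OF idm_in_Hom] by (elim exE conjE)
  note eH = epic_in_Hom[OF e]
  have Red: "R U e d" using R idm_comp[OF eH] by simp
  have d: "d \<in> Hom C U B" using typed[OF Red] by simp
  obtain K \<kappa> where \<kappa>: "is_kernel C U A e K \<kappa>" using kernel_exists[OF eH] by blast
  note \<kappa>D = is_kernelD[OF \<kappa>]
  have "d \<cdot> \<kappa> = 0" using restrict[OF Red \<kappa>D(2)] functional unfolding \<kappa>D(3) by blast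
  then obtain \<delta> where \<delta>: "\<delta> \<in> Hom C A B" "\<delta> \<cdot> e = d"
    using cokernel_factor[OF epic_cokernel_of_kernel[OF e \<kappa>] d] by metis
  have "b = \<delta> \<cdot> a" if Rab: "R W a b" for W a b
  proof -
    have ab: "a \<in> Hom C W A" "b \<in> Hom C W B" using typed[OF Rab] by auto
    obtain V \<epsilon> a' where a': "epic C V W \<epsilon>" "a' \<in> Hom C V U" "e \<cdot> a' = a \<cdot> \<epsilon>" using epi_pullback[OF e ab(1)] .
    note \<epsilon>H = epic_in_Hom[OF a'(1)]
    have "R V (a \<cdot> \<epsilon> - e \<cdot> a') (b \<cdot> \<epsilon> - d \<cdot> a')" by (rule diff[OF restrict[OF Rab \<epsilon>H] restrict[OF Red a'(2)]])
    then have "b \<cdot> \<epsilon> - d \<cdot> a' = 0" using functional[of V "b \<cdot> \<epsilon> - d \<cdot> a'"] a'(3) by simp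
    then have "b \<cdot> \<epsilon> = (\<delta> \<cdot> a) \<cdot> \<epsilon>"
      using comp_assoc[OF a'(2) eH \<delta>(1)] comp_assoc[OF \<epsilon>H ab(1) \<delta>(1)] a'(3) \<delta>(2) by simp
    then show ?thesis using epic_cancel[OF a'(1) ab(2) comp_in_Hom[OF ab(1) \<delta>(1)]] by simp
  qed
  then show ?thesis using \<delta>(1) by blast
qed

end

section \<open>Classes of local cycles\<close>

context char_symmetric_tensor_category
begin

lemma kerD_is_kernel: "is_kernel C (T X) (T X) (dp i X) (KerD C p i X) (kerD C p i X)"
  unfolding KerD_def kerD_def by (rule ker_is_kernel[OF dp_in_Hom])

lemma imD_factor:
  obtains e where "epic C (T X) (ImD C p j X) e" "imD C p j X \<cdot> e = dp j X"
    "monic C (ImD C p j X) (T X) (imD C p j X)"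
  unfolding ImD_def imD_def using image_factor[OF dp_in_Hom] .

text \<open>The definite description is justified by \<open>D^i D^{p-i} = D^p = 0\<close>, tested
  after the epimorphism onto the image.\<close>

lemma im_ker_incl:
  assumes "i \<le> p"
  shows "im_ker_incl C p i X \<in> Hom C (ImD C p (p - i) X) (KerD C p i X)"
    and "kerD C p i X \<cdot> im_ker_incl C p i X = imD C p (p - i) X"
proof -
  obtain e where e: "epic C (T X) (ImD C p (p - i) X) e" "imD C p (p - i) X \<cdot> e = dp (p - i) X"
    and m: "monic C (ImD C p (p - i) X) (T X) (imD C p (p - i) X)" using imD_factor .
  note mH = monic_in_Hom[OF m]
  have "(dp i X \<cdot> imD C p (p - i) X) \<cdot> e = 0"
    using comp_assoc[OF epic_in_Hom[OF e(1)] mH dp_in_Hom] e(2) dp_add[of X i "p - i"] dp_p assms by simp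
  then have z: "dp i X \<cdot> imD C p (p - i) X = 0" using epic_zero[OF e(1) comp_in_Hom[OF mH dp_in_Hom]] by simp
  have "\<exists>!j. j \<in> Hom C (ImD C p (p - i) X) (KerD C p i X) \<and> kerD C p i X \<cdot> j = imD C p (p - i) X"
    using kerD_is_kernel[of X i] mH z unfolding is_kernel_def by blast
  from theI'[OF this] show "im_ker_incl C p i X \<in> Hom C (ImD C p (p - i) X) (KerD C p i X)"
    and "kerD C p i X \<cdot> im_ker_incl C p i X = imD C p (p - i) X"
    unfolding im_ker_incl_def by auto
qed

lemma G_cokernel:
  assumes "i \<le> p"
  shows "is_cokernel C (ImD C p (p - i) X) (KerD C p i X) (im_ker_incl C p i X) (G C p i X) (G_proj C p i X)"
  unfolding G_def G_proj_def by (rule coker_is_cokernel[OF im_ker_incl(1)[OF assms]])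

definition cycle where "cycle i X W x \<longleftrightarrow> x \<in> Hom C W (T X) \<and> dp i X \<cdot> x = 0"

text \<open>The class in \<open>G\<^sub>i(X)\<close> of a local element of \<open>Ker D\<^sup>i\<close>.\<close>

definition cls where
  "cls i X W x = G_proj C p i X \<cdot> (THE u. u \<in> Hom C W (KerD C p i X) \<and> kerD C p i X \<cdot> u = x)"

lemma cls_kerD:
  assumes u: "u \<in> Hom C W (KerD C p i X)"
  shows "cls i X W (kerD C p i X \<cdot> u) = G_proj C p i X \<cdot> u"
proof -
  have "(THE v. v \<in> Hom C W (KerD C p i X) \<and> kerD C p i X \<cdot> v = kerD C p i X \<cdot> u) = u"
    by (rule the_equality) (use u monic_cancel[OF kernel_monic[OF kerD_is_kernel]] in auto)
  then show ?thesis unfolding cls_def by simp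
qed

lemma cycle_kerD: "u \<in> Hom C W (KerD C p i X) \<Longrightarrow> cycle i X W (kerD C p i X \<cdot> u)"
  unfolding cycle_def using is_kernelD[OF kerD_is_kernel[of X i]] comp_in_Hom[of u W] comp_assoc[of u W] comp_zero_left[of u W]
  by metis

lemma cycle_lift:
  assumes "cycle i X W x"
  obtains u where "u \<in> Hom C W (KerD C p i X)" "kerD C p i X \<cdot> u = x" "cls i X W x = G_proj C p i X \<cdot> u"
proof -
  obtain u where u: "u \<in> Hom C W (KerD C p i X)" "kerD C p i X \<cdot> u = x"
    using kernel_factor[OF kerD_is_kernel[of X i]] assms unfolding cycle_def by metis
  then show thesis using that cls_kerD[OF u(1)] by simp
qed

lemma cycle_in_Hom: "cycle i X W x \<Longrightarrow> x \<in> Hom C W (T X)"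
  by (simp add: cycle_def)

lemma cycle_diff: "cycle i X W x \<Longrightarrow> cycle i X W y \<Longrightarrow> cycle i X W (x - y)"
  unfolding cycle_def using comp_diff_right[of x W "T X" y "dp i X" "T X"] diff_in_Hom[of x W "T X" y] dp_in_Hom
  by simp

lemma cycle_comp: "cycle i X W x \<Longrightarrow> e \<in> Hom C V W \<Longrightarrow> cycle i X V (x \<cdot> e)"
  unfolding cycle_def using comp_zero_restrict[of "dp i X" x W "T X" "T X" e V] comp_in_Hom[of e V W x "T X"] dp_in_Hom
  by simp

lemma cycle_boundary: "i \<le> p \<Longrightarrow> y \<in> Hom C W (T X) \<Longrightarrow> cycle i X W (dp (p - i) X \<cdot> y)"
  unfolding cycle_def using dp_dp_p[of y W X i "p - i"] comp_in_Hom[OF _ dp_in_Hom, of y W X "p - i"] by simp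

lemma cycle_tpow_map: "f \<in> Hom C X Y \<Longrightarrow> cycle i X W x \<Longrightarrow> cycle i Y W (tpow_map C f p \<cdot> x)"
  unfolding cycle_def
  using tpow_map_dp_comp[of f X Y x W i, symmetric] comp_in_Hom[OF _ tpow_map_in_Hom[of f X Y p], of x W]
    comp_zero_right[OF tpow_map_in_Hom[of f X Y p]] by simp

context
  fixes i :: nat
  assumes i: "i \<le> p"
begin

lemma G_proj_in_Hom: "G_proj C p i X \<in> Hom C (KerD C p i X) (G C p i X)"
  using is_cokernelD(2)[OF G_cokernel[OF i]] .

lemma cls_in_Hom: "cycle i X W x \<Longrightarrow> cls i X W x \<in> Hom C W (G C p i X)"
  by (rule cycle_lift[of i X W x]) (auto intro: comp_in_Hom G_proj_in_Hom)

lemma cls_comp: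
  assumes "cycle i X W x" "e \<in> Hom C V W"
  shows "cls i X V (x \<cdot> e) = cls i X W x \<cdot> e"
proof -
  obtain u where u: "u \<in> Hom C W (KerD C p i X)" "kerD C p i X \<cdot> u = x" "cls i X W x = G_proj C p i X \<cdot> u"
    using cycle_lift[OF assms(1)] .
  note k = is_kernelD(2)[OF kerD_is_kernel[of X i]]
  show ?thesis
    using cls_kerD[OF comp_in_Hom[OF assms(2) u(1)]] comp_assoc[OF assms(2) u(1) k]
      comp_assoc[OF assms(2) u(1) G_proj_in_Hom] u(2,3) by simp
qed

lemma cls_diff:
  assumes "cycle i X W x" "cycle i X W y"
  shows "cls i X W (x - y) = cls i X W x - cls i X W y"
proof -
  obtain u where u: "u \<in> Hom C W (KerD C p i X)" "kerD C p i X \<cdot> u = x" "cls i X W x = G_proj C p i X \<cdot> u"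
    using cycle_lift[OF assms(1)] .
  obtain v where v: "v \<in> Hom C W (KerD C p i X)" "kerD C p i X \<cdot> v = y" "cls i X W y = G_proj C p i X \<cdot> v"
    using cycle_lift[OF assms(2)] .
  note k = is_kernelD(2)[OF kerD_is_kernel[of X i]]
  show ?thesis
    using cls_kerD[OF diff_in_Hom[OF u(1) v(1)]] comp_diff_right[OF u(1) v(1) k]
      comp_diff_right[OF u(1) v(1) G_proj_in_Hom] u(2,3) v(2,3) by simp
qed

lemma cls_surj:
  assumes h: "h \<in> Hom C W (G C p i X)"
  obtains W' e x where "epic C W' W e" "cycle i X W' x" "cls i X W' x = h \<cdot> e"
proof -
  obtain W' e u where u: "epic C W' W e" "u \<in> Hom C W' (KerD C p i X)" "G_proj C p i X \<cdot> u = h \<cdot> e"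
    using epi_pullback[OF cokernel_epic[OF G_cokernel[OF i]] h] .
  show thesis using that[OF u(1) cycle_kerD[OF u(2)]] cls_kerD[OF u(2)] u(3) by simp
qed

lemma cls_boundary:
  assumes y: "y \<in> Hom C W (T X)"
  shows "cls i X W (dp (p - i) X \<cdot> y) = 0"
proof -
  obtain e where e: "epic C (T X) (ImD C p (p - i) X) e" "imD C p (p - i) X \<cdot> e = dp (p - i) X"
    using imD_factor .
  note j = im_ker_incl[OF i, of X] and eH = epic_in_Hom[OF e(1)]
  note k = is_kernelD(2)[OF kerD_is_kernel[of X i]]
  note ey = comp_in_Hom[OF y eH]
  have "kerD C p i X \<cdot> (im_ker_incl C p i X \<cdot> (e \<cdot> y)) = dp (p - i) X \<cdot> y"
    using comp_assoc[OF ey j(1) k] comp_assoc[OF y eH comp_in_Hom[OF j(1) k]] j(2) e(2) by simp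
  then have "cls i X W (dp (p - i) X \<cdot> y) = G_proj C p i X \<cdot> (im_ker_incl C p i X \<cdot> (e \<cdot> y))"
    using cls_kerD[OF comp_in_Hom[OF ey j(1)]] by simp
  then show ?thesis
    using comp_assoc[OF ey j(1) G_proj_in_Hom] is_cokernelD(3)[OF G_cokernel[OF i]] comp_zero_left[OF ey] by simp
qed

text \<open>Two lifts, each at the cost of an epimorphism: into the image of \<open>D^{p-i}\<close>,
  and from there to the tensor power.\<close>

lemma cls_zero:
  assumes x: "cycle i X W x" and z: "cls i X W x = 0"
  obtains W' e y where "epic C W' W e" "y \<in> Hom C W' (T X)" "dp (p - i) X \<cdot> y = x \<cdot> e"
proof -
  obtain u where u: "u \<in> Hom C W (KerD C p i X)" "kerD C p i X \<cdot> u = x" "cls i X W x = G_proj C p i X \<cdot> u"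
    using cycle_lift[OF x] .
  note j = im_ker_incl[OF i, of X]
  note k = is_kernelD(2)[OF kerD_is_kernel[of X i]]
  have "G_proj C p i X \<cdot> u = 0" using u(3) z by simp
  then obtain W1 e1 v where v: "epic C W1 W e1" "v \<in> Hom C W1 (ImD C p (p - i) X)"
    "im_ker_incl C p i X \<cdot> v = u \<cdot> e1"
    using exact_at_lift[OF cokernel_exact[OF G_cokernel[OF i]] u(1)] by metis
  obtain e where e: "epic C (T X) (ImD C p (p - i) X) e" "imD C p (p - i) X \<cdot> e = dp (p - i) X"
    using imD_factor .
  obtain W2 e2 y where y: "epic C W2 W1 e2" "y \<in> Hom C W2 (T X)" "e \<cdot> y = v \<cdot> e2"
    using epi_pullback[OF e(1) v(2)] .
  note e1 = epic_in_Hom[OF v(1)] and e2 = epic_in_Hom[OF y(1)] and eH = epic_in_Hom[OF e(1)]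
  have "dp (p - i) X \<cdot> y = kerD C p i X \<cdot> ((im_ker_incl C p i X \<cdot> v) \<cdot> e2)"
    using comp_assoc[OF y(2) eH comp_in_Hom[OF j(1) k]] comp_assoc[OF e2 v(2) j(1)]
      comp_assoc[OF comp_in_Hom[OF e2 v(2)] j(1) k] j(2) e(2) y(3) by simp
  also have "\<dots> = x \<cdot> (e1 \<cdot> e2)"
    unfolding v(3) using comp_assoc[OF e2 e1 u(1)] comp_assoc[OF comp_in_Hom[OF e2 e1] u(1) k] u(2) by simp
  finally show thesis by (rule that[OF epic_comp[OF y(1) v(1)] y(2)])
qed

text \<open>The morphism \<open>u\<close> between kernels is unique and carries boundaries to
  boundaries. So the inner existential of \<open>G_map\<close> collapses, and the description picks
  out the induced map of cokernels. From here on \<open>G_map\<close> is handled through its action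
  on classes.\<close>

lemma G_map_cls:
  assumes f: "f \<in> Hom C X Y"
  shows "G_map C p i X Y f \<in> Hom C (G C p i X) (G C p i Y)"
    and "\<And>W x. cycle i X W x \<Longrightarrow> G_map C p i X Y f \<cdot> cls i X W x = cls i Y W (tpow_map C f p \<cdot> x)"
proof -
  note fp = tpow_map_in_Hom[OF f, of p]
  let ?K = "KerD C p i X" and ?L = "KerD C p i Y"
  note kX = is_kernelD(2)[OF kerD_is_kernel[of X i]] and kY = is_kernelD(2)[OF kerD_is_kernel[of Y i]]
  have "kerD C p i X \<cdot> idm C ?K = kerD C p i X" using comp_idm[OF kX] .
  then have cK: "cycle i X ?K (kerD C p i X)" using cycle_kerD[OF idm_in_Hom[of ?K]] by simp
  obtain u where u: "u \<in> Hom C ?K ?L" "kerD C p i Y \<cdot> u = tpow_map C f p \<cdot> kerD C p i X"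
    using cycle_lift[OF cycle_tpow_map[OF f cK]] by metis
  have uu: "v = u" if "v \<in> Hom C ?K ?L" "kerD C p i Y \<cdot> v = tpow_map C f p \<cdot> kerD C p i X" for v
    using monic_cancel[OF kernel_monic[OF kerD_is_kernel[of Y i]] that(1) u(1)] that(2) u(2) by simp
  note j = im_ker_incl[OF i, of X]
  obtain e where e: "epic C (T X) (ImD C p (p - i) X) e" "imD C p (p - i) X \<cdot> e = dp (p - i) X"
    using imD_factor .
  note eH = epic_in_Hom[OF e(1)]
  note pu = comp_in_Hom[OF u(1) G_proj_in_Hom]
  have "kerD C p i Y \<cdot> (u \<cdot> (im_ker_incl C p i X \<cdot> e)) = dp (p - i) Y \<cdot> tpow_map C f p"
    using comp_assoc[OF comp_in_Hom[OF eH j(1)] u(1) kY] u(2) comp_assoc[OF comp_in_Hom[OF eH j(1)] kX fp]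
      comp_assoc[OF eH j(1) kX] j(2) e(2) tpow_map_dp[OF f, of "p - i"] by simp
  then have "G_proj C p i Y \<cdot> (u \<cdot> (im_ker_incl C p i X \<cdot> e)) = 0"
    using cls_kerD[OF comp_in_Hom[OF comp_in_Hom[OF eH j(1)] u(1)]] cls_boundary[OF fp] by simp
  then have "((G_proj C p i Y \<cdot> u) \<cdot> im_ker_incl C p i X) \<cdot> e = 0"
    using comp_assoc[OF comp_in_Hom[OF eH j(1)] u(1) G_proj_in_Hom] comp_assoc[OF eH j(1) pu] by simp
  then have z: "(G_proj C p i Y \<cdot> u) \<cdot> im_ker_incl C p i X = 0"
    using epic_zero[OF e(1) comp_in_Hom[OF j(1) pu]] by simp
  have "\<exists>!h. h \<in> Hom C (G C p i X) (G C p i Y) \<and> h \<cdot> G_proj C p i X = G_proj C p i Y \<cdot> u"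
  proof (rule ex_ex1I)
    show "\<exists>h. h \<in> Hom C (G C p i X) (G C p i Y) \<and> h \<cdot> G_proj C p i X = G_proj C p i Y \<cdot> u"
      using cokernel_factor[OF G_cokernel[OF i] pu z] by metis
    show "h = h'" if "h \<in> Hom C (G C p i X) (G C p i Y) \<and> h \<cdot> G_proj C p i X = G_proj C p i Y \<cdot> u"
      "h' \<in> Hom C (G C p i X) (G C p i Y) \<and> h' \<cdot> G_proj C p i X = G_proj C p i Y \<cdot> u" for h h'
      using epic_cancel[OF cokernel_epic[OF G_cokernel[OF i]], of h X "G C p i Y" h'] that by simp
  qed
  note ex1 = this
  have eqv: "(\<exists>v\<in>Hom C ?K ?L. kerD C p i Y \<cdot> v = tpow_map C f p \<cdot> kerD C p i X \<and>
      h \<cdot> G_proj C p i X = G_proj C p i Y \<cdot> v) \<longleftrightarrow> h \<cdot> G_proj C p i X = G_proj C p i Y \<cdot> u" for h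
  proof
    assume "\<exists>v\<in>Hom C ?K ?L. kerD C p i Y \<cdot> v = tpow_map C f p \<cdot> kerD C p i X \<and>
      h \<cdot> G_proj C p i X = G_proj C p i Y \<cdot> v"
    then obtain v where v: "v \<in> Hom C ?K ?L" "kerD C p i Y \<cdot> v = tpow_map C f p \<cdot> kerD C p i X"
      "h \<cdot> G_proj C p i X = G_proj C p i Y \<cdot> v" by (elim bexE conjE)
    show "h \<cdot> G_proj C p i X = G_proj C p i Y \<cdot> u" using v(3) unfolding uu[OF v(1,2)] .
  next
    assume "h \<cdot> G_proj C p i X = G_proj C p i Y \<cdot> u"
    with u(2) show "\<exists>v\<in>Hom C ?K ?L. kerD C p i Y \<cdot> v = tpow_map C f p \<cdot> kerD C p i X \<and>
      h \<cdot> G_proj C p i X = G_proj C p i Y \<cdot> v" by (intro bexI[of _ u] conjI u(1))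
  qed
  have hh: "G_map C p i X Y f \<in> Hom C (G C p i X) (G C p i Y) \<and>
      G_map C p i X Y f \<cdot> G_proj C p i X = G_proj C p i Y \<cdot> u"
    unfolding G_map_def eqv by (rule theI'[OF ex1])
  note h = conjunct1[OF hh] conjunct2[OF hh]
  show "G_map C p i X Y f \<in> Hom C (G C p i X) (G C p i Y)" by (rule h(1))
  fix W x assume x: "cycle i X W x"
  obtain v where v: "v \<in> Hom C W ?K" "kerD C p i X \<cdot> v = x" "cls i X W x = G_proj C p i X \<cdot> v" using cycle_lift[OF x] .
  have "G_map C p i X Y f \<cdot> cls i X W x = G_proj C p i Y \<cdot> (u \<cdot> v)"
    using v(3) comp_assoc[OF v(1) G_proj_in_Hom h(1)] h(2) comp_assoc[OF v(1) u(1) G_proj_in_Hom] by simp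
  also have "\<dots> = cls i Y W (kerD C p i Y \<cdot> (u \<cdot> v))" by (rule cls_kerD[symmetric, OF comp_in_Hom[OF v(1) u(1)]])
  also have "kerD C p i Y \<cdot> (u \<cdot> v) = tpow_map C f p \<cdot> x"
    using comp_assoc[OF v(1) u(1) kY] u(2) comp_assoc[OF v(1) kX fp] v(2) by simp
  finally show "G_map C p i X Y f \<cdot> cls i X W x = cls i Y W (tpow_map C f p \<cdot> x)" .
qed

end

end

section \<open>Exactness in the middle and the connecting morphism\<close>

context char_tensor_short_exact
begin

lemmas Gf = G_map_cls[OF _ sesD(4), folded al_def] and Gg = G_map_cls[OF _ sesD(5), folded be_def]

lemmas cycle_al = cycle_tpow_map[OF sesD(4), folded al_def] and cycle_be = cycle_tpow_map[OF sesD(5), folded be_def]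

text \<open>The element \<open>z\<close> whose boundary trivialises the class lifts along the
  epimorphism \<open>be\<close>. Subtracting the boundary of the lift moves \<open>y\<close> into
  the kernel of \<open>be\<close>, where \<open>acyclic\<close> applies.\<close>

lemma cls_be_zero:
  assumes i: "i \<le> p" and y: "y \<in> Hom C W (T Y)" "cycle i Z W (be \<cdot> y)" and z: "cls i Z W (be \<cdot> y) = 0"
  obtains W' e y' where "epic C W' W e" "y' \<in> Hom C W' (T Y)" "be \<cdot> (y \<cdot> e - dp (p - i) Y \<cdot> y') = 0"
proof -
  obtain W1 e1 z where z: "epic C W1 W e1" "z \<in> Hom C W1 (T Z)" "dp (p - i) Z \<cdot> z = (be \<cdot> y) \<cdot> e1"
    using cls_zero[OF i y(2) z] .
  obtain W2 e2 y' where y': "epic C W2 W1 e2" "y' \<in> Hom C W2 (T Y)" "be \<cdot> y' = z \<cdot> e2"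
    using epi_pullback[OF be_epic z(2)] .
  note e1 = epic_in_Hom[OF z(1)] and e2 = epic_in_Hom[OF y'(1)]
  note e12 = comp_in_Hom[OF e2 e1]
  have "be \<cdot> (dp (p - i) Y \<cdot> y') = (dp (p - i) Z \<cdot> z) \<cdot> e2"
    using be_dp[OF y'(2)] y'(3) comp_assoc[OF e2 z(2) dp_in_Hom[of _ "p - i"]] by simp
  also have "\<dots> = be \<cdot> (y \<cdot> (e1 \<cdot> e2))"
    unfolding z(3) using comp_assoc[OF e2 e1 comp_in_Hom[OF y(1) be]] comp_assoc[OF e12 y(1) be] by simp
  finally have "be \<cdot> (y \<cdot> (e1 \<cdot> e2) - dp (p - i) Y \<cdot> y') = 0"
    using comp_diff_right[OF comp_in_Hom[OF e12 y(1)] comp_in_Hom[OF y'(2) dp_in_Hom[of _ "p - i"]] be] by simp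
  then show thesis by (rule that[OF epic_comp[OF y'(1) z(1)] y'(2)])
qed

text \<open>A class killed in \<open>Z\<close> is represented by a cycle \<open>k\<close> in the
  kernel of \<open>be\<close>. By \<open>acyclic\<close> with \<open>x = 0\<close> it is a boundary
  plus an element of \<open>X^{\<otimes>p}\<close>, and that element is a cycle because
  \<open>al\<close> is monic.\<close>

lemma middle_exact:
  assumes i: "1 \<le> i" "i \<le> p"
  shows "exact_at C (G C p i X) (G_map C p i X Y f) (G C p i Y) (G_map C p i Y Z g) (G C p i Z)"
proof (rule exact_atI[OF Gf(1)[OF i(2)] Gg(1)[OF i(2)]])
  let ?Gf = "G_map C p i X Y f" and ?Gg = "G_map C p i Y Z g"
  \<comment> \<open>A composite out of \<open>G_i(X)\<close> is tested on the universal class, the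
    identity, represented by a cycle after an epimorphism.\<close>
  obtain W e x where x: "epic C W (G C p i X) e" "cycle i X W x" "cls i X W x = idm C (G C p i X) \<cdot> e"
    using cls_surj[OF i(2) idm_in_Hom] .
  note xH = cycle_in_Hom[OF x(2)] and eH = epic_in_Hom[OF x(1)]
  have "?Gg \<cdot> (?Gf \<cdot> cls i X W x) = cls i Z W (be \<cdot> (al \<cdot> x))"
    using Gf(2)[OF i(2) x(2)] Gg(2)[OF i(2) cycle_al[OF x(2)]] by simp
  also have "\<dots> = cls i Z W (dp (p - i) Z \<cdot> 0)" using be_al[OF xH] comp_zero_right[OF dp_in_Hom] by simp
  also have "\<dots> = 0" by (rule cls_boundary[OF i(2) zero_in_Hom])
  finally have "(?Gg \<cdot> ?Gf) \<cdot> e = 0"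
    using x(3) idm_comp[OF eH] comp_assoc[OF eH Gf(1)[OF i(2)] Gg(1)[OF i(2)]] by simp
  then show "?Gg \<cdot> ?Gf = 0" using epic_zero[OF x(1) comp_in_Hom[OF Gf(1)[OF i(2)] Gg(1)[OF i(2)]]] by simp
next
  let ?Gf = "G_map C p i X Y f" and ?Gg = "G_map C p i Y Z g"
  fix W h assume h: "h \<in> Hom C W (G C p i Y)" "?Gg \<cdot> h = 0"
  obtain W1 e1 y where y: "epic C W1 W e1" "cycle i Y W1 y" "cls i Y W1 y = h \<cdot> e1" using cls_surj[OF i(2) h(1)] .
  note yH = cycle_in_Hom[OF y(2)] and e1 = epic_in_Hom[OF y(1)]
  have "cls i Z W1 (be \<cdot> y) = 0"
    using Gg(2)[OF i(2) y(2)] y(3) comp_zero_restrict[OF h(2,1) Gg(1)[OF i(2)] e1] by simp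
  then obtain W3 e23 y' where y': "epic C W3 W1 e23" "y' \<in> Hom C W3 (T Y)"
    "be \<cdot> (y \<cdot> e23 - dp (p - i) Y \<cdot> y') = 0"
    using cls_be_zero[OF i(2) yH cycle_be[OF y(2)]] by metis
  note e23 = epic_in_Hom[OF y'(1)]
  define k where "k = y \<cdot> e23 - dp (p - i) Y \<cdot> y'"
  have k: "k \<in> Hom C W3 (T Y)"
    unfolding k_def by (rule diff_in_Hom[OF comp_in_Hom[OF e23 yH] comp_in_Hom[OF y'(2) dp_in_Hom]])
  have "be \<cdot> k = 0" unfolding k_def by (rule y'(3))
  moreover have ck: "cycle i Y W3 k"
    unfolding k_def by (rule cycle_diff[OF cycle_comp[OF y(2) e23] cycle_boundary[OF i(2) y'(2)]])
  then have "dp i Y \<cdot> k = al \<cdot> 0" using comp_zero_right[OF al] by (simp add: cycle_def)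
  ultimately obtain W4 e4 k' x where k': "epic C W4 W3 e4" "k' \<in> Hom C W4 (T Y)" "x \<in> Hom C W4 (T X)"
    "k \<cdot> e4 = dp (p - i) Y \<cdot> k' + al \<cdot> x"
    using acyclic[OF i k _ zero_in_Hom] by blast
  note e4 = epic_in_Hom[OF k'(1)]
  have ax: "al \<cdot> x = k \<cdot> e4 - dp (p - i) Y \<cdot> k'" using k'(4) by simp
  have cax: "cycle i Y W4 (al \<cdot> x)"
    unfolding ax by (rule cycle_diff[OF cycle_comp[OF ck e4] cycle_boundary[OF i(2) k'(2)]])
  then have "al \<cdot> (dp i X \<cdot> x) = 0" using al_dp[OF k'(3)] by (simp add: cycle_def)
  then have cx: "cycle i X W4 x"
    using monic_zero[OF al_monic comp_in_Hom[OF k'(3) dp_in_Hom]] k'(3) by (simp add: cycle_def)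
  have "?Gf \<cdot> cls i X W4 x = cls i Y W4 (k \<cdot> e4)"
    unfolding Gf(2)[OF i(2) cx] ax
      cls_diff[OF i(2) cycle_comp[OF ck e4] cycle_boundary[OF i(2) k'(2)]] cls_boundary[OF i(2) k'(2)] by simp
  also have "\<dots> = cls i Y W3 k \<cdot> e4" by (rule cls_comp[OF i(2) ck e4])
  also have "cls i Y W3 k = cls i Y W1 y \<cdot> e23"
    unfolding k_def cls_diff[OF i(2) cycle_comp[OF y(2) e23] cycle_boundary[OF i(2) y'(2)]]
      cls_boundary[OF i(2) y'(2)] cls_comp[OF i(2) y(2) e23] by simp
  also have "\<dots> = h \<cdot> (e1 \<cdot> e23)" unfolding y(3) by (rule comp_assoc[OF e23 e1 h(1)])
  finally have "?Gf \<cdot> cls i X W4 x = h \<cdot> (e1 \<cdot> e23 \<cdot> e4)"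
    using comp_assoc[OF e4 comp_in_Hom[OF e23 e1] h(1)] comp_assoc[OF e4 e23 e1] by simp
  moreover have "epic C W4 W (e1 \<cdot> e23 \<cdot> e4)"
    using epic_comp[OF epic_comp[OF k'(1) y'(1)] y(1)] by simp
  ultimately show "\<exists>W' e x. epic C W' W e \<and> x \<in> Hom C W' (G C p i X) \<and> ?Gf \<cdot> x = h \<cdot> e"
    using cls_in_Hom[OF i(2) cx] by blast
qed

text \<open>The graph of the connecting morphism. The kernel of \<open>be\<close> is larger than
  \<open>X^{\<otimes>p}\<close>, so an arbitrary lift \<open>y\<close> of a cycle of
  \<open>Z\<close> does not qualify: \<open>D^i y\<close> has to come from
  \<open>X^{\<otimes>p}\<close> itself.\<close>

definition snake where
  "snake i W a b \<longleftrightarrow> (\<exists>y x. y \<in> Hom C W (T Y) \<and> x \<in> Hom C W (T X) \<and> dp i Y \<cdot> y = al \<cdot> x \<and>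
     a = cls i Z W (be \<cdot> y) \<and> b = cls (p - i) X W x)"

lemma snake_cycles:
  assumes "i \<le> p" "y \<in> Hom C W (T Y)" "x \<in> Hom C W (T X)" "dp i Y \<cdot> y = al \<cdot> x"
  shows "cycle i Z W (be \<cdot> y)" "cycle (p - i) X W x"
proof -
  show "cycle i Z W (be \<cdot> y)"
    unfolding cycle_def using be_dp[OF assms(2), of i, symmetric] assms(4) be_al[OF assms(3)] comp_in_Hom[OF assms(2) be] by simp
  have "al \<cdot> (dp (p - i) X \<cdot> x) = 0"
    using al_dp[OF assms(3), of "p - i"] assms(4)[symmetric] dp_dp_p[OF assms(2), of "p - i" i] assms(1) by simp
  then show "cycle (p - i) X W x"
    unfolding cycle_def using monic_zero[OF al_monic comp_in_Hom[OF assms(3) dp_in_Hom]] assms(3) by simp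
qed

text \<open>If the class of \<open>be \<cdot> y\<close> vanishes, a boundary moves \<open>y\<close>
  into the kernel of \<open>be\<close> without changing \<open>D^i y\<close>. There
  \<open>acyclic\<close> yields \<open>D^{p-i} k' + x'\<close>, and applying \<open>D^i\<close>
  exhibits \<open>x\<close> as the boundary \<open>D^i x'\<close>.\<close>

lemma snake_functional:
  assumes i: "1 \<le> i" "i \<le> p" and s: "snake i W 0 b"
  shows "b = 0"
proof -
  obtain y x where yx: "y \<in> Hom C W (T Y)" "x \<in> Hom C W (T X)" "dp i Y \<cdot> y = al \<cdot> x"
    "0 = cls i Z W (be \<cdot> y)" and b: "b = cls (p - i) X W x" using s unfolding snake_def by blast
  note cyc = snake_cycles[OF i(2) yx(1-3)]
  obtain W2 e12 y' where y': "epic C W2 W e12" "y' \<in> Hom C W2 (T Y)"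
    "be \<cdot> (y \<cdot> e12 - dp (p - i) Y \<cdot> y') = 0"
    using cls_be_zero[OF i(2) yx(1) cyc(1) yx(4)[symmetric]] .
  note e12 = epic_in_Hom[OF y'(1)]
  note ye = comp_in_Hom[OF e12 yx(1)] and dy' = comp_in_Hom[OF y'(2) dp_in_Hom[of _ "p - i"]]
  define k where "k = y \<cdot> e12 - dp (p - i) Y \<cdot> y'"
  have k: "k \<in> Hom C W2 (T Y)" unfolding k_def by (rule diff_in_Hom[OF ye dy'])
  have "be \<cdot> k = 0" unfolding k_def by (rule y'(3))
  moreover have "dp i Y \<cdot> k = al \<cdot> (x \<cdot> e12)"
    unfolding k_def using comp_diff_right[OF ye dy' dp_in_Hom[of _ i]] dp_dp_p[OF y'(2), of i "p - i"] i(2)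
      comp_eq_restrict[OF yx(3,1) dp_in_Hom yx(2) al e12] by simp
  ultimately obtain W3 e3 k' x' where k': "epic C W3 W2 e3" "k' \<in> Hom C W3 (T Y)" "x' \<in> Hom C W3 (T X)"
    "k \<cdot> e3 = dp (p - i) Y \<cdot> k' + al \<cdot> x'"
    using acyclic[OF i k _ comp_in_Hom[OF e12 yx(2)]] by blast
  note e3 = epic_in_Hom[OF k'(1)]
  note e123 = comp_in_Hom[OF e3 e12]
  have "al \<cdot> (x \<cdot> (e12 \<cdot> e3)) = dp i Y \<cdot> (k \<cdot> e3)"
    using comp_eq_restrict[OF \<open>dp i Y \<cdot> k = _\<close> k dp_in_Hom comp_in_Hom[OF e12 yx(2)] al e3]
      comp_assoc[OF e3 e12 yx(2)] by simp
  also have "\<dots> = al \<cdot> (dp i X \<cdot> x')"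
    unfolding k'(4) comp_add_right[OF comp_in_Hom[OF k'(2) dp_in_Hom] comp_in_Hom[OF k'(3) al] dp_in_Hom]
    using dp_dp_p[OF k'(2), of i "p - i"] i(2) al_dp[OF k'(3)] by simp
  finally have x: "x \<cdot> (e12 \<cdot> e3) = dp i X \<cdot> x'"
    by (rule monic_cancel[OF al_monic comp_in_Hom[OF e123 yx(2)] comp_in_Hom[OF k'(3) dp_in_Hom]])
  have "b \<cdot> (e12 \<cdot> e3) = cls (p - i) X W3 (dp (p - (p - i)) X \<cdot> x')"
    unfolding b cls_comp[OF diff_le_self cyc(2) e123, symmetric] x using i(2) by simp
  also have "\<dots> = 0" by (rule cls_boundary[OF diff_le_self k'(3)])
  finally show "b = 0"
    using epic_zero[OF epic_comp[OF k'(1) y'(1)], of b] cls_in_Hom[OF diff_le_self cyc(2)] b by blast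
qed

text \<open>For any lift \<open>y\<close> of a cycle, \<open>D^i y\<close> lies in the kernel of
  \<open>be\<close> and is killed by \<open>D^{p-i}\<close>. So \<open>acyclic\<close> for
  \<open>p - i\<close> writes it as \<open>D^i k' + x\<close> with \<open>k'\<close> in that kernel,
  and \<open>y - k'\<close> is the lift sought.\<close>

lemma snake_total:
  assumes i: "1 \<le> i" "i < p" and a: "a \<in> Hom C W (G C p i Z)"
  shows "\<exists>W' e b. epic C W' W e \<and> snake i W' (a \<cdot> e) b"
proof -
  have ip: "i \<le> p" using i(2) by simp
  obtain W1 e1 z where z: "epic C W1 W e1" "cycle i Z W1 z" "cls i Z W1 z = a \<cdot> e1" using cls_surj[OF ip a] .
  note zH = cycle_in_Hom[OF z(2)]
  obtain W2 e2 y where y: "epic C W2 W1 e2" "y \<in> Hom C W2 (T Y)" "be \<cdot> y = z \<cdot> e2" using epi_pullback[OF be_epic zH] .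
  note e1 = epic_in_Hom[OF z(1)] and e2 = epic_in_Hom[OF y(1)]
  define k where "k = dp i Y \<cdot> y"
  have k: "k \<in> Hom C W2 (T Y)" unfolding k_def by (rule comp_in_Hom[OF y(2) dp_in_Hom])
  have "be \<cdot> k = 0"
    unfolding k_def using be_dp[OF y(2)] y(3) cycle_comp[OF z(2) e2] by (simp add: cycle_def)
  moreover have "dp (p - i) Y \<cdot> k = al \<cdot> 0"
    unfolding k_def using dp_dp_p[OF y(2), of "p - i" i] ip comp_zero_right[OF al] by simp
  moreover have "1 \<le> p - i" "p - i \<le> p" using i by auto
  ultimately obtain W3 e3 k' x where k': "epic C W3 W2 e3" "k' \<in> Hom C W3 (T Y)" "be \<cdot> k' = 0" "x \<in> Hom C W3 (T X)"
    "k \<cdot> e3 = dp (p - (p - i)) Y \<cdot> k' + al \<cdot> x"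
    using acyclic[OF _ _ k _ zero_in_Hom] by blast
  note e3 = epic_in_Hom[OF k'(1)]
  note ye = comp_in_Hom[OF e3 y(2)] and e23 = comp_in_Hom[OF e3 e2]
  define y' where "y' = y \<cdot> e3 - k'"
  have y': "y' \<in> Hom C W3 (T Y)" unfolding y'_def by (rule diff_in_Hom[OF ye k'(2)])
  have "dp i Y \<cdot> y' = al \<cdot> x"
    unfolding y'_def comp_diff_right[OF ye k'(2) dp_in_Hom] using k'(5) ip comp_assoc[OF e3 y(2) dp_in_Hom[of _ i]]
    by (simp add: k_def)
  moreover have "be \<cdot> y' = z \<cdot> (e2 \<cdot> e3)"
    unfolding y'_def comp_diff_right[OF ye k'(2) be] using k'(3) comp_assoc[OF e3 y(2) be] y(3) comp_assoc[OF e3 e2 zH] by simp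
  then have "cls i Z W3 (be \<cdot> y') = a \<cdot> (e1 \<cdot> (e2 \<cdot> e3))"
    using cls_comp[OF ip z(2) e23] z(3) comp_assoc[OF e23 e1 a] by simp
  ultimately have "snake i W3 (a \<cdot> (e1 \<cdot> (e2 \<cdot> e3))) (cls (p - i) X W3 x)"
    unfolding snake_def using y' k'(4) by (intro exI[of _ y'] exI[of _ x]) simp
  then show ?thesis using epic_comp[OF epic_comp[OF k'(1) y(1)] z(1)] by blast
qed

lemma connecting_morphism:
  assumes i: "1 \<le> i" "i < p"
  shows "\<exists>\<delta>\<in>Hom C (G C p i Z) (G C p (p - i) X). \<forall>W a b. snake i W a b \<longrightarrow> b = \<delta> \<cdot> a"
proof (rule local_relation_morphism)
  have ip: "i \<le> p" using i(2) by simp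
  show "a \<in> Hom C W (G C p i Z) \<and> b \<in> Hom C W (G C p (p - i) X)" if s: "snake i W a b" for W a b
  proof -
    obtain y x where yx: "y \<in> Hom C W (T Y)" "x \<in> Hom C W (T X)" "dp i Y \<cdot> y = al \<cdot> x"
      "a = cls i Z W (be \<cdot> y)" "b = cls (p - i) X W x" using s unfolding snake_def by blast
    note cyc = snake_cycles[OF ip yx(1-3)]
    show ?thesis unfolding yx(4,5) using cls_in_Hom[OF ip cyc(1)] cls_in_Hom[OF diff_le_self cyc(2)] ..
  qed
  show "snake i V (a \<cdot> e) (b \<cdot> e)" if s: "snake i W a b" and e: "e \<in> Hom C V W" for V W e a b
  proof -
    obtain y x where yx: "y \<in> Hom C W (T Y)" "x \<in> Hom C W (T X)" "dp i Y \<cdot> y = al \<cdot> x"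
      "a = cls i Z W (be \<cdot> y)" "b = cls (p - i) X W x" using s unfolding snake_def by blast
    note cyc = snake_cycles[OF ip yx(1-3)]
    show ?thesis
      unfolding snake_def
    proof (intro exI conjI)
      show "y \<cdot> e \<in> Hom C V (T Y)" "x \<cdot> e \<in> Hom C V (T X)" using comp_in_Hom e yx by auto
      show "dp i Y \<cdot> (y \<cdot> e) = al \<cdot> (x \<cdot> e)" by (rule comp_eq_restrict[OF yx(3,1) dp_in_Hom yx(2) al e])
      show "a \<cdot> e = cls i Z V (be \<cdot> (y \<cdot> e))"
        unfolding yx(4) cls_comp[OF ip cyc(1) e, symmetric] comp_assoc[OF e yx(1) be] ..
      show "b \<cdot> e = cls (p - i) X V (x \<cdot> e)" unfolding yx(5) by (rule cls_comp[OF diff_le_self cyc(2) e, symmetric])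
    qed
  qed
  show "snake i W (a - a') (b - b')" if s: "snake i W a b" and s': "snake i W a' b'" for W a b a' b'
  proof -
    obtain y x where yx: "y \<in> Hom C W (T Y)" "x \<in> Hom C W (T X)" "dp i Y \<cdot> y = al \<cdot> x"
      "a = cls i Z W (be \<cdot> y)" "b = cls (p - i) X W x" using s unfolding snake_def by blast
    obtain y' x' where yx': "y' \<in> Hom C W (T Y)" "x' \<in> Hom C W (T X)" "dp i Y \<cdot> y' = al \<cdot> x'"
      "a' = cls i Z W (be \<cdot> y')" "b' = cls (p - i) X W x'" using s' unfolding snake_def by blast
    note cyc = snake_cycles[OF ip yx(1-3)] and cyc' = snake_cycles[OF ip yx'(1-3)]
    show ?thesis
      unfolding snake_def
    proof (intro exI conjI)
      show "y - y' \<in> Hom C W (T Y)" "x - x' \<in> Hom C W (T X)" using diff_in_Hom yx yx' by auto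
      show "dp i Y \<cdot> (y - y') = al \<cdot> (x - x')"
        unfolding comp_diff_right[OF yx(1) yx'(1) dp_in_Hom] comp_diff_right[OF yx(2) yx'(2) al] yx(3) yx'(3) ..
      show "a - a' = cls i Z W (be \<cdot> (y - y'))"
        unfolding yx(4) yx'(4) comp_diff_right[OF yx(1) yx'(1) be] by (rule cls_diff[OF ip cyc(1) cyc'(1), symmetric])
      show "b - b' = cls (p - i) X W (x - x')"
        unfolding yx(5) yx'(5) by (rule cls_diff[OF diff_le_self cyc(2) cyc'(2), symmetric])
    qed
  qed
  show "b = 0" if "snake i W 0 b" for W b using snake_functional[OF i(1) ip that] .
  show "\<exists>W' e b. epic C W' W e \<and> snake i W' (a \<cdot> e) b" if "a \<in> Hom C W (G C p i Z)" for W a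
    using snake_total[OF i that] .
qed

text \<open>At \<open>G_i(Z)\<close>: if \<open>x = D^i x'\<close>, subtracting \<open>x'\<close>
  from \<open>y\<close> makes it a cycle. At \<open>G_{p-i}(X)\<close>: an equation
  \<open>D^i y = x\<close> that trivialises the class of \<open>x\<close> in \<open>Y\<close> is
  itself an instance of \<open>snake\<close>.\<close>

lemma connecting_exact:
  assumes i: "1 \<le> i" "i < p"
  shows "\<exists>\<delta>. exact_at C (G C p i Y) (G_map C p i Y Z g) (G C p i Z) \<delta> (G C p (p - i) X) \<and>
    exact_at C (G C p i Z) \<delta> (G C p (p - i) X) (G_map C p (p - i) X Y f) (G C p (p - i) Y)"
proof -
  let ?i = "p - i"
  have ip: "i \<le> p" and ip': "?i \<le> p" and pp: "p - ?i = i" using i by auto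
  let ?Gg = "G_map C p i Y Z g" and ?Gf = "G_map C p ?i X Y f"
  note Ggi = Gg[OF ip] and Gfi = Gf[OF ip']
  obtain \<delta> where \<delta>: "\<delta> \<in> Hom C (G C p i Z) (G C p ?i X)" and sn: "\<And>W a b. snake i W a b \<Longrightarrow> b = \<delta> \<cdot> a"
    using connecting_morphism[OF i] by blast
  have \<delta>cls: "cls ?i X W x = \<delta> \<cdot> cls i Z W (be \<cdot> y)"
    if "y \<in> Hom C W (T Y)" "x \<in> Hom C W (T X)" "dp i Y \<cdot> y = al \<cdot> x" for W x y
    by (rule sn) (use that in \<open>auto simp: snake_def\<close>)
  have "exact_at C (G C p i Y) ?Gg (G C p i Z) \<delta> (G C p ?i X)"
  proof (rule exact_atI[OF Ggi(1) \<delta>])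
    obtain W e y where y: "epic C W (G C p i Y) e" "cycle i Y W y" "cls i Y W y = idm C (G C p i Y) \<cdot> e"
      using cls_surj[OF ip idm_in_Hom] .
    note yH = cycle_in_Hom[OF y(2)] and eH = epic_in_Hom[OF y(1)]
    \<comment> \<open>A cycle of \<open>Y\<close> is the instance \<open>x = 0\<close> of
      \<open>snake\<close>.\<close>
    have "dp i Y \<cdot> y = al \<cdot> 0" using y(2) comp_zero_right[OF al] by (simp add: cycle_def)
    from \<delta>cls[OF yH zero_in_Hom this] have "\<delta> \<cdot> (?Gg \<cdot> cls i Y W y) = cls ?i X W 0" using Ggi(2)[OF y(2)] by simp
    also have "\<dots> = 0" using cls_boundary[OF ip' zero_in_Hom, of X W] comp_zero_right[OF dp_in_Hom] by simp
    finally have "(\<delta> \<cdot> ?Gg) \<cdot> e = 0" using y(3) idm_comp[OF eH] comp_assoc[OF eH Ggi(1) \<delta>] by simp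
    then show "\<delta> \<cdot> ?Gg = 0" using epic_zero[OF y(1) comp_in_Hom[OF Ggi(1) \<delta>]] by simp
  next
    fix W h assume h: "h \<in> Hom C W (G C p i Z)" "\<delta> \<cdot> h = 0"
    obtain W1 e1 b where e1: "epic C W1 W e1" and b: "snake i W1 (h \<cdot> e1) b" using snake_total[OF i h(1)] by blast
    obtain y x where yx: "y \<in> Hom C W1 (T Y)" "x \<in> Hom C W1 (T X)" "dp i Y \<cdot> y = al \<cdot> x"
      "h \<cdot> e1 = cls i Z W1 (be \<cdot> y)" using b unfolding snake_def by blast
    note e1H = epic_in_Hom[OF e1] and cyc = snake_cycles[OF ip yx(1-3)]
    have "cls ?i X W1 x = 0" using \<delta>cls[OF yx(1-3)] yx(4)[symmetric] comp_zero_restrict[OF h(2,1) \<delta> e1H] by simp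
    then obtain W2 e2 x' where x': "epic C W2 W1 e2" "x' \<in> Hom C W2 (T X)" "dp i X \<cdot> x' = x \<cdot> e2"
      using cls_zero[OF ip' cyc(2)] unfolding pp by metis
    note e2H = epic_in_Hom[OF x'(1)]
    note ye = comp_in_Hom[OF e2H yx(1)] and ax = comp_in_Hom[OF x'(2) al]
    define y' where "y' = y \<cdot> e2 - al \<cdot> x'"
    have y': "y' \<in> Hom C W2 (T Y)" unfolding y'_def by (rule diff_in_Hom[OF ye ax])
    have "dp i Y \<cdot> y' = 0"
      unfolding y'_def comp_diff_right[OF ye ax dp_in_Hom]
      using comp_eq_restrict[OF yx(3,1) dp_in_Hom yx(2) al e2H] al_dp[OF x'(2), of i] x'(3) by simp
    then have cy': "cycle i Y W2 y'" using y' by (simp add: cycle_def)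
    have "be \<cdot> y' = (be \<cdot> y) \<cdot> e2"
      unfolding y'_def comp_diff_right[OF ye ax be] using be_al[OF x'(2)] comp_assoc[OF e2H yx(1) be] by simp
    then have "?Gg \<cdot> cls i Y W2 y' = cls i Z W1 (be \<cdot> y) \<cdot> e2"
      using Ggi(2)[OF cy'] cls_comp[OF ip cyc(1) e2H] by simp
    also have "\<dots> = h \<cdot> (e1 \<cdot> e2)" unfolding yx(4)[symmetric] by (rule comp_assoc[OF e2H e1H h(1)])
    finally show "\<exists>W' e x. epic C W' W e \<and> x \<in> Hom C W' (G C p i Y) \<and> ?Gg \<cdot> x = h \<cdot> e"
      using epic_comp[OF x'(1) e1] cls_in_Hom[OF ip cy'] by blast
  qed
  moreover have "exact_at C (G C p i Z) \<delta> (G C p ?i X) ?Gf (G C p ?i Y)"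
  proof (rule exact_atI[OF \<delta> Gfi(1)])
    obtain W1 e1 b where e1: "epic C W1 (G C p i Z) e1" and b: "snake i W1 (idm C (G C p i Z) \<cdot> e1) b"
      using snake_total[OF i idm_in_Hom] by blast
    note e1H = epic_in_Hom[OF e1]
    obtain y x where yx: "y \<in> Hom C W1 (T Y)" "x \<in> Hom C W1 (T X)" "dp i Y \<cdot> y = al \<cdot> x"
      "e1 = cls i Z W1 (be \<cdot> y)" using b unfolding snake_def idm_comp[OF e1H] by blast
    note cyc = snake_cycles[OF ip yx(1-3)]
    have "?Gf \<cdot> (\<delta> \<cdot> e1) = cls ?i Y W1 (dp (p - ?i) Y \<cdot> y)"
      using \<delta>cls[OF yx(1-3)] yx(4) Gfi(2)[OF cyc(2)] yx(3) pp by simp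
    also have "\<dots> = 0" by (rule cls_boundary[OF ip' yx(1)])
    finally have "(?Gf \<cdot> \<delta>) \<cdot> e1 = 0" using comp_assoc[OF e1H \<delta> Gfi(1)] by simp
    then show "?Gf \<cdot> \<delta> = 0" using epic_zero[OF e1 comp_in_Hom[OF \<delta> Gfi(1)]] by simp
  next
    fix W h assume h: "h \<in> Hom C W (G C p ?i X)" "?Gf \<cdot> h = 0"
    obtain W1 e1 x where x: "epic C W1 W e1" "cycle ?i X W1 x" "cls ?i X W1 x = h \<cdot> e1" using cls_surj[OF ip' h(1)] .
    note e1H = epic_in_Hom[OF x(1)] and xH = cycle_in_Hom[OF x(2)]
    have "cls ?i Y W1 (al \<cdot> x) = 0"
      using Gfi(2)[OF x(2)] x(3) comp_zero_restrict[OF h(2,1) Gfi(1) e1H] by simp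
    then obtain W2 e2 y where y: "epic C W2 W1 e2" "y \<in> Hom C W2 (T Y)" "dp i Y \<cdot> y = (al \<cdot> x) \<cdot> e2"
      using cls_zero[OF ip' cycle_al[OF x(2)]] unfolding pp by metis
    note e2H = epic_in_Hom[OF y(1)]
    have "dp i Y \<cdot> y = al \<cdot> (x \<cdot> e2)" using y(3) comp_assoc[OF e2H xH al] by simp
    note eq = this
    have "\<delta> \<cdot> cls i Z W2 (be \<cdot> y) = cls ?i X W1 x \<cdot> e2"
      using \<delta>cls[OF y(2) comp_in_Hom[OF e2H xH] eq] cls_comp[OF ip' x(2) e2H] by simp
    also have "\<dots> = h \<cdot> (e1 \<cdot> e2)" unfolding x(3) by (rule comp_assoc[OF e2H e1H h(1)])
    finally show "\<exists>W' e x. epic C W' W e \<and> x \<in> Hom C W' (G C p i Z) \<and> \<delta> \<cdot> x = h \<cdot> e"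
      using epic_comp[OF y(1) x(1)] cls_in_Hom[OF ip snake_cycles(1)[OF ip y(2) comp_in_Hom[OF e2H xH] eq]] by blast
  qed
  ultimately show ?thesis by blast
qed

end

theorem proposition3p6:
  fixes C :: "('k::alg_closed_field, 'o, 'm::ab_group_add) symm_tensor_cat"
    and X Y Z :: 'o and f g :: 'm and p i :: nat
  assumes "p = CHAR('k)" and "p > 0"
    and "symmetric_tensor_category C"
    and "short_exact C X f Y g Z"
    and "1 \<le> i" and "i \<le> p - 1"
  shows
    "(\<exists>\<delta> \<delta>'.
        exact_at C (G C p i X) (G_map C p i X Y f) (G C p i Y) (G_map C p i Y Z g) (G C p i Z) \<and>
        exact_at C (G C p i Y) (G_map C p i Y Z g) (G C p i Z) \<delta> (G C p (p - i) X) \<and>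
        exact_at C (G C p i Z) \<delta> (G C p (p - i) X) (G_map C p (p - i) X Y f) (G C p (p - i) Y) \<and>
        exact_at C (G C p (p - i) X) (G_map C p (p - i) X Y f) (G C p (p - i) Y)
          (G_map C p (p - i) Y Z g) (G C p (p - i) Z) \<and>
        exact_at C (G C p (p - i) Y) (G_map C p (p - i) Y Z g) (G C p (p - i) Z) \<delta>' (G C p i X) \<and>
        exact_at C (G C p (p - i) Z) \<delta>' (G C p i X) (G_map C p i X Y f) (G C p i Y))
     \<and>
     exact_at C (G C p i X) (G_map C p i X Y f) (G C p i Y) (G_map C p i Y Z g) (G C p i Z)
     \<and>
     (\<forall>S P Ss Ts. simple_object C S \<longrightarrow> biproduct C (G C p i X) (G C p i Z) P \<longrightarrow>
        composition_series C (G C p i Y) Ss \<longrightarrow> composition_series C P Ts \<longrightarrow>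
        occurrences C S Ss \<le> occurrences C S Ts)"
proof -
  interpret symmetric_tensor_category C by fact
  interpret char_tensor_short_exact C p X Y Z f g
    by unfold_locales (use assms in auto)
  have i: "1 \<le> i" "i < p" "i \<le> p" and i': "1 \<le> p - i" "p - i < p" "p - i \<le> p" and pp: "p - (p - i) = i"
    using assms(2,5,6) by auto
  obtain \<delta> where \<delta>: "exact_at C (G C p i Y) (G_map C p i Y Z g) (G C p i Z) \<delta> (G C p (p - i) X)"
    "exact_at C (G C p i Z) \<delta> (G C p (p - i) X) (G_map C p (p - i) X Y f) (G C p (p - i) Y)"
    using connecting_exact[OF i(1,2)] by blast
  \<comment> \<open>The second half of the period is the first half for \<open>p - i\<close>; since
    \<open>p - (p - i) = i\<close>, it ends at \<open>G_i(X)\<close> and closes up.\<close>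
  obtain \<delta>' where \<delta>': "exact_at C (G C p (p - i) Y) (G_map C p (p - i) Y Z g) (G C p (p - i) Z) \<delta>' (G C p i X)"
    "exact_at C (G C p (p - i) Z) \<delta>' (G C p i X) (G_map C p i X Y f) (G C p i Y)"
    using connecting_exact[OF i'(1,2)] unfolding pp by blast
  note m = middle_exact[OF i(1,3)] and m' = middle_exact[OF i'(1,3)]
  \<comment> \<open>Multiplicities in the biproduct add up, as it is an extension of
    \<open>G_i(Z)\<close> by \<open>G_i(X)\<close>.\<close>
  have "occurrences C S Ss \<le> occurrences C S Ts"
    if P: "biproduct C (G C p i X) (G C p i Z) P"
      and s: "composition_series C (G C p i Y) Ss" "composition_series C P Ts" for S P Ss Ts
  proof -
    obtain As where As: "composition_series C (G C p i X) As" using finite_length by blast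
    obtain Bs where Bs: "composition_series C (G C p i Z) Bs" using finite_length by blast
    obtain a b where ab: "short_exact C (G C p i X) a P b (G C p i Z)" using biproduct_short_exact[OF P] .
    show ?thesis
      using occurrences_exact_at[OF m As s(1) Bs] occurrences_short_exact[OF ab As s(2) Bs] by simp
  qed
  then show ?thesis using m m' \<delta> \<delta>' by blast
qed

end
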